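(* Let $1<\delta<\infty$ and let $u\in H^1(Q_R;\mathbb{R}^d)$ be a weak solution of $\mathcal L_\delta(u)=0$ in $Q_R$ for some $R\ge32$. Then for any $\ell\ge1$, $$\int_{Q_{R/2}}|\nabla u|^2\,dx\le\frac{C}{R^2}\int_{Q_R}|u|^2\,dx+\frac{C}{R^{2\ell}}\int_{Q_R}|\nabla u|^2\,dx,$$ where $C$ depends only on $d,\kappa_1,\kappa_2,\ell$ and $\omega$.
   Context: Let $d\ge2$. $\omega\subset\mathbb{R}^d$ is a connected, unbounded open set that is 1-periodic, with $\mathbb{R}^d\setminus\omega=\bigcup_k\overline F_k$, each $F_k$ a bounded Lipschitz domain with connected boundary, the $\overline F_k$ mutually disjoint, and $\min_{k\ne\ell}\operatorname{dist}(F_k,F_\ell)>0$; $F=\bigcup_kF_k$. $\Lambda_t(x)=t$ on $F$, $=1$ off $F$. $A=(a_{ij}^{\alpha\beta})$ is real, bounded measurable, 1-periodic, with $a_{ij}^{\alpha\beta}=a_{ji}^{\beta\alpha}=a_{\alpha j}^{i\beta}$ and $\kappa_1|\xi|^2\le a_{ij}^{\alpha\beta}\xi_i^\alpha\xi_j^\beta\le\kappa_2|\xi|^2$ for symmetric $\xi\in\mathbb{R}^{d\times d}$. $\mathcal L_\delta=-\operatorname{div}(\Lambda_{\delta^2}A\nabla)$; $u\in H^1(\Omega;\mathbb{R}^d)$ is a weak solution of $\mathcal L_\delta(u)=0$ in $\Omega$ if $\int_\Omega\Lambda_{\delta^2}A\nabla u\cdot\nabla v=0$ for all $v\in H^1_0(\Omega;\mathbb{R}^d)$.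 $Q_R=(-R/2,R/2)^d$. *)

theory Defs
  imports "HOL-Analysis.Analysis"
begin

definition partial :: "'n::finite \<Rightarrow> (real^'n \<Rightarrow> real) \<Rightarrow> real^'n \<Rightarrow> real" where
  "partial j f x = deriv (\<lambda>t. f (x + t *\<^sub>R axis j 1)) 0"

coinductive C_inf :: "(real^'n::finite) set \<Rightarrow> (real^'n \<Rightarrow> real) \<Rightarrow> bool" for S where
  "continuous_on S f \<Longrightarrow>
   (\<forall>j. \<exists>g. (\<forall>x\<in>S. ((\<lambda>t. f (x + t *\<^sub>R axis j 1)) has_real_derivative g x) (at 0)) \<and> C_inf S g)
   \<Longrightarrow> C_inf S f"

definition tsupport :: "(real^'n::finite \<Rightarrow> real) \<Rightarrow> (real^'n) set" where
  "tsupport f = closure {x. f x \<noteq> 0}"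

definition test_fn :: "(real^'n::finite) set \<Rightarrow> (real^'n \<Rightarrow> real) \<Rightarrow> bool" where
  "test_fn \<Omega> \<phi> \<longleftrightarrow> C_inf UNIV \<phi> \<and> compact (tsupport \<phi>) \<and> tsupport \<phi> \<subseteq> \<Omega>"

definition L2 :: "(real^'n::finite) set \<Rightarrow> (real^'n \<Rightarrow> real) \<Rightarrow> bool" where
  "L2 \<Omega> f \<longleftrightarrow> set_borel_measurable lebesgue \<Omega> f \<and> set_integrable lebesgue \<Omega> (\<lambda>x. (f x)\<^sup>2)"

definition weak_grad :: "(real^'n::finite) set \<Rightarrow> (real^'n \<Rightarrow> real^'n) \<Rightarrow> (real^'n \<Rightarrow> real^'n^'n) \<Rightarrow> bool" where
  "weak_grad \<Omega> u Du \<longleftrightarrow>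
     (\<forall>b. L2 \<Omega> (\<lambda>x. u x $ b)) \<and> (\<forall>b j. L2 \<Omega> (\<lambda>x. Du x $ b $ j)) \<and>
     (\<forall>b j \<phi>. test_fn \<Omega> \<phi> \<longrightarrow>
        (LINT x:\<Omega>|lebesgue. u x $ b * partial j \<phi> x) = - (LINT x:\<Omega>|lebesgue. Du x $ b $ j * \<phi> x))"

definition H1 :: "(real^'n::finite) set \<Rightarrow> (real^'n \<Rightarrow> real^'n) \<Rightarrow> bool" where
  "H1 \<Omega> u \<longleftrightarrow> (\<exists>Du. weak_grad \<Omega> u Du)"

definition cgrad :: "(real^'n::finite \<Rightarrow> real^'n) \<Rightarrow> real^'n \<Rightarrow> real^'n^'n" where
  "cgrad \<Phi> x = (\<chi> b j. partial j (\<lambda>y. \<Phi> y $ b) x)"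

definition H10 :: "(real^'n::finite) set \<Rightarrow> (real^'n \<Rightarrow> real^'n) \<Rightarrow> bool" where
  "H10 \<Omega> v \<longleftrightarrow> (\<exists>Dv. weak_grad \<Omega> v Dv \<and>
     (\<exists>\<Phi>::nat \<Rightarrow> real^'n \<Rightarrow> real^'n. (\<forall>k b. test_fn \<Omega> (\<lambda>x. \<Phi> k x $ b)) \<and>
        (\<lambda>k. LINT x:\<Omega>|lebesgue. (norm (\<Phi> k x - v x))\<^sup>2 + (norm (cgrad (\<Phi> k) x - Dv x))\<^sup>2)
          \<longlonglongrightarrow> 0))"

text \<open>Weak solution of -div(Lambda A grad u) = 0 in Omega; coefficient
  A x i j a b stands for a_{ij}^{ab}.\<close>
definition weak_solution ::
  "(real^'n::finite) set \<Rightarrow> (real^'n \<Rightarrow> real) \<Rightarrow> (real^'n \<Rightarrow> 'n \<Rightarrow> 'n \<Rightarrow> 'n \<Rightarrow> 'n \<Rightarrow> real)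
     \<Rightarrow> (real^'n \<Rightarrow> real^'n) \<Rightarrow> bool" where
  "weak_solution \<Omega> Lam A u \<longleftrightarrow> (\<exists>Du. weak_grad \<Omega> u Du \<and>
     (\<forall>v Dv. H10 \<Omega> v \<and> weak_grad \<Omega> v Dv \<longrightarrow>
        (LINT x:\<Omega>|lebesgue. Lam x *
           (\<Sum>i\<in>UNIV. \<Sum>j\<in>UNIV. \<Sum>a\<in>UNIV. \<Sum>b\<in>UNIV. A x i j a b * Du x $ b $ j * Dv x $ a $ i)) = 0))"

text \<open>Bounded Lipschitz domain: bounded, open, connected, nonempty; near each boundary point,
  after a rigid motion, the set is the region below the graph of a Lipschitz function of the
  remaining d-1 coordinates (h is independent of the k-th coordinate).\<close>
definition lipschitz_domain :: "(real^'n::finite) set \<Rightarrow> bool" where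
  "lipschitz_domain D \<longleftrightarrow> open D \<and> connected D \<and> D \<noteq> {} \<and> bounded D \<and>
     (\<forall>p\<in>frontier D. \<exists>r>0. \<exists>(Q::real^'n \<Rightarrow> real^'n) k h L.
        orthogonal_transformation Q \<and> L-lipschitz_on UNIV h \<and>
        (\<forall>y. h y = h (\<chi> i. if i = k then 0 else y $ i)) \<and>
        D \<inter> ball p r = {x \<in> ball p r. Q (x - p) $ k < h (Q (x - p))})"

definition int_vec :: "real^'n::finite \<Rightarrow> bool" where
  "int_vec z \<longleftrightarrow> (\<forall>i. z $ i \<in> \<int>)"

definition perforated :: "(real^'n::finite) set set \<Rightarrow> bool" where
  "perforated Fam \<longleftrightarrow>
     (\<forall>F\<in>Fam. lipschitz_domain F \<and> connected (frontier F)) \<and>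
     (\<forall>F\<in>Fam. \<forall>G\<in>Fam. F \<noteq> G \<longrightarrow> closure F \<inter> closure G = {}) \<and>
     (\<exists>c>0. \<forall>F\<in>Fam. \<forall>G\<in>Fam. F \<noteq> G \<longrightarrow> (\<forall>x\<in>F. \<forall>y\<in>G. c \<le> dist x y)) \<and>
     (let \<omega> = - (\<Union>F\<in>Fam. closure F) in
        open \<omega> \<and> connected \<omega> \<and> \<not> bounded \<omega> \<and>
        (\<forall>x z. int_vec z \<longrightarrow> (x + z \<in> \<omega> \<longleftrightarrow> x \<in> \<omega>)))"

definition Lambda :: "(real^'n::finite) set \<Rightarrow> real \<Rightarrow> real^'n \<Rightarrow> real" where
  "Lambda F t x = (if x \<in> F then t else 1)"

definition cube :: "real \<Rightarrow> (real^'n::finite) set" where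
  "cube R = box (- (R/2) *\<^sub>R One) ((R/2) *\<^sub>R One)"

definition elast_coeff :: "(real^'n::finite \<Rightarrow> 'n \<Rightarrow> 'n \<Rightarrow> 'n \<Rightarrow> 'n \<Rightarrow> real) \<Rightarrow> real \<Rightarrow> real \<Rightarrow> bool" where
  "elast_coeff A k1 k2 \<longleftrightarrow>
     (\<forall>i j a b. (\<lambda>x. A x i j a b) \<in> borel_measurable lebesgue) \<and>
     (\<exists>M. \<forall>x i j a b. \<bar>A x i j a b\<bar> \<le> M) \<and>
     (\<forall>x z. int_vec z \<longrightarrow> A (x + z) = A x) \<and>
     (\<forall>x i j a b. A x i j a b = A x j i b a \<and> A x i j a b = A x a j i b) \<and>
     (\<forall>x (\<xi>::real^'n^'n). transpose \<xi> = \<xi> \<longrightarrow>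
        k1 * (norm \<xi>)\<^sup>2 \<le> (\<Sum>i\<in>UNIV. \<Sum>j\<in>UNIV. \<Sum>a\<in>UNIV. \<Sum>b\<in>UNIV. A x i j a b * \<xi> $ i $ a * \<xi> $ j $ b) \<and>
        (\<Sum>i\<in>UNIV. \<Sum>j\<in>UNIV. \<Sum>a\<in>UNIV. \<Sum>b\<in>UNIV. A x i j a b * \<xi> $ i $ a * \<xi> $ j $ b) \<le> k2 * (norm \<xi>)\<^sup>2)"

end

theory Submission
  imports Defs "HOL-Computational_Algebra.Polynomial"
begin

text \<open>
  For \<open>R\<close> large a stronger inequality holds, without the second term on the right. Periodicity
  bounds the diameters of the inclusions uniformly, and they keep a positive mutual distance. Hence
  there is a smooth cutoff \<open>\<phi>\<close> with \<open>\<bar>\<nabla>\<phi>\<bar> \<le> K / R\<close> that is constant on every inclusion: replace a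
  Lipschitz cutoff near each inclusion by its value at one point of it and mollify at a fixed
  scale. Testing the equation with \<open>\<phi>\<^sup>2 u\<close>, the error terms contain \<open>\<nabla>\<phi>\<close> and are therefore not
  multiplied by the large factor \<open>\<delta>\<^sup>2\<close>, whereas the good term can only gain from it. This controls
  the symmetric gradient of \<open>u\<close> by \<open>u / R\<close> uniformly in \<open>\<delta>\<close>, and Korn's first inequality for
  \<open>\<phi> u\<close> recovers the full gradient. For bounded \<open>R\<close> the second term on the right is enough.
\<close>

section \<open>Mollifiers\<close>

text \<open>Two features of the hypotheses shape the proof. Periodicity is assumed of the connected
  set \<omega> only, not of the family of inclusions, so the bound on the diameters has to come from
  a topological fact: an integer translate of an inclusion is a connected subset of the union of the
  closures. And the weak formulation admits only fields in \<open>H10\<close>, limits of smooth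
  compactly supported ones, so the quadratic test field must be approximated together with its
  gradient. Mollifiers serve three times: they supply that approximation, they justify the exchange
  of derivatives behind Korn's inequality for fields with one weak derivative, and they smooth the
  cutoff. In the first two uses their scale tends to 0. In the third it is chosen from the gap
  between inclusions and does not depend on \<open>R\<close>, so an oscillation of order
  \<open>1 / R\<close> at that scale becomes a gradient of order \<open>1 / R\<close>. The threshold
  between bounded and large \<open>R\<close> depends on the inclusions alone, so the exponent enters
  the constant only through the bounded range.\<close>

definition flat :: "real poly \<Rightarrow> real \<Rightarrow> real" where
  "flat p t = (if t > 0 then poly p (1/t) * exp (- (1/t)) else 0)"

lemma poly_exp_tendsto_0: "((\<lambda>s. poly p s * exp (- s)) \<longlongrightarrow> (0::real)) at_top"
proof -
  have "((\<lambda>s. \<Sum>i\<le>degree p. coeff p i * (s ^ i / exp s)) \<longlongrightarrow> (\<Sum>i\<le>degree p. coeff p i * 0)) at_top"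
    by (intro tendsto_intros tendsto_power_div_exp_0)
  then show ?thesis
    by (simp add: poly_altdef sum_distrib_right exp_minus divide_inverse mult.assoc)
qed

text \<open>Differentiating \<open>poly p (1/t) * exp (- (1/t))\<close> gives \<open>1/t^2\<close>
  times \<open>p - pderiv p\<close> at \<open>1/t\<close>; \<open>[:0,0,1:]\<close> is that factor
  as a polynomial in \<open>1/t\<close>. At 0 the right difference quotient is a polynomial in
  \<open>s = 1/h\<close> times \<open>exp (- s)\<close>, which tends to 0, so one formula covers
  every \<open>t\<close>.\<close>

lemma flat_has_derivative:
  "(flat p has_real_derivative flat ([:0,0,1:] * (p - pderiv p)) t) (at t)"
proof (cases t "0::real" rule: linorder_cases)
  case less
  have "((\<lambda>_. 0) has_real_derivative 0) (at t)" by simp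
  then have "(flat p has_real_derivative 0) (at t)"
    by (rule has_field_derivative_transform_within_open[of _ _ _ "{..<0}"]) (use less in \<open>auto simp: flat_def\<close>)
  then show ?thesis using less by (simp add: flat_def)
next
  case greater
  have "((\<lambda>t. poly p (1/t) * exp (- (1/t))) has_real_derivative
     poly (pderiv p) (1/t) * (- 1 / t^2) * exp (- (1/t)) + poly p (1/t) * (exp (- (1/t)) * (1 / t^2))) (at t)"
    using greater by (auto intro!: derivative_eq_intros DERIV_chain2[OF poly_DERIV] simp: power2_eq_square field_simps)
  also have "poly (pderiv p) (1/t) * (- 1 / t^2) * exp (- (1/t)) + poly p (1/t) * (exp (- (1/t)) * (1 / t^2))
      = flat ([:0,0,1:] * (p - pderiv p)) t"
    using greater by (simp add: flat_def field_simps power2_eq_square)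
  finally show ?thesis
    by (rule has_field_derivative_transform_within_open[of _ _ _ "{0<..}"]) (use greater in \<open>auto simp: flat_def\<close>)
next
  case equal
  have "((\<lambda>h. flat p h / h) \<longlongrightarrow> 0) (at 0)"
  proof (rule filterlim_split_at)
    show "((\<lambda>h. flat p h / h) \<longlongrightarrow> 0) (at_left 0)"
      by (rule tendsto_eventually) (auto simp: flat_def eventually_at_filter)
    have "((\<lambda>h. poly ([:0,1:] * p) (inverse h) * exp (- inverse h)) \<longlongrightarrow> 0) (at_right (0::real))"
      using filterlim_compose[OF poly_exp_tendsto_0 filterlim_inverse_at_top_right] .
    then show "((\<lambda>h. flat p h / h) \<longlongrightarrow> 0) (at_right 0)"
      by (rule Lim_transform_eventually) (auto simp: flat_def eventually_at_filter field_simps)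
  qed
  then show ?thesis using equal by (simp add: has_field_derivative_iff flat_def)
qed

text \<open>A class of bumps supported in \<open>[- 1 / a, 1 / a]\<close> that is closed under differentiation.\<close>

inductive_set bump_span :: "real \<Rightarrow> (real \<Rightarrow> real) set" for a where
  prod: "(\<lambda>t. s * flat p (1 + a * t) * flat q (1 - a * t)) \<in> bump_span a"
| add: "f \<in> bump_span a \<Longrightarrow> g \<in> bump_span a \<Longrightarrow> (\<lambda>t. f t + g t) \<in> bump_span a"

text \<open>The inner functions \<open>1 + a * t\<close> and \<open>1 - a * t\<close> contribute the
  factors \<open>a\<close> and \<open>- a\<close>; the scalar \<open>s\<close> of the generators is
  there to absorb them.\<close>

lemma bump_span_derivative:
  assumes "f \<in> bump_span a"
  shows "\<exists>g\<in>bump_span a. \<forall>t. (f has_real_derivative g t) (at t)"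
  using assms
proof induction
  case (prod s p q)
  define p' q' where "p' = [:0,0,1:] * (p - pderiv p)" and "q' = [:0,0,1:] * (q - pderiv q)"
  have "((\<lambda>t. s * flat p (1 + a * t) * flat q (1 - a * t)) has_real_derivative
      (s * a) * flat p' (1 + a * t) * flat q (1 - a * t) + (- s * a) * flat p (1 + a * t) * flat q' (1 - a * t)) (at t)" for t
    unfolding p'_def q'_def
    by (auto intro!: derivative_eq_intros DERIV_chain2[OF flat_has_derivative] simp: algebra_simps)
  then show ?case
    by (rule_tac bexI, rule_tac allI, assumption) (intro bump_span.intros)
next
  case (add f g)
  then obtain f' g' where "f' \<in> bump_span a" "g' \<in> bump_span a"
    "\<forall>t. (f has_real_derivative f' t) (at t)" "\<forall>t. (g has_real_derivative g' t) (at t)" by blast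
  then show ?case
    by (intro bexI[of _ "\<lambda>t. f' t + g' t"]) (auto intro!: bump_span.intros DERIV_add)
qed

lemma bump_span_zero:
  assumes "f \<in> bump_span a" "a > 0" "\<bar>t\<bar> > 1 / a"
  shows "f t = 0"
  using assms(1)
proof induction
  case (prod s p q)
  have "1 + a * t \<le> 0 \<or> 1 - a * t \<le> 0"
    using assms(2,3) by (auto simp: field_simps abs_if split: if_splits)
  then show ?case by (auto simp: flat_def)
qed auto

lemma smooth_bump_exists:
  assumes "r > 0"
  shows "\<exists>F :: nat \<Rightarrow> real \<Rightarrow> real. (\<forall>n t. (F n has_real_derivative F (Suc n) t) (at t)) \<and>
     (\<forall>n t. \<bar>t\<bar> > r \<longrightarrow> F n t = 0) \<and> (\<forall>t. F 0 t \<ge> 0) \<and> F 0 0 > 0"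
proof -
  define a where "a = 1 / r"
  have a: "a > 0" "1 / a = r" using assms by (auto simp: a_def)
  define f where "f = (\<lambda>t. 1 * flat 1 (1 + a * t) * flat 1 (1 - a * t))"
  have f: "f \<in> bump_span a" unfolding f_def by (rule bump_span.prod)
  \<comment> \<open>Dependent choice picks a derivative inside the span at every stage. The clause
    for \<open>n = 0\<close> pins the start to the concrete bump, which is nonnegative and positive
    at 0.\<close>
  have "\<exists>F. \<forall>n. (F n \<in> bump_span a \<and> (n = 0 \<longrightarrow> F n = f)) \<and> (\<forall>t. (F n has_real_derivative F (Suc n) t) (at t))"
  proof (rule dependent_nat_choice)
    show "\<exists>x. x \<in> bump_span a \<and> (0 = (0::nat) \<longrightarrow> x = f)" using f by blast
    show "\<exists>y. (y \<in> bump_span a \<and> (Suc n = 0 \<longrightarrow> y = f)) \<and> (\<forall>t. (x has_real_derivative y t) (at t))"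
      if "x \<in> bump_span a \<and> (n = 0 \<longrightarrow> x = f)" for x n
      using bump_span_derivative[of x a] that by auto
  qed
  then obtain F where F: "\<And>n. F n \<in> bump_span a" "F 0 = f" "\<And>n t. (F n has_real_derivative F (Suc n) t) (at t)" by blast
  show ?thesis
    by (rule exI[of _ F]) (use F bump_span_zero[OF F(1) a(1)] in \<open>auto simp: f_def flat_def a(2)\<close>)
qed

text \<open>A whole family, indexed by multi-indices, so that differentiation stays inside the family
  and mixed partial derivatives commute by construction.\<close>

definition mollifier :: "real \<Rightarrow> (('n::finite \<Rightarrow> nat) \<Rightarrow> real^'n \<Rightarrow> real) \<Rightarrow> bool" where
  "mollifier e G \<longleftrightarrow> (\<forall>m. continuous_on UNIV (G m)) \<and>
     (\<forall>m j x. ((\<lambda>t. G m (x + t *\<^sub>R axis j 1)) has_real_derivative G (m(j := Suc (m j))) x) (at 0)) \<and>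
     (\<forall>m x. norm x > e \<longrightarrow> G m x = 0) \<and> (\<forall>x. G (\<lambda>_. 0) x \<ge> 0) \<and>
     (\<integral>x. G (\<lambda>_. 0) x \<partial>lborel) = 1"

lemma integrable_continuous_compact:
  fixes f :: "'a::euclidean_space \<Rightarrow> real"
  assumes "continuous_on UNIV f" "\<And>x. norm x > e \<Longrightarrow> f x = 0"
  shows "integrable lborel f"
proof -
  have "integrable lborel (\<lambda>x. indicator (cball 0 e) x *\<^sub>R f x)"
    using assms by (intro borel_integrable_compact continuous_on_subset[OF assms(1)]) auto
  also have "(\<lambda>x. indicator (cball 0 e) x *\<^sub>R f x) = f"
    using assms(2) by (auto simp: indicator_def fun_eq_iff not_le)
  finally show ?thesis .
qed

text \<open>A tensor product of one-dimensional bumps: \<open>m i\<close> says which derivative of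
  the bump stands in the factor of coordinate \<open>i\<close>, so raising one entry of
  \<open>m\<close> is one partial derivative. Dividing all members by the same integral keeps these
  relations.\<close>

lemma mollifier_exists:
  assumes "e > 0"
  shows "\<exists>G :: ('n::finite \<Rightarrow> nat) \<Rightarrow> real^'n \<Rightarrow> real. mollifier e G"
proof -
  \<comment> \<open>If all coordinates are at most \<open>r\<close> in modulus, the l1 norm and
    hence the Euclidean norm is at most \<open>e\<close>.\<close>
  define r where "r = e / real CARD('n)"
  have r: "r > 0" using assms by (simp add: r_def)
  obtain F :: "nat \<Rightarrow> real \<Rightarrow> real" where F: "\<And>n t. (F n has_real_derivative F (Suc n) t) (at t)"
     "\<And>n t. \<bar>t\<bar> > r \<Longrightarrow> F n t = 0" "\<And>t. F 0 t \<ge> 0" "F 0 0 > 0"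
    using smooth_bump_exists[OF r] by blast
  define H where "H m x = (\<Prod>i\<in>UNIV. F (m i) (x $ i))" for m :: "'n \<Rightarrow> nat" and x :: "real^'n"
  have Fc: "continuous_on UNIV (F n)" for n
    using F(1) by (meson DERIV_isCont continuous_at_imp_continuous_on)
  have Hc: "continuous_on UNIV (H m)" for m
    unfolding H_def
    by (intro continuous_on_prod continuous_on_compose2[OF Fc]) (auto intro!: continuous_intros)
  have Hz: "H m x = 0" if "norm x > e" for m x
  proof -
    have "\<exists>i. \<bar>x $ i\<bar> > r"
    proof (rule ccontr)
      assume "\<not> ?thesis"
      then have "(\<Sum>i\<in>UNIV. \<bar>x $ i\<bar>) \<le> (\<Sum>i\<in>(UNIV::'n set). r)" by (intro sum_mono) (auto simp: not_less)
      also have "\<dots> = e" by (simp add: r_def)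
      finally show False using norm_le_l1_cart[of x] that by simp
    qed
    then show ?thesis unfolding H_def using F(2) by auto
  qed
  have Hd: "((\<lambda>t. H m (x + t *\<^sub>R axis j 1)) has_real_derivative H (m(j := Suc (m j))) x) (at 0)" for m j x
  proof -
    define P where "P = (\<Prod>i\<in>UNIV - {j}. F (m i) (x $ i))"
    have 1: "H m (x + t *\<^sub>R axis j 1) = F (m j) (x $ j + t) * P" for t
    proof -
      have "H m (x + t *\<^sub>R axis j 1) = F (m j) ((x + t *\<^sub>R axis j 1) $ j) * (\<Prod>i\<in>UNIV - {j}. F (m i) ((x + t *\<^sub>R axis j 1) $ i))"
        unfolding H_def by (subst prod.remove[of _ j]) auto
      also have "(\<Prod>i\<in>UNIV - {j}. F (m i) ((x + t *\<^sub>R axis j 1) $ i)) = P"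
        unfolding P_def by (rule prod.cong) (auto simp: axis_def)
      finally show ?thesis by (simp add: axis_def)
    qed
    have 2: "H (m(j := Suc (m j))) x = F (Suc (m j)) (x $ j) * P"
      unfolding H_def P_def by (subst prod.remove[of _ j]) (auto intro!: prod.cong)
    have "((\<lambda>t. F (m j) (x $ j + t)) has_real_derivative F (Suc (m j)) (x $ j + 0) * 1) (at 0)"
      by (rule DERIV_chain2[OF F(1)]) (auto intro!: derivative_eq_intros)
    then show ?thesis unfolding 1 2 by (auto intro!: derivative_eq_intros)
  qed
  define I where "I = (\<integral>x. H (\<lambda>_. 0) x \<partial>lborel)"
  have H0: "H (\<lambda>_. 0) x \<ge> 0" for x unfolding H_def using F(3) by (simp add: prod_nonneg)
  have int: "integrable lborel (H (\<lambda>_. 0))"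
    using integrable_continuous_compact[OF Hc Hz] .
  \<comment> \<open>A nonnegative function with zero integral vanishes almost everywhere, but this
    one is nonzero on a nonempty open set, which is not negligible.\<close>
  have "I \<noteq> 0"
  proof
    assume "I = 0"
    then have "AE x in lborel. H (\<lambda>_. 0) x = 0"
      unfolding I_def using integral_nonneg_eq_0_iff_AE[OF int] H0 by auto
    then have "{x. H (\<lambda>_. 0) x \<noteq> 0} \<in> null_sets lborel"
      using borel_measurable_continuous_onI[OF Hc[of "\<lambda>_. 0"]] by (subst (asm) AE_iff_null) auto
    then have "negligible {x. H (\<lambda>_. 0) x \<noteq> 0}"
      by (simp add: negligible_iff_null_sets null_sets_completionI)
    moreover have "open {x. H (\<lambda>_. 0) x \<noteq> 0}"
      by (intro open_Collect_neq Hc continuous_on_const)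
    moreover have "0 \<in> {x. H (\<lambda>_. 0) x \<noteq> 0}" using F(4) by (simp add: H_def)
    ultimately show False using open_not_negligible by blast
  qed
  moreover have "I \<ge> 0" unfolding I_def using H0 by simp
  ultimately have I: "I > 0" by simp
  show ?thesis
    unfolding mollifier_def
    by (rule exI[of _ "\<lambda>m x. H m x / I"])
       (use Hc Hz H0 I Hd in \<open>auto intro!: continuous_intros DERIV_cdivide simp: I_def[symmetric]\<close>)
qed

section \<open>Convolution with a mollifier\<close>

lemma C_inf_continuous: "C_inf S f \<Longrightarrow> continuous_on S f"
  by (cases rule: C_inf.cases) auto

lemma C_inf_partial_has_derivative:
  assumes "C_inf UNIV f"
  shows "((\<lambda>t. f (x + t *\<^sub>R axis j 1)) has_real_derivative partial j f x) (at 0)"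
  using assms
proof (cases rule: C_inf.cases)
  case 1
  then obtain g where "((\<lambda>t. f (x + t *\<^sub>R axis j 1)) has_real_derivative g x) (at 0)" by blast
  then show ?thesis unfolding partial_def by (metis DERIV_imp_deriv)
qed

lemma partial_eqI:
  "((\<lambda>t. f (x + t *\<^sub>R axis j 1)) has_real_derivative d) (at 0) \<Longrightarrow> partial j f x = d"
  unfolding partial_def by (rule DERIV_imp_deriv)

lemma C_inf_partial: "C_inf UNIV f \<Longrightarrow> C_inf UNIV (partial j f)"
proof -
  assume "C_inf UNIV f"
  then obtain g where g: "\<And>x. ((\<lambda>t. f (x + t *\<^sub>R axis j 1)) has_real_derivative g x) (at 0)" "C_inf UNIV g"
    by (cases rule: C_inf.cases) blast
  have "partial j f = g" using partial_eqI[OF g(1)] by blast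
  then show ?thesis using g(2) by simp
qed

text \<open>Coinduction with membership in \<open>S\<close> as the invariant. Smoothness thereby
  reduces to naming a family of continuous functions closed under partial derivatives.\<close>

lemma C_inf_family:
  assumes "h \<in> S" and "\<And>h. h \<in> S \<Longrightarrow> continuous_on UNIV h"
    and "\<And>h j. h \<in> S \<Longrightarrow> \<exists>g\<in>S. \<forall>x. ((\<lambda>t. h (x + t *\<^sub>R axis j 1)) has_real_derivative g x) (at 0)"
  shows "C_inf UNIV h"
  using assms(1)
proof (coinduction arbitrary: h)
  case (C_inf h)
  then show ?case using assms(2,3) by blast
qed

text \<open>Products alone are not stable under the Leibniz rule; finite sums of products of smooth
  functions are, and so form an invariant family.\<close>

inductive_set product_span :: "(real^'n::finite \<Rightarrow> real) set" where
  prod: "C_inf UNIV f \<Longrightarrow> C_inf UNIV g \<Longrightarrow> (\<lambda>x. f x * g x) \<in> product_span"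
| add: "f \<in> product_span \<Longrightarrow> g \<in> product_span \<Longrightarrow> (\<lambda>x. f x + g x) \<in> product_span"

lemma partial_mult_has_derivative:
  assumes "C_inf UNIV f" "C_inf UNIV g"
  shows "((\<lambda>t. f (x + t *\<^sub>R axis j 1) * g (x + t *\<^sub>R axis j 1)) has_real_derivative
    partial j f x * g x + f x * partial j g x) (at 0)"
  using DERIV_mult[OF C_inf_partial_has_derivative[OF assms(1), of x j] C_inf_partial_has_derivative[OF assms(2), of x j]]
  by (simp add: algebra_simps)

lemma partial_mult:
  assumes "C_inf UNIV f" "C_inf UNIV g"
  shows "partial j (\<lambda>x. f x * g x) x = partial j f x * g x + f x * partial j g x"
  by (rule partial_eqI, rule partial_mult_has_derivative[OF assms])

lemma C_inf_mult:
  assumes "C_inf UNIV f" "C_inf UNIV g"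
  shows "C_inf UNIV (\<lambda>x. f x * g x)"
proof (rule C_inf_family[of _ product_span])
  show "(\<lambda>x. f x * g x) \<in> product_span" using assms by (rule product_span.prod)
  show "continuous_on UNIV h" if "h \<in> product_span" for h :: "real^'n \<Rightarrow> real"
    using that by induction (auto intro!: continuous_intros dest: C_inf_continuous)
  show "\<exists>g\<in>product_span. \<forall>x. ((\<lambda>t. h (x + t *\<^sub>R axis j 1)) has_real_derivative g x) (at 0)"
    if "h \<in> product_span" for h :: "real^'n \<Rightarrow> real" and j
    using that
  proof induction
    case (prod f g)
    show ?case
      by (rule bexI[of _ "\<lambda>x. partial j f x * g x + f x * partial j g x"])
         (use prod in \<open>auto intro!: product_span.intros C_inf_partial partial_mult_has_derivative\<close>)
  next
    case (add f g)
    then obtain f' g' where "f' \<in> product_span" "g' \<in> product_span"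
      "\<forall>x. ((\<lambda>t. f (x + t *\<^sub>R axis j 1)) has_real_derivative f' x) (at 0)"
      "\<forall>x. ((\<lambda>t. g (x + t *\<^sub>R axis j 1)) has_real_derivative g' x) (at 0)" by blast
    then show ?case
      by (intro bexI[of _ "\<lambda>x. f' x + g' x"]) (auto intro!: DERIV_add product_span.intros)
  qed
qed

section \<open>Smoothness of convolutions\<close>

lemma mollifier_continuous: "mollifier e G \<Longrightarrow> continuous_on UNIV (G m)"
  by (simp add: mollifier_def)

lemma mollifier_zero: "mollifier e G \<Longrightarrow> norm x > e \<Longrightarrow> G m x = 0"
  by (simp add: mollifier_def)

lemma mollifier_nonneg: "mollifier e G \<Longrightarrow> G (\<lambda>_. 0) x \<ge> 0"
  by (simp add: mollifier_def)

lemma mollifier_derivative: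
  "mollifier e G \<Longrightarrow> ((\<lambda>t. G m (x + t *\<^sub>R axis j 1)) has_real_derivative G (m(j := Suc (m j))) x) (at 0)"
  by (simp add: mollifier_def)

lemma mollifier_reflect_derivative:
  assumes "mollifier e G"
  shows "((\<lambda>t. G m (x - (y + t *\<^sub>R axis j 1))) has_real_derivative - G (m(j := Suc (m j))) (x - y)) (at 0)"
proof -
  have "((\<lambda>t. G m ((x - y) + t *\<^sub>R axis j 1)) has_real_derivative G (m(j := Suc (m j))) (x - y)) (at (- 0))"
    using mollifier_derivative[OF assms] by simp
  then have "((\<lambda>t. G m ((x - y) + (- t) *\<^sub>R axis j 1)) has_real_derivative G (m(j := Suc (m j))) (x - y) * (- 1)) (at 0)"
    by (rule DERIV_chain2) (auto intro!: derivative_eq_intros)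
  then show ?thesis by (simp add: algebra_simps)
qed

text \<open>The kernel seen from \<open>x\<close>, as a function of \<open>y\<close>, is what a weak
  derivative is tested against when a mollification is differentiated.\<close>

lemma mollifier_reflect_C_inf:
  assumes "mollifier e G"
  shows "C_inf UNIV (\<lambda>y. G m (x - y))"
proof -
  \<comment> \<open>Each derivative in \<open>y\<close> reverses the sign because \<open>y\<close>
    enters as \<open>x - y\<close>; the scalar \<open>s\<close> keeps the family closed.\<close>
  define S where "S = {\<lambda>y. s * G m (x - y) | s m. True}"
  have "C_inf UNIV (\<lambda>y. 1 * G m (x - y))"
  proof (rule C_inf_family[of _ S])
    show "(\<lambda>y. 1 * G m (x - y)) \<in> S" unfolding S_def by blast
    have "continuous_on UNIV (\<lambda>y. G m (x - y))" for m
      by (intro continuous_on_compose2[OF mollifier_continuous[OF assms]] continuous_intros) simp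
    then show "continuous_on UNIV h" if "h \<in> S" for h using that unfolding S_def
      by (auto intro!: continuous_intros)
  next
    fix h j assume "h \<in> S"
    then obtain s m where h: "h = (\<lambda>y. s * G m (x - y))" unfolding S_def by blast
    have "((\<lambda>t. s * G m (x - (y + t *\<^sub>R axis j 1))) has_real_derivative - s * G (m(j := Suc (m j))) (x - y)) (at 0)" for y
      using DERIV_cmult[OF mollifier_reflect_derivative[OF assms, of m x y j], of s] by simp
    then show "\<exists>g\<in>S. \<forall>x. ((\<lambda>t. h (x + t *\<^sub>R axis j 1)) has_real_derivative g x) (at 0)"
      unfolding h by (intro bexI[of _ "\<lambda>y. - s * G (m(j := Suc (m j))) (x - y)"]) (simp, unfold S_def, blast)
  qed
  then show ?thesis by simp
qed

lemma mollifier_reflect_partial: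
  assumes "mollifier e G"
  shows "partial j (\<lambda>y. G m (x - y)) y = - G (m(j := Suc (m j))) (x - y)"
  by (rule partial_eqI) (rule mollifier_reflect_derivative[OF assms])

definition conv :: "(real^'n::finite \<Rightarrow> real) \<Rightarrow> (real^'n \<Rightarrow> real) \<Rightarrow> real^'n \<Rightarrow> real" where
  "conv g w x = (\<integral>y. g (x - y) * w y \<partial>lebesgue)"

lemma mollifier_bounded:
  assumes "mollifier e G"
  obtains B where "\<And>x. \<bar>G m x\<bar> \<le> B"
proof -
  have "compact (G m ` cball 0 e)"
    by (intro compact_continuous_image continuous_on_subset[OF mollifier_continuous[OF assms]] compact_cball subset_UNIV)
  then have "bounded (G m ` cball 0 e)" by (rule compact_imp_bounded)
  then obtain B where B: "\<forall>y\<in>G m ` cball 0 e. \<bar>y\<bar> \<le> B" unfolding bounded_real by (elim exE)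
  have "\<bar>G m x\<bar> \<le> max B 0" for x
    using B mollifier_zero[OF assms, of x] by (cases "norm x \<le> e") (auto simp: le_max_iff_disj)
  then show thesis using that by blast
qed

lemma continuous_imp_lebesgue_measurable:
  "continuous_on UNIV (f :: 'a::euclidean_space \<Rightarrow> real) \<Longrightarrow> f \<in> borel_measurable lebesgue"
  using borel_measurable_continuous_onI[of f] by (intro measurable_completion) simp

lemma mollifier_reflect_measurable:
  "mollifier e G \<Longrightarrow> (\<lambda>y. G m (x - y)) \<in> borel_measurable lebesgue"
  by (intro continuous_imp_lebesgue_measurable C_inf_continuous mollifier_reflect_C_inf)

lemma conv_integrable:
  assumes G: "mollifier e G" and w: "integrable lebesgue w"
  shows "integrable lebesgue (\<lambda>y. G m (x - y) * w y)"
proof -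
  obtain B where B: "\<And>x. \<bar>G m x\<bar> \<le> B" using mollifier_bounded[OF G] by metis
  show ?thesis
  proof (rule Bochner_Integration.integrable_bound[of _ "\<lambda>y. B * w y"])
    show "(\<lambda>y. G m (x - y) * w y) \<in> borel_measurable lebesgue"
      using w mollifier_reflect_measurable[OF G] by (intro borel_measurable_times) auto
    show "AE y in lebesgue. norm (G m (x - y) * w y) \<le> norm (B * w y)"
      using B by (intro AE_I2) (simp add: abs_mult, meson abs_ge_self mult_right_mono order_trans abs_ge_zero)
  qed (use w in auto)
qed

lemma conv_continuous:
  fixes w :: "real^'n::finite \<Rightarrow> real"
  assumes G: "mollifier e G" and w: "integrable lebesgue w"
  shows "continuous_on UNIV (conv (G m) w)"
proof -
  obtain B where B: "\<And>x. \<bar>G m x\<bar> \<le> B" using mollifier_bounded[OF G] by metis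
  show ?thesis
  proof (intro continuous_at_imp_continuous_on ballI, subst continuous_at_sequentially, intro allI impI)
    fix x and s :: "nat \<Rightarrow> real^'n" assume s: "s \<longlonglongrightarrow> x"
    show "(conv (G m) w \<circ> s) \<longlonglongrightarrow> conv (G m) w x"
      unfolding conv_def comp_def
    proof (rule integral_dominated_convergence)
      show "integrable lebesgue (\<lambda>y. B * \<bar>w y\<bar>)" using w by auto
      show "AE y in lebesgue. (\<lambda>i. G m (s i - y) * w y) \<longlonglongrightarrow> G m (x - y) * w y"
        using mollifier_continuous[OF G, of m]
        by (intro AE_I2 tendsto_intros continuous_on_tendsto_compose[of UNIV "G m"] s) auto
      show "AE y in lebesgue. norm (G m (s i - y) * w y) \<le> B * \<bar>w y\<bar>" for i
        using B by (intro AE_I2) (simp add: abs_mult mult_right_mono)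
    qed (use conv_integrable[OF G w] in auto)
  qed
qed

text \<open>Differentiation under the integral sign: by the mean value inequality the difference
  quotients of the kernel are bounded by a bound \<open>B\<close> of the next kernel in the family,
  so \<open>B * \<bar>w y\<bar>\<close> dominates the integrands.\<close>

lemma conv_has_derivative:
  assumes G: "mollifier e G" and w: "integrable lebesgue w"
  shows "((\<lambda>t. conv (G m) w (x + t *\<^sub>R axis j 1)) has_real_derivative conv (G (m(j := Suc (m j)))) w x) (at 0)"
proof -
  let ?m = "m(j := Suc (m j))"
  obtain B where B: "\<And>x. \<bar>G ?m x\<bar> \<le> B" using mollifier_bounded[OF G] by metis
  have d0: "((\<lambda>t. G m (z + t *\<^sub>R axis j 1)) has_real_derivative G ?m z) (at 0)" for z
    by (rule mollifier_derivative[OF G])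
  have d: "((\<lambda>t. G m (z + t *\<^sub>R axis j 1)) has_real_derivative G ?m (z + t *\<^sub>R axis j 1)) (at t)" for z t
  proof -
    have "((\<lambda>s. G m ((z + t *\<^sub>R axis j 1) + s *\<^sub>R axis j 1)) has_real_derivative G ?m (z + t *\<^sub>R axis j 1)) (at 0)"
      by (rule d0)
    then have "((\<lambda>s. (\<lambda>t. G m (z + t *\<^sub>R axis j 1)) (s + t)) has_real_derivative G ?m (z + t *\<^sub>R axis j 1)) (at 0)"
      by (simp add: algebra_simps)
    then show ?thesis using DERIV_shift[of "\<lambda>t. G m (z + t *\<^sub>R axis j 1)" _ 0 t] by simp
  qed
  have quot: "\<bar>(G m (z + t *\<^sub>R axis j 1) - G m z) / t\<bar> \<le> B" if "t \<noteq> 0" for z t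
  proof -
    have "norm (G m (z + t *\<^sub>R axis j 1) - G m (z + 0 *\<^sub>R axis j 1)) \<le> B * norm (t - 0)"
      by (rule field_differentiable_bound[of UNIV]) (use d B in auto)
    then show ?thesis using that by (simp add: field_simps)
  qed
  show ?thesis
    unfolding has_field_derivative_iff tendsto_at_iff_sequentially
  proof (intro allI impI)
    fix s :: "nat \<Rightarrow> real"
    assume s0: "\<forall>i. s i \<in> UNIV - {0}" and s: "s \<longlonglongrightarrow> 0"
    have eq: "(conv (G m) w (x + s i *\<^sub>R axis j 1) - conv (G m) w (x + 0 *\<^sub>R axis j 1)) / (s i - 0)
       = (\<integral>y. (G m ((x - y) + s i *\<^sub>R axis j 1) - G m (x - y)) / s i * w y \<partial>lebesgue)" for i
    proof -
      have "conv (G m) w (x + s i *\<^sub>R axis j 1) - conv (G m) w x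
          = (\<integral>y. G m (x + s i *\<^sub>R axis j 1 - y) * w y - G m (x - y) * w y \<partial>lebesgue)"
        unfolding conv_def by (rule Bochner_Integration.integral_diff[symmetric]) (rule conv_integrable[OF G w])+
      then have "(conv (G m) w (x + s i *\<^sub>R axis j 1) - conv (G m) w x) / s i
          = (\<integral>y. (G m (x + s i *\<^sub>R axis j 1 - y) * w y - G m (x - y) * w y) / s i \<partial>lebesgue)"
        by simp
      also have "(\<lambda>y. (G m (x + s i *\<^sub>R axis j 1 - y) * w y - G m (x - y) * w y) / s i) =
          (\<lambda>y. (G m ((x - y) + s i *\<^sub>R axis j 1) - G m (x - y)) / s i * w y)"
        by (rule ext) (simp add: left_diff_distrib add_diff_eq diff_add_eq)
      finally show ?thesis by (simp only: scaleR_zero_left add_0_right diff_zero)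
    qed
    have "(\<lambda>i. \<integral>y. (G m ((x - y) + s i *\<^sub>R axis j 1) - G m (x - y)) / s i * w y \<partial>lebesgue)
       \<longlonglongrightarrow> (\<integral>y. G ?m (x - y) * w y \<partial>lebesgue)"
    proof (rule integral_dominated_convergence)
      show "integrable lebesgue (\<lambda>y. B * \<bar>w y\<bar>)" using w by auto
      show "AE y in lebesgue. (\<lambda>i. (G m ((x - y) + s i *\<^sub>R axis j 1) - G m (x - y)) / s i * w y) \<longlonglongrightarrow> G ?m (x - y) * w y"
      proof (intro AE_I2 tendsto_mult tendsto_const)
        fix y
        from d0[of "x - y"] show "(\<lambda>i. (G m ((x - y) + s i *\<^sub>R axis j 1) - G m (x - y)) / s i) \<longlonglongrightarrow> G ?m (x - y)"
          unfolding has_field_derivative_iff tendsto_at_iff_sequentially using s s0 by (auto simp: comp_def)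
      qed
      show "AE y in lebesgue. norm ((G m ((x - y) + s i *\<^sub>R axis j 1) - G m (x - y)) / s i * w y) \<le> B * \<bar>w y\<bar>" for i
      proof (intro AE_I2)
        fix y
        show "norm ((G m ((x - y) + s i *\<^sub>R axis j 1) - G m (x - y)) / s i * w y) \<le> B * \<bar>w y\<bar>"
          unfolding real_norm_def abs_mult by (rule mult_right_mono) (use quot[of "s i"] s0 in auto)
      qed
      show "(\<lambda>y. G ?m (x - y) * w y) \<in> borel_measurable lebesgue"
        using conv_integrable[OF G w] by auto
      have "(\<lambda>y. (G m ((x + s i *\<^sub>R axis j 1) - y) * w y - G m (x - y) * w y) / s i) \<in> borel_measurable lebesgue" for i
        using conv_integrable[OF G w] by (intro borel_measurable_divide borel_measurable_diff) auto
      then show "(\<lambda>y. (G m ((x - y) + s i *\<^sub>R axis j 1) - G m (x - y)) / s i * w y) \<in> borel_measurable lebesgue" for i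
        by (simp add: left_diff_distrib add_diff_eq diff_add_eq)
    qed
    then show "((\<lambda>t. (conv (G m) w (x + t *\<^sub>R axis j 1) - conv (G m) w (x + 0 *\<^sub>R axis j 1)) / (t - 0)) \<circ> s)
       \<longlonglongrightarrow> conv (G ?m) w x"
      unfolding comp_def eq conv_def[of "G ?m" w x] .
  qed
qed

lemma conv_partial:
  assumes "mollifier e G" "integrable lebesgue w"
  shows "partial j (conv (G m) w) = conv (G (m(j := Suc (m j)))) w"
  by (rule ext, rule partial_eqI, rule conv_has_derivative[OF assms, where m = m and j = j])

lemma conv_C_inf:
  assumes "mollifier e G" "integrable lebesgue w"
  shows "C_inf UNIV (conv (G m) w)"
proof (rule C_inf_family[of _ "range (\<lambda>m. conv (G m) w)"])
  fix h j assume "h \<in> range (\<lambda>m. conv (G m) w)"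
  then obtain m where h: "h = conv (G m) w" by blast
  show "continuous_on UNIV h" unfolding h by (rule conv_continuous[OF assms])
  show "\<exists>g\<in>range (\<lambda>m. conv (G m) w). \<forall>x. ((\<lambda>t. h (x + t *\<^sub>R axis j 1)) has_real_derivative g x) (at 0)"
    unfolding h using conv_has_derivative[OF assms, where m = m and j = j] by blast
qed simp

lemma conv_partial_commute:
  assumes "mollifier e G" "integrable lebesgue w"
  shows "partial i (partial j (conv (G m) w)) = partial j (partial i (conv (G m) w))"
  by (cases "i = j") (auto simp: conv_partial[OF assms] fun_upd_twist[of i j])

lemma conv_eq_0:
  assumes "mollifier e G" "\<And>y. norm (x - y) \<le> e \<Longrightarrow> w y = 0"
  shows "conv (G m) w x = 0"
proof -
  have "G m (x - y) * w y = 0" for y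
    using assms(2)[of y] mollifier_zero[OF assms(1), of "x - y" m] by (cases "norm (x - y) \<le> e") auto
  then have "(\<lambda>y. G m (x - y) * w y) = (\<lambda>_. 0)" by (rule ext)
  then show ?thesis unfolding conv_def by simp
qed

section \<open>Mollification in L2\<close>

lemma lborel_translate:
  fixes f :: "'a::euclidean_space \<Rightarrow> real"
  assumes "f \<in> borel_measurable borel"
  shows "(\<integral>y. f (y + z) \<partial>lborel) = (\<integral>y. f y \<partial>lborel)"
    and "integrable lborel (\<lambda>y. f (y + z)) \<longleftrightarrow> integrable lborel f"
proof -
  show "(\<integral>y. f (y + z) \<partial>lborel) = (\<integral>y. f y \<partial>lborel)"
    by (subst (2) lborel_distr_plus[of z, symmetric], subst integral_distr) (use assms in \<open>auto simp: add.commute\<close>)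
  show "integrable lborel (\<lambda>y. f (y + z)) \<longleftrightarrow> integrable lborel f"
    by (subst (2) lborel_distr_plus[of z, symmetric], subst integrable_distr_eq) (use assms in \<open>auto simp: add.commute\<close>)
qed

lemma nn_integral_lborel_translate:
  fixes f :: "'a::euclidean_space \<Rightarrow> ennreal"
  assumes "f \<in> borel_measurable borel"
  shows "(\<integral>\<^sup>+y. f (z + y) \<partial>lborel) = (\<integral>\<^sup>+y. f y \<partial>lborel)"
  by (subst (2) lborel_distr_plus[of z, symmetric], subst nn_integral_distr) (use assms in auto)

definition translation_continuous :: "('a::euclidean_space \<Rightarrow> real) \<Rightarrow> bool" where
  "translation_continuous f \<longleftrightarrow>
     (\<forall>e>0. \<exists>d>0. \<forall>z. norm z < d \<longrightarrow> (\<integral>y. \<bar>f (y + z) - f y\<bar> \<partial>lborel) < e)"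

lemma integrable_translate_diff:
  fixes f :: "'a::euclidean_space \<Rightarrow> real"
  assumes "integrable lborel f"
  shows "integrable lborel (\<lambda>y. \<bar>f (y + z) - f y\<bar>)"
  using assms lborel_translate(2)[of f z] by (auto dest: borel_measurable_integrable)

text \<open>An \<open>e/3\<close> argument: translation invariance of the measure makes the shifted
  error \<open>g - f\<close> cost exactly as much as the unshifted one, so the property is closed
  under limits in L1.\<close>

lemma translation_continuous_approx:
  fixes f :: "'a::euclidean_space \<Rightarrow> real"
  assumes f: "integrable lborel f"
    and approx: "\<And>e. e > 0 \<Longrightarrow> \<exists>g. integrable lborel g \<and> translation_continuous g \<and> (\<integral>y. \<bar>g y - f y\<bar> \<partial>lborel) < e"
  shows "translation_continuous f"
  unfolding translation_continuous_def
proof (intro allI impI)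
  fix e :: real assume e: "e > 0"
  obtain g where g: "integrable lborel g" "translation_continuous g" "(\<integral>y. \<bar>g y - f y\<bar> \<partial>lborel) < e / 3"
    using approx[of "e/3"] e by auto
  obtain d where d: "d > 0" "\<And>z. norm z < d \<Longrightarrow> (\<integral>y. \<bar>g (y + z) - g y\<bar> \<partial>lborel) < e / 3"
    using g(2) e unfolding translation_continuous_def by (meson divide_pos_pos zero_less_numeral)
  have "(\<integral>y. \<bar>f (y + z) - f y\<bar> \<partial>lborel) < e" if z: "norm z < d" for z
  proof -
    have m: "(\<lambda>y. \<bar>g y - f y\<bar>) \<in> borel_measurable borel" using g(1) f by auto
    have i: "integrable lborel (\<lambda>y. \<bar>g y - f y\<bar>)" using g(1) f by auto
    have i2: "integrable lborel (\<lambda>y. \<bar>g (y + z) - f (y + z)\<bar>)" using lborel_translate(2)[OF m, of z] i by simp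
    have "(\<integral>y. \<bar>f (y + z) - f y\<bar> \<partial>lborel)
        \<le> (\<integral>y. (\<bar>g (y + z) - f (y + z)\<bar> + \<bar>g (y + z) - g y\<bar>) + \<bar>g y - f y\<bar> \<partial>lborel)"
      by (intro integral_mono Bochner_Integration.integrable_add integrable_translate_diff f g i i2) linarith
    also have "\<dots> = (\<integral>y. \<bar>g (y + z) - f (y + z)\<bar> \<partial>lborel) + (\<integral>y. \<bar>g (y + z) - g y\<bar> \<partial>lborel) + (\<integral>y. \<bar>g y - f y\<bar> \<partial>lborel)"
      using i i2 integrable_translate_diff[OF g(1), of z] by simp
    also have "(\<integral>y. \<bar>g (y + z) - f (y + z)\<bar> \<partial>lborel) = (\<integral>y. \<bar>g y - f y\<bar> \<partial>lborel)"
      using lborel_translate(1)[OF m, of z] by simp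
    finally show ?thesis using d(2)[OF z] g(3) by linarith
  qed
  then show "\<exists>d>0. \<forall>z. norm z < d \<longrightarrow> (\<integral>y. \<bar>f (y + z) - f y\<bar> \<partial>lborel) < e"
    using d(1) by blast
qed

text \<open>The shifted indicator need not converge on the boundary of \<open>U\<close>. The modulus
  of the difference is therefore written as \<open>I (y + z) + I y - 2 * (I (y + z) * I y)\<close>:
  the first two terms have integrals independent of \<open>z\<close>, and the product converges
  pointwise because \<open>U\<close> is open.\<close>

lemma translation_continuous_open:
  fixes U :: "'a::euclidean_space set"
  assumes U: "open U" and fin: "emeasure lborel U < \<infinity>"
  shows "translation_continuous (\<lambda>y. indicator U y * c)"
proof -
  define h where "h z = (\<integral>y. \<bar>indicator U (y + z) * c - indicator U y * c\<bar> \<partial>lborel)" for z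
  define I :: "'a \<Rightarrow> real" where "I = indicator U"
  have Im: "I \<in> borel_measurable borel" using U by (simp add: I_def)
  have Ii: "integrable lborel I" unfolding I_def using U fin by (intro integrable_real_indicator) auto
  have Iz: "integrable lborel (\<lambda>y. I (y + z))" for z using lborel_translate(2)[OF Im] Ii by simp
  have Ip: "integrable lborel (\<lambda>y. I (y + z) * I y)" for z
  proof (rule Bochner_Integration.integrable_bound[OF Ii])
    show "(\<lambda>y. I (y + z) * I y) \<in> borel_measurable lborel" using Im by simp
  qed (auto simp: I_def indicator_def)
  have "(h \<longlongrightarrow> 0) (at 0)"
    unfolding tendsto_at_iff_sequentially
  proof (intro allI impI)
    fix s :: "nat \<Rightarrow> 'a" assume s: "s \<longlonglongrightarrow> 0"
    have h: "h z = \<bar>c\<bar> * (2 * (\<integral>y. I y \<partial>lborel) - 2 * (\<integral>y. I (y + z) * I y \<partial>lborel))" for z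
    proof -
      have "h z = (\<integral>y. \<bar>c\<bar> * ((I (y + z) + I y) - 2 * (I (y + z) * I y)) \<partial>lborel)"
        unfolding h_def I_def by (rule Bochner_Integration.integral_cong) (auto simp: indicator_def)
      also have "\<dots> = \<bar>c\<bar> * (((\<integral>y. I (y + z) \<partial>lborel) + (\<integral>y. I y \<partial>lborel)) - 2 * (\<integral>y. I (y + z) * I y \<partial>lborel))"
        using Ii Iz[of z] Ip[of z] by simp
      finally show ?thesis using lborel_translate(1)[OF Im, of z] by simp
    qed
    have "(\<lambda>i. \<integral>y. I (y + s i) * I y \<partial>lborel) \<longlonglongrightarrow> (\<integral>y. I y \<partial>lborel)"
    proof (rule integral_dominated_convergence[OF _ _ Ii])
      show "AE y in lborel. (\<lambda>i. I (y + s i) * I y) \<longlonglongrightarrow> I y"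
      proof (intro AE_I2)
        fix y
        show "(\<lambda>i. I (y + s i) * I y) \<longlonglongrightarrow> I y"
        proof (cases "y \<in> U")
          case True
          have "(\<lambda>i. y + s i) \<longlonglongrightarrow> y + 0" by (intro tendsto_intros s)
          then have "\<forall>\<^sub>F i in sequentially. y + s i \<in> U"
            using U True by (auto elim!: topological_tendstoD)
          then show ?thesis
            by (intro tendsto_eventually, elim eventually_mono) (simp add: I_def True)
        qed (simp add: I_def)
      qed
      show "(\<lambda>y. I (y + s i) * I y) \<in> borel_measurable lborel" for i using Ip by blast
      show "AE y in lborel. norm (I (y + s i) * I y) \<le> I y" for i
        by (intro AE_I2) (simp add: I_def indicator_def)
    qed (use Im in simp)
    then have "(\<lambda>i. h (s i)) \<longlonglongrightarrow> \<bar>c\<bar> * (2 * (\<integral>y. I y \<partial>lborel) - 2 * (\<integral>y. I y \<partial>lborel))"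
      unfolding h by (intro tendsto_intros)
    then show "(h \<circ> s) \<longlonglongrightarrow> 0" by (simp add: comp_def)
  qed
  moreover have "h 0 = 0" by (simp add: h_def)
  ultimately show ?thesis
    unfolding translation_continuous_def h_def[symmetric] Lim_at
    by (auto simp: dist_norm) (metis abs_ge_self abs_zero norm_eq_zero order_le_less_trans)
qed

text \<open>Outer regularity carries the property from open sets to measurable sets of finite
  measure; sums and dominated limits then reach every integrable function.\<close>

lemma integrable_translation_continuous:
  fixes f :: "'a::euclidean_space \<Rightarrow> real"
  assumes "integrable lborel f"
  shows "translation_continuous f"
  using assms
proof (induction rule: integrable_induct)
  case (base A c)
  show ?case
  proof (rule translation_continuous_approx)
    show "integrable lborel (\<lambda>x. indicator A x *\<^sub>R c)" using base by auto
    fix e :: real assume e: "e > 0"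
    \<comment> \<open>The summand 1 covers \<open>c = 0\<close> and makes
      \<open>\<bar>c\<bar> * e'\<close> strictly smaller than \<open>e\<close>.\<close>
    define e' where "e' = e / (\<bar>c\<bar> + 1)"
    have e': "e' > 0" using e by (simp add: e'_def)
    obtain U where U: "open U" "A \<subseteq> U" "emeasure lborel (U - A) < e'"
      using outer_regular_lborel[OF _ e', of A] base by auto
    have "emeasure lborel U \<le> emeasure lborel A + emeasure lborel (U - A)"
      using U base emeasure_subadditive[of A lborel "U - A"] by (simp add: Un_absorb1)
    also have "\<dots> < \<infinity>" using base(2) U(3) by (simp add: less_top[symmetric])
       (metis ennreal_less_top order_less_trans less_top)
    finally have fin: "emeasure lborel U < \<infinity>" .
    have "(\<integral>y. \<bar>indicator U y * c - indicator A y *\<^sub>R c\<bar> \<partial>lborel) = (\<integral>y. \<bar>c\<bar> * indicator (U - A) y \<partial>lborel)"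
      by (rule Bochner_Integration.integral_cong) (use U(2) in \<open>auto simp: indicator_def\<close>)
    also have "\<dots> = \<bar>c\<bar> * measure lborel (U - A)" by simp
    also have "\<dots> \<le> \<bar>c\<bar> * e'"
      using U(3) e' by (intro mult_left_mono) (auto simp: measure_def enn2real_leI)
    also have "\<dots> < e" using e by (simp add: e'_def field_simps)
    finally show "\<exists>g. integrable lborel g \<and> translation_continuous g \<and> (\<integral>y. \<bar>g y - indicator A y *\<^sub>R c\<bar> \<partial>lborel) < e"
      using translation_continuous_open[OF U(1) fin, of c] U(1) fin
      by (intro exI[of _ "\<lambda>y. indicator U y * c"]) auto
  qed
next
  case (add f g)
  show ?case
    unfolding translation_continuous_def
  proof (intro allI impI)
    fix e :: real assume e: "e > 0"
    obtain d where d: "d > 0" "\<And>z. norm z < d \<Longrightarrow> (\<integral>y. \<bar>f (y + z) - f y\<bar> \<partial>lborel) < e / 2"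
      using add.IH(1) e unfolding translation_continuous_def by (meson half_gt_zero)
    obtain d' where d': "d' > 0" "\<And>z. norm z < d' \<Longrightarrow> (\<integral>y. \<bar>g (y + z) - g y\<bar> \<partial>lborel) < e / 2"
      using add.IH(2) e unfolding translation_continuous_def by (meson half_gt_zero)
    have "(\<integral>y. \<bar>(f (y + z) + g (y + z)) - (f y + g y)\<bar> \<partial>lborel) < e" if "norm z < min d d'" for z
    proof -
      have "(\<integral>y. \<bar>(f (y + z) + g (y + z)) - (f y + g y)\<bar> \<partial>lborel)
         \<le> (\<integral>y. \<bar>f (y + z) - f y\<bar> + \<bar>g (y + z) - g y\<bar> \<partial>lborel)"
        using integrable_translate_diff[of "\<lambda>x. f x + g x" z] add(1,2)
        by (intro integral_mono Bochner_Integration.integrable_add integrable_translate_diff) auto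
      also have "\<dots> = (\<integral>y. \<bar>f (y + z) - f y\<bar> \<partial>lborel) + (\<integral>y. \<bar>g (y + z) - g y\<bar> \<partial>lborel)"
        using integrable_translate_diff add(1,2) by (intro Bochner_Integration.integral_add)
      finally show ?thesis using d(2)[of z] d'(2)[of z] that by simp
    qed
    then show "\<exists>d>0. \<forall>z. norm z < d \<longrightarrow> (\<integral>y. \<bar>(f (y + z) + g (y + z)) - (f y + g y)\<bar> \<partial>lborel) < e"
      using d(1) d'(1) by (intro exI[of _ "min d d'"]) auto
  qed
next
  case (lim f s)
  show ?case
  proof (rule translation_continuous_approx[OF \<open>integrable lborel f\<close>])
    fix e :: real assume e: "e > 0"
    have sf: "(\<lambda>i. s i y) \<longlonglongrightarrow> f y" and sb: "\<bar>s i y\<bar> \<le> 2 * \<bar>f y\<bar>" for i y using lim by simp_all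
    have "(\<lambda>i. \<integral>y. \<bar>s i y - f y\<bar> \<partial>lborel) \<longlonglongrightarrow> integral\<^sup>L (lborel :: 'a measure) (\<lambda>_. 0)"
    proof (rule integral_dominated_convergence[where w="\<lambda>y. 3 * \<bar>f y\<bar>"])
      show "integrable lborel (\<lambda>y. 3 * \<bar>f y\<bar>)" using lim by auto
      show "AE y in lborel. (\<lambda>i. \<bar>s i y - f y\<bar>) \<longlonglongrightarrow> 0"
        by (intro AE_I2 tendsto_rabs_zero LIM_zero sf)
      show "AE y in lborel. norm \<bar>s i y - f y\<bar> \<le> 3 * \<bar>f y\<bar>" for i
      proof (intro AE_I2)
        fix y show "norm \<bar>s i y - f y\<bar> \<le> 3 * \<bar>f y\<bar>" using sb[of i y] by simp
      qed
    qed (use lim in auto)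
    then have "\<forall>\<^sub>F i in sequentially. (\<integral>y. \<bar>s i y - f y\<bar> \<partial>lborel) < e"
      using e by (auto elim!: order_tendstoD)
    then obtain i where "(\<integral>y. \<bar>s i y - f y\<bar> \<partial>lborel) < e" by (auto simp: eventually_sequentially)
    then show "\<exists>g. integrable lborel g \<and> translation_continuous g \<and> (\<integral>y. \<bar>g y - f y\<bar> \<partial>lborel) < e"
      using lim by blast
  qed
qed

text \<open>The function \<open>a * \<bar>a\<bar>\<close> is the signed square. For equal signs, one
  factor \<open>\<bar>a - b\<bar>\<close> is at most \<open>\<bar>a + b\<bar>\<close>, and the
  product is the difference of signed squares. For opposite signs that difference is
  \<open>a * a + b * b\<close> in modulus, and twice it dominates \<open>(a - b)^2\<close>.\<close>

lemma square_diff_le_signed_squares: "(a - b)\<^sup>2 \<le> 2 * \<bar>a * \<bar>a\<bar> - b * \<bar>b\<bar>\<bar>" for a b :: real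
proof -
  have "a * a + b * b \<ge> 2 * a * b" "a * a \<ge> 0" "b * b \<ge> 0" "a*a+b*b \<ge> - 2 * a * b"
    using zero_le_square[of "a - b"] zero_le_square[of "a + b"] by (auto simp: algebra_simps)
  consider "a \<ge> 0" "b \<ge> 0" | "a < 0" "b < 0" | "a \<ge> 0" "b < 0" | "a < 0" "b \<ge> 0" by linarith
  then show ?thesis
  proof cases
    case 1
    have "(a - b)\<^sup>2 = \<bar>a - b\<bar> * \<bar>a - b\<bar>" by (simp add: power2_eq_square)
    also have "\<dots> \<le> \<bar>a - b\<bar> * (a + b)" using 1 by (intro mult_left_mono) auto
    also have "\<dots> = \<bar>(a - b) * (a + b)\<bar>" using 1 by (simp add: abs_mult)
    also have "(a - b) * (a + b) = a * \<bar>a\<bar> - b * \<bar>b\<bar>" using 1 by (simp add: algebra_simps)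
    also have "\<bar>a * \<bar>a\<bar> - b * \<bar>b\<bar>\<bar> \<le> 2 * \<bar>a * \<bar>a\<bar> - b * \<bar>b\<bar>\<bar>" by simp
    finally show ?thesis .
  next
    case 2
    have "(a - b)\<^sup>2 = \<bar>a - b\<bar> * \<bar>a - b\<bar>" by (simp add: power2_eq_square)
    also have "\<dots> \<le> \<bar>a - b\<bar> * (- a - b)" using 2 by (intro mult_left_mono) auto
    also have "\<dots> = \<bar>(a - b) * (- a - b)\<bar>" using 2 by (simp add: abs_mult)
    also have "(a - b) * (- a - b) = a * \<bar>a\<bar> - b * \<bar>b\<bar>" using 2 by (simp add: algebra_simps)
    also have "\<bar>a * \<bar>a\<bar> - b * \<bar>b\<bar>\<bar> \<le> 2 * \<bar>a * \<bar>a\<bar> - b * \<bar>b\<bar>\<bar>" by simp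
    finally show ?thesis .
  next
    case 3
    then have "\<bar>a * \<bar>a\<bar> - b * \<bar>b\<bar>\<bar> = a * a + b * b" by simp
    then show ?thesis using \<open>a*a+b*b \<ge> - 2 * a * b\<close> by (simp add: power2_eq_square algebra_simps)
  next
    case 4
    then have "\<bar>a * \<bar>a\<bar> - b * \<bar>b\<bar>\<bar> = \<bar>- (a * a + b * b)\<bar>" by simp
    also have "\<dots> = a * a + b * b" by simp
    finally show ?thesis using \<open>a*a+b*b \<ge> - 2 * a * b\<close> by (simp add: power2_eq_square algebra_simps)
  qed
qed

text \<open>The elementary inequality above reduces continuity of translations in \<open>L\<^sup>2\<close> to the
  \<open>L\<^sup>1\<close> case applied to \<open>f * \<bar>f\<bar>\<close>.\<close>

lemma L2_translation_continuous:
  fixes f :: "'a::euclidean_space \<Rightarrow> real"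
  assumes [measurable]: "f \<in> borel_measurable borel" and f: "integrable lborel (\<lambda>x. (f x)\<^sup>2)" and e: "e > 0"
  shows "\<exists>d>0. \<forall>z. norm z < d \<longrightarrow> (\<integral>\<^sup>+y. ennreal ((f (y + z) - f y)\<^sup>2) \<partial>lborel) \<le> ennreal e"
proof -
  define g where "g x = f x * \<bar>f x\<bar>" for x
  have g: "integrable lborel g"
    unfolding g_def by (rule Bochner_Integration.integrable_bound[OF f]) (auto simp: power2_eq_square abs_mult)
  obtain d where d: "d > 0" "\<And>z. norm z < d \<Longrightarrow> (\<integral>y. \<bar>g (y + z) - g y\<bar> \<partial>lborel) < e / 2"
    using integrable_translation_continuous[OF g] e unfolding translation_continuous_def by (meson half_gt_zero)
  have "(\<integral>\<^sup>+y. ennreal ((f (y + z) - f y)\<^sup>2) \<partial>lborel) \<le> ennreal e" if z: "norm z < d" for z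
  proof -
    have "(\<integral>\<^sup>+y. ennreal ((f (y + z) - f y)\<^sup>2) \<partial>lborel) \<le> (\<integral>\<^sup>+y. ennreal (2 * \<bar>g (y + z) - g y\<bar>) \<partial>lborel)"
      unfolding g_def by (intro nn_integral_mono ennreal_leI square_diff_le_signed_squares)
    also have "\<dots> = ennreal (\<integral>y. 2 * \<bar>g (y + z) - g y\<bar> \<partial>lborel)"
      using integrable_translate_diff[OF g, of z] by (intro nn_integral_eq_integral) auto
    also have "\<dots> \<le> ennreal e" using d(2)[OF z] by (intro ennreal_leI) simp
    finally show ?thesis .
  qed
  then show ?thesis using d(1) by blast
qed

section \<open>Approximation of L2 functions by their mollifications\<close>

lemma lborel_reflect:
  fixes f :: "real^'n::finite \<Rightarrow> real"
  assumes "f \<in> borel_measurable borel"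
  shows "(\<integral>y. f (x - y) \<partial>lborel) = (\<integral>y. f y \<partial>lborel)"
  by (subst (2) lborel_affine[of "-1" x]) (use assms in \<open>simp_all add: density_1 integral_distr\<close>)

lemma mollifier_reflect_integrable:
  fixes G :: "('n::finite \<Rightarrow> nat) \<Rightarrow> real^'n \<Rightarrow> real"
  assumes G: "mollifier e G"
  shows "integrable lborel (\<lambda>y. G m (x - y))"
proof (rule integrable_continuous_compact)
  show "continuous_on UNIV (\<lambda>y. G m (x - y))" by (rule C_inf_continuous[OF mollifier_reflect_C_inf[OF G]])
  fix y :: "real^'n" assume "norm y > norm x + e"
  then have "norm (x - y) > e" using norm_triangle_ineq3[of x y] by linarith
  then show "G m (x - y) = 0" by (rule mollifier_zero[OF G])
qed

lemma mollifier_reflect_integral: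
  assumes G: "mollifier e G"
  shows "(\<integral>y. G (\<lambda>_. 0) (x - y) \<partial>lebesgue) = 1"
proof -
  have "(\<integral>y. G (\<lambda>_. 0) (x - y) \<partial>lebesgue) = (\<integral>y. G (\<lambda>_. 0) (x - y) \<partial>lborel)"
    by (rule integral_completion[OF borel_measurable_integrable[OF mollifier_reflect_integrable[OF G]]])
  also have "\<dots> = 1"
    using lborel_reflect[OF borel_measurable_continuous_onI[OF mollifier_continuous[OF G]]] G
    by (simp add: mollifier_def)
  finally show ?thesis .
qed

text \<open>Jensen's inequality for the probability density
  \<open>G (\<lambda>_. 0) (x - y)\<close>, read off from the nonnegativity of the variance of
  \<open>w\<close> about its mean. The free constant \<open>c\<close> is later set to
  \<open>w x\<close>.\<close>

lemma conv_square_le: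
  fixes w :: "real^'n::finite \<Rightarrow> real"
  assumes G: "mollifier e G" and w: "integrable lebesgue w" "integrable lebesgue (\<lambda>x. (w x)\<^sup>2)"
  shows "integrable lebesgue (\<lambda>y. G (\<lambda>_. 0) (x - y) * (w y - c)\<^sup>2)"
    and "(conv (G (\<lambda>_. 0)) w x - c)\<^sup>2 \<le> (\<integral>y. G (\<lambda>_. 0) (x - y) * (w y - c)\<^sup>2 \<partial>lebesgue)"
proof -
  define r where "r y = G (\<lambda>_. 0) (x - y)" for y
  define X where "X = conv (G (\<lambda>_. 0)) w x"
  have rw: "integrable lebesgue (\<lambda>y. r y * w y)" "integrable lebesgue (\<lambda>y. r y * (w y)\<^sup>2)"
    unfolding r_def using conv_integrable[OF G] w by auto
  have ri: "integrable lebesgue r"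
    unfolding r_def using mollifier_reflect_integrable[OF G] by (simp add: integrable_completion)
  have r1: "(\<integral>y. r y \<partial>lebesgue) = 1" unfolding r_def by (rule mollifier_reflect_integral[OF G])
  have int: "integrable lebesgue (\<lambda>y. r y * (w y - c)\<^sup>2)" 
    and val: "(\<integral>y. r y * (w y - c)\<^sup>2 \<partial>lebesgue) = (\<integral>y. r y * (w y)\<^sup>2 \<partial>lebesgue) - 2 * c * X + c\<^sup>2" for c
  proof -
    have eq: "(\<lambda>y. r y * (w y - c)\<^sup>2) = (\<lambda>y. (r y * (w y)\<^sup>2 - 2 * c * (r y * w y)) + c\<^sup>2 * r y)"
      by (rule ext) (simp add: power2_eq_square algebra_simps)
    show "integrable lebesgue (\<lambda>y. r y * (w y - c)\<^sup>2)" unfolding eq using rw ri by auto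
    show "(\<integral>y. r y * (w y - c)\<^sup>2 \<partial>lebesgue) = (\<integral>y. r y * (w y)\<^sup>2 \<partial>lebesgue) - 2 * c * X + c\<^sup>2"
      unfolding eq using rw ri r1 by (simp add: X_def conv_def r_def[symmetric])
  qed
  show "integrable lebesgue (\<lambda>y. G (\<lambda>_. 0) (x - y) * (w y - c)\<^sup>2)" using int unfolding r_def .
  have "(\<integral>y. r y * (w y - X)\<^sup>2 \<partial>lebesgue) \<ge> 0"
    unfolding r_def by (intro integral_nonneg_AE AE_I2 mult_nonneg_nonneg mollifier_nonneg[OF G]) simp
  then have "(\<integral>y. r y * (w y)\<^sup>2 \<partial>lebesgue) \<ge> X\<^sup>2" unfolding val by (simp add: power2_eq_square)
  then show "(conv (G (\<lambda>_. 0)) w x - c)\<^sup>2 \<le> (\<integral>y. G (\<lambda>_. 0) (x - y) * (w y - c)\<^sup>2 \<partial>lebesgue)"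
    unfolding X_def[symmetric] r_def[symmetric] val by (simp add: power2_eq_square algebra_simps)
qed

text \<open>By Jensen with \<open>c = w x\<close> and two exchanges of integrals, the squared error
  is at most the average, with weight \<open>G (\<lambda>_. 0) z\<close>, of the squared L2
  distances between \<open>w\<close> and its translates by \<open>z\<close>. Only shifts with
  \<open>norm z \<le> \<epsilon>\<close> carry weight, so continuity of translations bounds the
  error for all mollifiers of small radius at once.\<close>

lemma conv_L2_approx_borel:
  fixes w :: "real^'n::finite \<Rightarrow> real"
  assumes [measurable]: "w \<in> borel_measurable borel"
    and w: "integrable lborel w" "integrable lborel (\<lambda>x. (w x)\<^sup>2)" and e: "e > 0"
  shows "\<exists>d>0. \<forall>\<epsilon> G. \<epsilon> < d \<and> mollifier \<epsilon> G \<longrightarrow>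
    (\<integral>\<^sup>+x. ennreal ((conv (G (\<lambda>_. 0)) w x - w x)\<^sup>2) \<partial>lborel) \<le> ennreal e"
proof -
  obtain d where d: "d > 0" "\<And>z. norm z < d \<Longrightarrow> (\<integral>\<^sup>+y. ennreal ((w (y + z) - w y)\<^sup>2) \<partial>lborel) \<le> ennreal e"
    using L2_translation_continuous[OF _ w(2) e] by auto
  have "(\<integral>\<^sup>+x. ennreal ((conv (G (\<lambda>_. 0)) w x - w x)\<^sup>2) \<partial>lborel) \<le> ennreal e"
    if "\<epsilon> < d" and G: "mollifier \<epsilon> G" for \<epsilon> G
  proof -
    define r where "r = G (\<lambda>_. 0)"
    have r[measurable]: "r \<in> borel_measurable borel"
      unfolding r_def by (rule borel_measurable_continuous_onI[OF mollifier_continuous[OF G]])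
    have rpos: "r x \<ge> 0" for x unfolding r_def by (rule mollifier_nonneg[OF G])
    have wl: "integrable lebesgue w" "integrable lebesgue (\<lambda>x. (w x)\<^sup>2)"
      using w by (simp_all add: integrable_completion)
    have "(\<integral>\<^sup>+x. ennreal ((conv r w x - w x)\<^sup>2) \<partial>lborel)
       \<le> (\<integral>\<^sup>+x. (\<integral>\<^sup>+y. ennreal (r (x - y) * (w y - w x)\<^sup>2) \<partial>lborel) \<partial>lborel)"
    proof (intro nn_integral_mono)
      fix x
      have m: "(\<lambda>y. r (x - y) * (w y - w x)\<^sup>2) \<in> borel_measurable lborel" by simp
      have i: "integrable lborel (\<lambda>y. r (x - y) * (w y - w x)\<^sup>2)"
        using conv_square_le(1)[OF G wl, of x "w x"] integrable_completion[OF m] unfolding r_def by simp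
      have "(conv r w x - w x)\<^sup>2 \<le> (\<integral>y. r (x - y) * (w y - w x)\<^sup>2 \<partial>lborel)"
        using conv_square_le(2)[OF G wl, of x "w x"] integral_completion[OF m] unfolding r_def by simp
      then have "ennreal ((conv r w x - w x)\<^sup>2) \<le> ennreal (\<integral>y. r (x - y) * (w y - w x)\<^sup>2 \<partial>lborel)"
        by (rule ennreal_leI)
      also have "\<dots> = (\<integral>\<^sup>+y. ennreal (r (x - y) * (w y - w x)\<^sup>2) \<partial>lborel)"
        by (rule nn_integral_eq_integral[symmetric, OF i]) (auto intro!: AE_I2 mult_nonneg_nonneg rpos)
      finally show "ennreal ((conv r w x - w x)\<^sup>2) \<le> (\<integral>\<^sup>+y. ennreal (r (x - y) * (w y - w x)\<^sup>2) \<partial>lborel)" .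
    qed
    also have "\<dots> = (\<integral>\<^sup>+y. (\<integral>\<^sup>+x. ennreal (r (x - y) * (w y - w x)\<^sup>2) \<partial>lborel) \<partial>lborel)"
      by (rule lborel_pair.Fubini'[symmetric]) measurable
    also have "\<dots> = (\<integral>\<^sup>+y. (\<integral>\<^sup>+z. ennreal (r z * (w y - w (y + z))\<^sup>2) \<partial>lborel) \<partial>lborel)"
    proof (rule nn_integral_cong)
      fix y
      show "(\<integral>\<^sup>+x. ennreal (r (x - y) * (w y - w x)\<^sup>2) \<partial>lborel) = (\<integral>\<^sup>+z. ennreal (r z * (w y - w (y + z))\<^sup>2) \<partial>lborel)"
        by (subst nn_integral_lborel_translate[of _ y, symmetric]) auto
    qed
    also have "\<dots> = (\<integral>\<^sup>+z. (\<integral>\<^sup>+y. ennreal (r z * (w y - w (y + z))\<^sup>2) \<partial>lborel) \<partial>lborel)"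
      by (rule lborel_pair.Fubini') measurable
    also have "\<dots> \<le> (\<integral>\<^sup>+z. ennreal (r z) * ennreal e \<partial>lborel)"
    proof (rule nn_integral_mono)
      fix z
      have "(\<integral>\<^sup>+y. ennreal (r z * (w y - w (y + z))\<^sup>2) \<partial>lborel) = ennreal (r z) * (\<integral>\<^sup>+y. ennreal ((w (y + z) - w y)\<^sup>2) \<partial>lborel)"
        using rpos by (subst nn_integral_cmult[symmetric]) (auto simp: ennreal_mult power2_commute)
      also have "\<dots> \<le> ennreal (r z) * ennreal e"
      proof (cases "norm z < d")
        case True
        then show ?thesis using d(2) by (intro mult_left_mono) auto
      next
        case False
        then have "r z = 0" using \<open>\<epsilon> < d\<close> unfolding r_def by (intro mollifier_zero[OF G]) simp
        then show ?thesis by simp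
      qed
      finally show "(\<integral>\<^sup>+y. ennreal (r z * (w y - w (y + z))\<^sup>2) \<partial>lborel) \<le> ennreal (r z) * ennreal e" .
    qed
    also have "\<dots> = (\<integral>\<^sup>+z. ennreal (r z) \<partial>lborel) * ennreal e"
      by (rule nn_integral_multc) simp
    also have "(\<integral>\<^sup>+z. ennreal (r z) \<partial>lborel) = ennreal 1"
    proof -
      have "(\<integral>x. r x \<partial>lborel) = 1" using G by (simp add: r_def mollifier_def)
      moreover from this have "integrable lborel r" by (metis not_integrable_integral_eq zero_neq_one)
      ultimately show ?thesis using nn_integral_eq_integral[of lborel r] rpos by simp
    qed
    finally show ?thesis by (simp add: r_def)
  qed
  then show ?thesis using d(1) by blast
qed

lemma conv_cong_AE:
  assumes "AE x in lebesgue. w x = w' x" "w \<in> borel_measurable lebesgue" "w' \<in> borel_measurable lebesgue" "mollifier e G"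
  shows "conv (G m) w = conv (G m) w'"
  unfolding conv_def
  by (intro ext integral_cong_AE borel_measurable_times mollifier_reflect_measurable[OF assms(4)])
     (use assms in auto)

text \<open>The exchange of integrals relies on joint Borel measurability, so \<open>w\<close> is
  replaced by a Borel function equal to it almost everywhere; its convolutions stay the
  same.\<close>

lemma conv_L2_approx:
  fixes w :: "real^'n::finite \<Rightarrow> real"
  assumes w: "integrable lebesgue w" "integrable lebesgue (\<lambda>x. (w x)\<^sup>2)" and e: "e > 0"
  shows "\<exists>d>0. \<forall>\<epsilon> G. \<epsilon> < d \<and> mollifier \<epsilon> G \<longrightarrow>
    integrable lebesgue (\<lambda>x. (conv (G (\<lambda>_. 0)) w x - w x)\<^sup>2) \<and>
    (\<integral>x. (conv (G (\<lambda>_. 0)) w x - w x)\<^sup>2 \<partial>lebesgue) \<le> e"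
proof -
  have wm: "w \<in> borel_measurable lebesgue" using w by auto
  then obtain v where v[measurable]: "v \<in> borel_measurable borel" and ae: "AE x in lborel. w x = v x"
    using completion_ex_borel_measurable_real[of w lborel] by auto
  have vl: "v \<in> borel_measurable lebesgue" by (rule measurable_completion) simp
  have ae': "AE x in lebesgue. w x = v x" using ae by (rule AE_completion)
  have "integrable lebesgue v" 
    using integrable_cong_AE[OF wm vl ae'] w by simp
  moreover have "integrable lebesgue (\<lambda>x. (v x)\<^sup>2)"
  proof -
    have "AE x in lebesgue. (w x)\<^sup>2 = (v x)\<^sup>2" using ae' by eventually_elim simp
    then show ?thesis
      using integrable_cong_AE[of "\<lambda>x. (w x)\<^sup>2" lebesgue "\<lambda>x. (v x)\<^sup>2"] wm vl w(2) by simp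
  qed
  ultimately have vi: "integrable lborel v" "integrable lborel (\<lambda>x. (v x)\<^sup>2)"
    by (simp_all add: integrable_completion)
  obtain d where d: "d > 0" "\<And>\<epsilon> G. \<epsilon> < d \<Longrightarrow> mollifier \<epsilon> G \<Longrightarrow>
     (\<integral>\<^sup>+x. ennreal ((conv (G (\<lambda>_. 0)) v x - v x)\<^sup>2) \<partial>lborel) \<le> ennreal e"
    using conv_L2_approx_borel[OF v vi e] by blast
  have "integrable lebesgue (\<lambda>x. (conv (G (\<lambda>_. 0)) w x - w x)\<^sup>2) \<and>
    (\<integral>x. (conv (G (\<lambda>_. 0)) w x - w x)\<^sup>2 \<partial>lebesgue) \<le> e" if "\<epsilon> < d" and G: "mollifier \<epsilon> G" for \<epsilon> G
  proof -
    let ?c = "conv (G (\<lambda>_. 0)) w"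
    have c: "?c = conv (G (\<lambda>_. 0)) v" by (rule conv_cong_AE[OF ae' wm vl G])
    have cm: "?c \<in> borel_measurable borel"
      by (rule borel_measurable_continuous_onI[OF conv_continuous[OF G w(1)]])
    then have cl: "?c \<in> borel_measurable lebesgue" by (intro measurable_completion) simp
    have le: "(\<integral>\<^sup>+x. ennreal ((?c x - v x)\<^sup>2) \<partial>lborel) \<le> ennreal e" using d(2)[OF that] c by simp
    have i: "integrable lborel (\<lambda>x. (?c x - v x)\<^sup>2)"
      using cm le by (intro integrableI_bounded) (auto simp: top_unique less_top[symmetric])
    have "ennreal (\<integral>x. (?c x - v x)\<^sup>2 \<partial>lborel) \<le> ennreal e"
      using le nn_integral_eq_integral[OF i] by simp
    then have le': "(\<integral>x. (?c x - v x)\<^sup>2 \<partial>lborel) \<le> e" using e by (simp add: ennreal_le_iff)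
    have m: "(\<lambda>x. (?c x - v x)\<^sup>2) \<in> borel_measurable lborel" using cm by auto
    have i2: "integrable lebesgue (\<lambda>x. (?c x - v x)\<^sup>2)" using i integrable_completion[OF m] by simp
    have le2: "(\<integral>x. (?c x - v x)\<^sup>2 \<partial>lebesgue) \<le> e" using le' integral_completion[OF m] by simp
    have ae2: "AE x in lebesgue. (?c x - w x)\<^sup>2 = (?c x - v x)\<^sup>2" using ae' by eventually_elim simp
    have m1: "(\<lambda>x. (?c x - w x)\<^sup>2) \<in> borel_measurable lebesgue" "(\<lambda>x. (?c x - v x)\<^sup>2) \<in> borel_measurable lebesgue"
      using cl wm vl by auto
    show ?thesis
      using integrable_cong_AE[OF m1 ae2] integral_cong_AE[OF m1 ae2] i2 le2 by simp
  qed
  then show ?thesis using d(1) by blast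
qed

definition moll :: "nat \<Rightarrow> ('n::finite \<Rightarrow> nat) \<Rightarrow> real^'n \<Rightarrow> real" where
  "moll k = (SOME G. mollifier (1 / real (Suc k)) G)"

lemma moll: "mollifier (1 / real (Suc k)) (moll k)"
  unfolding moll_def by (rule someI_ex[OF mollifier_exists]) simp

definition smooth :: "nat \<Rightarrow> (real^'n::finite \<Rightarrow> real) \<Rightarrow> real^'n \<Rightarrow> real" where
  "smooth k = conv (moll k (\<lambda>_. 0))"

lemma smooth_L2_approx:
  assumes w: "integrable lebesgue w" "integrable lebesgue (\<lambda>x. (w x)\<^sup>2)" and e: "e > 0"
  shows "\<exists>N. \<forall>k\<ge>N. integrable lebesgue (\<lambda>x. (smooth k w x - w x)\<^sup>2) \<and>
    (\<integral>x. (smooth k w x - w x)\<^sup>2 \<partial>lebesgue) \<le> e"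
proof -
  obtain d where d: "d > 0" "\<forall>\<epsilon> G. \<epsilon> < d \<and> mollifier \<epsilon> G \<longrightarrow>
    integrable lebesgue (\<lambda>x. (conv (G (\<lambda>_. 0)) w x - w x)\<^sup>2) \<and>
    (\<integral>x. (conv (G (\<lambda>_. 0)) w x - w x)\<^sup>2 \<partial>lebesgue) \<le> e"
    using conv_L2_approx[OF w e] by (elim exE conjE)
  obtain N where N: "1 / real (Suc N) < d" using d(1) nat_approx_posE by blast
  show ?thesis
  proof (intro exI[of _ N] allI impI)
    fix k assume "k \<ge> N"
    then have "1 / real (Suc k) \<le> 1 / real (Suc N)" by (simp add: frac_le)
    then have "1 / real (Suc k) < d" using N by simp
    with d(2)[rule_format, OF conjI, OF _ moll[of k]]
    show "integrable lebesgue (\<lambda>x. (smooth k w x - w x)\<^sup>2) \<and>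
      (\<integral>x. (smooth k w x - w x)\<^sup>2 \<partial>lebesgue) \<le> e"
      unfolding smooth_def by simp
  qed
qed

lemma smooth_L2_tendsto:
  assumes w: "integrable lebesgue w" "integrable lebesgue (\<lambda>x. (w x)\<^sup>2)"
  shows "(\<lambda>k. \<integral>x. (smooth k w x - w x)\<^sup>2 \<partial>lebesgue) \<longlonglongrightarrow> 0"
proof (rule LIMSEQ_I)
  fix e :: real assume e: "e > 0"
  then obtain N where N: "\<And>k. k \<ge> N \<Longrightarrow> (\<integral>x. (smooth k w x - w x)\<^sup>2 \<partial>lebesgue) \<le> e / 2"
    using smooth_L2_approx[OF w, of "e/2"] by auto
  show "\<exists>N. \<forall>k\<ge>N. norm ((\<integral>x. (smooth k w x - w x)\<^sup>2 \<partial>lebesgue) - 0) < e"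
  proof (intro exI[of _ N] allI impI)
    fix k assume "k \<ge> N"
    then have "(\<integral>x. (smooth k w x - w x)\<^sup>2 \<partial>lebesgue) < e" using N[of k] e by linarith
    then show "norm ((\<integral>x. (smooth k w x - w x)\<^sup>2 \<partial>lebesgue) - 0) < e" by simp
  qed
qed

section \<open>Localized weak gradients\<close>

text \<open>Functions live on the whole space, so integration by parts meets no boundary. Bounded
  support places them in L1 as well and lets every continuous function, bounded or not, act as a
  multiplier.\<close>

definition L2c :: "(real^'n::finite \<Rightarrow> real) \<Rightarrow> bool" where
  "L2c f \<longleftrightarrow> f \<in> borel_measurable lebesgue \<and> integrable lebesgue (\<lambda>x. (f x)\<^sup>2) \<and>
     (\<exists>r. \<forall>x. norm x > r \<longrightarrow> f x = 0)"

lemma L2cD: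
  assumes "L2c f"
  shows "f \<in> borel_measurable lebesgue" "integrable lebesgue (\<lambda>x. (f x)\<^sup>2)"
  using assms by (auto simp: L2c_def)

lemma integrable_product_L2:
  fixes f g :: "'a \<Rightarrow> real"
  assumes "f \<in> borel_measurable M" "g \<in> borel_measurable M"
    "integrable M (\<lambda>x. (f x)\<^sup>2)" "integrable M (\<lambda>x. (g x)\<^sup>2)"
  shows "integrable M (\<lambda>x. f x * g x)"
proof (rule Bochner_Integration.integrable_bound)
  show "integrable M (\<lambda>x. (f x)\<^sup>2 + (g x)\<^sup>2)" using assms by simp
  show "AE x in M. norm (f x * g x) \<le> norm ((f x)\<^sup>2 + (g x)\<^sup>2)"
  proof (intro AE_I2)
    fix x
    have "2 * (\<bar>f x\<bar> * \<bar>g x\<bar>) \<le> (f x)\<^sup>2 + (g x)\<^sup>2"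
      using sum_squares_bound[of "\<bar>f x\<bar>" "\<bar>g x\<bar>"] by simp
    moreover have "0 \<le> \<bar>f x\<bar> * \<bar>g x\<bar>" by simp
    ultimately have "\<bar>f x\<bar> * \<bar>g x\<bar> \<le> (f x)\<^sup>2 + (g x)\<^sup>2" by linarith
    then show "norm (f x * g x) \<le> norm ((f x)\<^sup>2 + (g x)\<^sup>2)" by (simp add: abs_mult)
  qed
qed (use assms in simp)

lemma L2c_add:
  assumes "L2c f" "L2c g"
  shows "L2c (\<lambda>x. f x + g x)"
proof -
  obtain r s where "\<And>x. norm x > r \<Longrightarrow> f x = 0" "\<And>x. norm x > s \<Longrightarrow> g x = 0"
    using assms unfolding L2c_def by blast
  then have "\<exists>r. \<forall>x. norm x > r \<longrightarrow> f x + g x = 0" by (intro exI[of _ "max r s"]) simp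
  moreover have "integrable lebesgue (\<lambda>x. (f x)\<^sup>2 + (g x)\<^sup>2 + 2 * (f x * g x))"
    using L2cD[OF assms(1)] L2cD[OF assms(2)] by (intro Bochner_Integration.integrable_add integrable_mult_right integrable_product_L2)
  ultimately show ?thesis
    using L2cD(1)[OF assms(1)] L2cD(1)[OF assms(2)] unfolding L2c_def by (simp add: power2_sum mult.assoc)
qed

lemma L2c_mult_continuous:
  assumes f: "L2c f" and c: "continuous_on UNIV \<psi>"
  shows "L2c (\<lambda>x. f x * \<psi> x)"
proof -
  obtain r where r: "\<And>x. norm x > r \<Longrightarrow> f x = 0" using f unfolding L2c_def by blast
  have "compact (\<psi> ` cball 0 r)" by (intro compact_continuous_image continuous_on_subset[OF c]) auto
  then have "bounded (\<psi> ` cball 0 r)" by (rule compact_imp_bounded)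
  then obtain B where B: "\<forall>y\<in>\<psi> ` cball 0 r. \<bar>y\<bar> \<le> B" unfolding bounded_real by (elim exE)
  have m: "(\<lambda>x. f x * \<psi> x) \<in> borel_measurable lebesgue"
    using L2cD(1)[OF f] continuous_imp_lebesgue_measurable[OF c] by simp
  have "integrable lebesgue (\<lambda>x. (f x * \<psi> x)\<^sup>2)"
  proof (rule Bochner_Integration.integrable_bound)
    show "integrable lebesgue (\<lambda>x. B\<^sup>2 * (f x)\<^sup>2)" using L2cD(2)[OF f] by simp
    show "(\<lambda>x. (f x * \<psi> x)\<^sup>2) \<in> borel_measurable lebesgue" using m by simp
    show "AE x in lebesgue. norm ((f x * \<psi> x)\<^sup>2) \<le> norm (B\<^sup>2 * (f x)\<^sup>2)"
    proof (intro AE_I2)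
      fix x
      show "norm ((f x * \<psi> x)\<^sup>2) \<le> norm (B\<^sup>2 * (f x)\<^sup>2)"
      proof (cases "norm x > r")
        case False
        then have "\<bar>\<psi> x\<bar> \<le> B" using B by simp
        then have "(\<psi> x)\<^sup>2 \<le> B\<^sup>2" by (metis abs_ge_zero order_trans power2_abs power_mono)
        then show ?thesis by (simp add: power_mult_distrib mult.commute mult_right_mono)
      qed (simp add: r)
    qed
  qed
  then show ?thesis using m r unfolding L2c_def by auto
qed

lemma L2c_integrable:
  fixes f :: "real^'n::finite \<Rightarrow> real"
  assumes f: "L2c f"
  shows "integrable lebesgue f"
proof -
  obtain r where r: "\<And>x. norm x > r \<Longrightarrow> f x = 0" using f unfolding L2c_def by blast
  have i: "integrable lebesgue (indicat_real (cball 0 r :: (real^'n) set))"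
    by (intro integrable_real_indicator) (use lmeasurable_cball[of 0 r] in \<open>auto simp: fmeasurable_def\<close>)
  show ?thesis
  proof (rule Bochner_Integration.integrable_bound)
    show "integrable lebesgue (\<lambda>x. (f x)\<^sup>2 + indicator (cball 0 r) x)" using i L2cD(2)[OF f] by simp
    show "AE x in lebesgue. norm (f x) \<le> norm ((f x)\<^sup>2 + indicator (cball 0 r) x)"
    proof (intro AE_I2)
      fix x
      have "\<bar>f x\<bar> \<le> (f x)\<^sup>2 + 1"
        using sum_squares_bound[of "\<bar>f x\<bar>" 1] abs_ge_zero[of "f x"] by (simp) 
      then show "norm (f x) \<le> norm ((f x)\<^sup>2 + indicator (cball 0 r) x)"
        using r[of x] by (cases "norm x > r") auto
    qed
  qed (use L2cD(1)[OF f] in simp)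
qed

lemma test_fnD:
  assumes "test_fn \<Omega> \<phi>"
  shows "C_inf UNIV \<phi>" "continuous_on UNIV \<phi>" "x \<notin> tsupport \<phi> \<Longrightarrow> \<phi> x = 0" "x \<notin> \<Omega> \<Longrightarrow> \<phi> x = 0"
    "compact (tsupport \<phi>)" "tsupport \<phi> \<subseteq> \<Omega>" "\<exists>r. \<forall>x. norm x > r \<longrightarrow> \<phi> x = 0"
proof -
  have z: "x \<notin> tsupport \<phi> \<Longrightarrow> \<phi> x = 0" for x
    unfolding tsupport_def using closure_subset[of "{x. \<phi> x \<noteq> 0}"] by blast
  then show "x \<notin> tsupport \<phi> \<Longrightarrow> \<phi> x = 0" .
  show "C_inf UNIV \<phi>" and c: "compact (tsupport \<phi>)" and s: "tsupport \<phi> \<subseteq> \<Omega>"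
    using assms by (auto simp: test_fn_def)
  then show "continuous_on UNIV \<phi>" by (intro C_inf_continuous)
  show "x \<notin> \<Omega> \<Longrightarrow> \<phi> x = 0" using z s by blast
  obtain r where "\<forall>x\<in>tsupport \<phi>. norm x \<le> r" using compact_imp_bounded[OF c] bounded_iff by blast
  then show "\<exists>r. \<forall>x. norm x > r \<longrightarrow> \<phi> x = 0" using z by (metis not_le)
qed

lemma test_fnI:
  assumes "C_inf UNIV \<phi>" "compact K" "K \<subseteq> \<Omega>" "\<And>x. x \<notin> K \<Longrightarrow> \<phi> x = 0"
  shows "test_fn \<Omega> \<phi>"
proof -
  have "tsupport \<phi> \<subseteq> K"
    unfolding tsupport_def using assms(2,4) by (intro closure_minimal compact_imp_closed) auto
  moreover have "closed (tsupport \<phi>)" by (simp add: tsupport_def)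
  ultimately show ?thesis
    using assms compact_Int_closed[of K "tsupport \<phi>"] unfolding test_fn_def by (auto simp: Int_absorb1)
qed

lemma test_fn_mult:
  assumes "test_fn \<Omega> \<phi>" "C_inf UNIV \<psi>"
  shows "test_fn \<Omega> (\<lambda>x. \<phi> x * \<psi> x)"
  by (rule test_fnI[OF C_inf_mult[OF test_fnD(1)[OF assms(1)] assms(2)] test_fnD(5,6)[OF assms(1)]])
     (simp add: test_fnD(3)[OF assms(1)])

lemma partial_eq_0_locally:
  fixes f :: "real^'n::finite \<Rightarrow> real"
  assumes "open U" "x \<in> U" "\<And>y. y \<in> U \<Longrightarrow> f y = c"
  shows "partial j f x = 0"
proof (rule partial_eqI)
  have "open ((\<lambda>t. x + t *\<^sub>R axis j 1) -` U)"
    by (intro open_vimage assms continuous_intros)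
  then show "((\<lambda>t. f (x + t *\<^sub>R axis j 1)) has_real_derivative 0) (at 0)"
    by (rule has_field_derivative_transform_within_open[OF DERIV_const[of c]]) (use assms in auto)
qed

lemma test_fn_partial:
  assumes "test_fn \<Omega> \<phi>"
  shows "test_fn \<Omega> (partial j \<phi>)"
proof (rule test_fnI[OF C_inf_partial[OF test_fnD(1)[OF assms]] test_fnD(5,6)[OF assms]])
  fix x assume "x \<notin> tsupport \<phi>"
  then have x: "x \<in> - tsupport \<phi>" by simp
  have "open (- tsupport \<phi>)" by (simp add: tsupport_def open_Compl)
  then show "partial j \<phi> x = 0"
    by (rule partial_eq_0_locally[OF _ x]) (rule test_fnD(3)[OF assms], simp)
qed

text \<open>Nothing is known about \<open>f\<close> outside \<Omega>, not even measurability. Since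
  \<phi> vanishes there, \<open>f\<close> may be replaced by its truncation to \<Omega>.\<close>

lemma L2c_localize:
  fixes f :: "real^'n::finite \<Rightarrow> real"
  assumes f: "L2 \<Omega> f" and \<phi>: "test_fn \<Omega> \<phi>"
  shows "L2c (\<lambda>x. \<phi> x * f x)"
proof -
  have eq: "(\<lambda>x. \<phi> x * f x) = (\<lambda>x. (indicator \<Omega> x * f x) * \<phi> x)"
    using test_fnD(4)[OF \<phi>] by (auto simp: fun_eq_iff indicator_def)
  obtain r where r: "\<And>x. norm x > r \<Longrightarrow> \<phi> x = 0" using test_fnD(7)[OF \<phi>] by blast
  define I where "I = (indicator (cball 0 r) :: real^'n \<Rightarrow> real)"
  have eq2: "(\<lambda>x. \<phi> x * f x) = (\<lambda>x. (I x * (indicator \<Omega> x * f x)) * \<phi> x)"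
    unfolding eq I_def using r by (auto simp: fun_eq_iff indicator_def)
  have m: "(\<lambda>x. indicator \<Omega> x * f x) \<in> borel_measurable lebesgue"
    using f by (simp add: L2_def set_borel_measurable_def)
  have Im: "I \<in> borel_measurable lebesgue" unfolding I_def by (intro borel_measurable_indicator) auto
  have i: "integrable lebesgue (\<lambda>x. (indicator \<Omega> x * f x)\<^sup>2)"
  proof -
    have "(\<lambda>x. (indicator \<Omega> x * f x)\<^sup>2) = (\<lambda>x. indicator \<Omega> x *\<^sub>R (f x)\<^sup>2)"
      by (auto simp: fun_eq_iff indicator_def)
    then show ?thesis using f by (simp add: L2_def set_integrable_def)
  qed
  have "L2c (\<lambda>x. I x * (indicator \<Omega> x * f x))"
    unfolding L2c_def
  proof (intro conjI exI allI impI)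
    show "(\<lambda>x. I x * (indicator \<Omega> x * f x)) \<in> borel_measurable lebesgue" using m Im by simp
    then show "integrable lebesgue (\<lambda>x. (I x * (indicator \<Omega> x * f x))\<^sup>2)"
      by (intro Bochner_Integration.integrable_bound[OF i]) (auto simp: I_def indicator_def)
    show "norm x > r \<Longrightarrow> I x * (indicator \<Omega> x * f x) = 0" for x :: "real^'n" by (simp add: I_def)
  qed
  then show ?thesis unfolding eq2 by (rule L2c_mult_continuous) (rule test_fnD(2)[OF \<phi>])
qed

text \<open>The bounded support is carried by \<open>w\<close> and \<open>D\<close>, so \<psi>
  ranges over all smooth functions. Reflected mollifiers and derivatives of mollifications can then
  be used as \<psi> without any check of their supports.\<close>

definition global_wgrad :: "(real^'n::finite \<Rightarrow> real) \<Rightarrow> ('n \<Rightarrow> real^'n \<Rightarrow> real) \<Rightarrow> bool" where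
  "global_wgrad w D \<longleftrightarrow> L2c w \<and> (\<forall>j. L2c (D j)) \<and>
     (\<forall>\<psi> j. C_inf UNIV \<psi> \<longrightarrow> (\<integral>x. w x * partial j \<psi> x \<partial>lebesgue) = - (\<integral>x. D j x * \<psi> x \<partial>lebesgue))"

lemma set_lebesgue_integral_eq:
  assumes "\<And>x. x \<notin> \<Omega> \<Longrightarrow> f x = 0"
  shows "(LINT x:\<Omega>|lebesgue. f x) = (\<integral>x. f x \<partial>lebesgue)"
  unfolding set_lebesgue_integral_def
  by (rule Bochner_Integration.integral_cong) (use assms in \<open>auto simp: indicator_def\<close>)

text \<open>For any smooth \<psi> the product of \<phi> and \<psi> is a test function on \<Omega>.
  The Leibniz term with the derivative of \<phi> is moved to the other side, where it joins the
  gradient.\<close>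

lemma global_wgrad_localize:
  fixes u :: "real^'n::finite \<Rightarrow> real^'n"
  assumes u: "weak_grad \<Omega> u Du" and \<phi>: "test_fn \<Omega> \<phi>"
  shows "global_wgrad (\<lambda>x. \<phi> x * u x $ b) (\<lambda>j x. \<phi> x * Du x $ b $ j + partial j \<phi> x * u x $ b)"
proof -
  have ub: "L2 \<Omega> (\<lambda>x. u x $ b)" and Dub: "L2 \<Omega> (\<lambda>x. Du x $ b $ j)" for j
    using u by (auto simp: weak_grad_def)
  have l: "L2c (\<lambda>x. \<phi> x * u x $ b)" "L2c (\<lambda>x. \<phi> x * Du x $ b $ j)" "L2c (\<lambda>x. partial j \<phi> x * u x $ b)" for j
    by (intro L2c_localize[OF ub] L2c_localize[OF Dub] \<phi> test_fn_partial)+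
  show ?thesis
    unfolding global_wgrad_def
  proof (intro conjI allI impI)
    fix \<psi> :: "real^'n \<Rightarrow> real" and j :: 'n assume \<psi>: "C_inf UNIV \<psi>"
    have c: "continuous_on UNIV \<psi>" "continuous_on UNIV (partial j \<psi>)"
      using C_inf_continuous \<psi> C_inf_partial by blast+
    note i = L2c_integrable[OF L2c_mult_continuous]
    have p: "partial j (\<lambda>x. \<phi> x * \<psi> x) x = partial j \<phi> x * \<psi> x + \<phi> x * partial j \<psi> x" for x
      by (rule partial_eqI, rule partial_mult_has_derivative[OF test_fnD(1)[OF \<phi>] \<psi>])
    have "(LINT x:\<Omega>|lebesgue. u x $ b * partial j (\<lambda>x. \<phi> x * \<psi> x) x) = - (LINT x:\<Omega>|lebesgue. Du x $ b $ j * (\<phi> x * \<psi> x))"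
      using u test_fn_mult[OF \<phi> \<psi>] unfolding weak_grad_def by blast
    also have "(LINT x:\<Omega>|lebesgue. u x $ b * partial j (\<lambda>x. \<phi> x * \<psi> x) x)
       = (\<integral>x. (partial j \<phi> x * u x $ b) * \<psi> x + (\<phi> x * u x $ b) * partial j \<psi> x \<partial>lebesgue)"
      using test_fnD(4)[OF \<phi>] test_fnD(4)[OF test_fn_partial[OF \<phi>]]
      by (subst set_lebesgue_integral_eq) (auto simp: p algebra_simps)
    also have "\<dots> = (\<integral>x. (partial j \<phi> x * u x $ b) * \<psi> x \<partial>lebesgue) + (\<integral>x. (\<phi> x * u x $ b) * partial j \<psi> x \<partial>lebesgue)"
      by (intro Bochner_Integration.integral_add i l c)
    also have "(LINT x:\<Omega>|lebesgue. Du x $ b $ j * (\<phi> x * \<psi> x)) = (\<integral>x. (\<phi> x * Du x $ b $ j) * \<psi> x \<partial>lebesgue)"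
      using test_fnD(4)[OF \<phi>] by (subst set_lebesgue_integral_eq) (auto simp: algebra_simps)
    finally have "(\<integral>x. (\<phi> x * u x $ b) * partial j \<psi> x \<partial>lebesgue)
       = - ((\<integral>x. (\<phi> x * Du x $ b $ j) * \<psi> x \<partial>lebesgue) + (\<integral>x. (partial j \<phi> x * u x $ b) * \<psi> x \<partial>lebesgue))" by linarith
    also have "(\<integral>x. (\<phi> x * Du x $ b $ j) * \<psi> x \<partial>lebesgue) + (\<integral>x. (partial j \<phi> x * u x $ b) * \<psi> x \<partial>lebesgue)
       = (\<integral>x. (\<phi> x * Du x $ b $ j) * \<psi> x + (partial j \<phi> x * u x $ b) * \<psi> x \<partial>lebesgue)"
      by (intro Bochner_Integration.integral_add[symmetric] i l c)
    finally show "(\<integral>x. \<phi> x * u x $ b * partial j \<psi> x \<partial>lebesgue) = - (\<integral>x. (\<phi> x * Du x $ b $ j + partial j \<phi> x * u x $ b) * \<psi> x \<partial>lebesgue)"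
      by (simp add: algebra_simps)
  qed (intro l L2c_add)+
qed

text \<open>The derivative falls on the mollifier. The reflected argument and the definition of the
  weak derivative each bring a minus sign, and the two cancel.\<close>

lemma smooth_partial:
  assumes w: "global_wgrad w D"
  shows "partial j (smooth k w) = smooth k (D j)"
proof
  fix x
  have wi: "integrable lebesgue w" using w by (auto simp: global_wgrad_def L2c_integrable)
  let ?G = "moll k"
  let ?m = "(\<lambda>_. 0)(j := Suc 0)"
  have "partial j (smooth k w) x = (\<integral>y. ?G ?m (x - y) * w y \<partial>lebesgue)"
    unfolding smooth_def by (subst conv_partial[OF moll wi]) (simp add: conv_def)
  also have "\<dots> = - (\<integral>y. w y * partial j (\<lambda>y. ?G (\<lambda>_. 0) (x - y)) y \<partial>lebesgue)"
    by (simp add: mollifier_reflect_partial[OF moll] mult.commute)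
  also have "\<dots> = (\<integral>y. D j y * ?G (\<lambda>_. 0) (x - y) \<partial>lebesgue)"
    using w mollifier_reflect_C_inf[OF moll, of k "\<lambda>_. 0" x] unfolding global_wgrad_def by simp
  finally show "partial j (smooth k w) x = smooth k (D j) x"
    by (simp add: smooth_def conv_def mult.commute)
qed

section \<open>Korn's inequality\<close>

lemma L2c_imp_L2:
  assumes "L2c f" "\<Omega> \<in> sets lebesgue"
  shows "L2 \<Omega> f"
  unfolding L2_def set_borel_measurable_def set_integrable_def
  using L2cD[OF assms(1)] assms(2) by (intro conjI integrable_mult_indicator borel_measurable_scaleR borel_measurable_indicator)

lemma L2c_continuous:
  fixes f :: "real^'n::finite \<Rightarrow> real"
  assumes "continuous_on UNIV f" "\<And>x. norm x > r \<Longrightarrow> f x = 0"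
  shows "L2c f"
proof -
  have "integrable lborel (\<lambda>x. (f x)\<^sup>2)"
    by (rule integrable_continuous_compact[where e = r]) (use assms in \<open>auto intro!: continuous_intros\<close>)
  then have "integrable lebesgue (\<lambda>x. (f x)\<^sup>2)" by (simp add: integrable_completion)
  then show ?thesis
    using assms continuous_imp_lebesgue_measurable[OF assms(1)] unfolding L2c_def by blast
qed

lemma L2c_diff: "L2c f \<Longrightarrow> L2c g \<Longrightarrow> L2c (\<lambda>x. f x - g x)"
  using L2c_add[of f "\<lambda>x. g x * (- 1)"] L2c_mult_continuous[of g "\<lambda>_. - 1"] by simp

lemma L2c_smooth:
  fixes w :: "real^'n::finite \<Rightarrow> real"
  assumes w: "L2c w"
  shows "L2c (smooth k w)"
proof -
  obtain r where r: "\<And>x. norm x > r \<Longrightarrow> w x = 0" using w unfolding L2c_def by blast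
  show ?thesis
  proof (rule L2c_continuous)
    show "continuous_on UNIV (smooth k w)"
      unfolding smooth_def by (rule conv_continuous[OF moll L2c_integrable[OF w]])
    fix x :: "real^'n" assume x: "norm x > r + 1 / real (Suc k)"
    show "smooth k w x = 0"
      unfolding smooth_def
    proof (rule conv_eq_0[OF moll])
      fix y assume "norm (x - y) \<le> 1 / real (Suc k)"
      then have "norm y > r" using norm_triangle_ineq2[of x y] x by linarith
      then show "w y = 0" by (rule r)
    qed
  qed
qed

lemma L2c_product_integrable: "L2c f \<Longrightarrow> L2c g \<Longrightarrow> integrable lebesgue (\<lambda>x. f x * g x)"
  by (intro integrable_product_L2 L2cD)

lemma smooth_weak_tendsto:
  assumes f: "L2c f" and g: "L2c g"
  shows "(\<lambda>k. \<integral>x. f x * smooth k g x \<partial>lebesgue) \<longlonglongrightarrow> (\<integral>x. f x * g x \<partial>lebesgue)"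
proof (rule LIMSEQ_I)
  fix e :: real assume e: "e > 0"
  define N2 where "N2 = (\<integral>x. (f x)\<^sup>2 \<partial>lebesgue)"
  have N2: "N2 \<ge> 0" by (simp add: N2_def)
  \<comment> \<open>Weight in the pointwise bound of \<open>\<bar>f x * h x\<bar>\<close> by
    \<open>t\<close> times the square of \<open>f x\<close> plus the square of \<open>h x\<close>
    divided by \<open>t\<close>, which plays the role of Cauchy-Schwarz. The first part integrates
    to at most \<open>e / 2\<close>; the index is taken so large that the second stays below
    \<open>e / 4\<close>. The summand 1 covers \<open>N2 = 0\<close>.\<close>
  define t where "t = e / (2 * (N2 + 1))"
  have t: "t > 0" using e N2 by (simp add: t_def)
  have tN: "t * N2 \<le> e / 2" using e N2 by (simp add: t_def field_simps)
  have "\<exists>N. \<forall>k\<ge>N. norm ((\<integral>x. (smooth k g x - g x)\<^sup>2 \<partial>lebesgue) - 0) < t * (e / 4)"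
    using smooth_L2_tendsto[OF L2c_integrable[OF g] L2cD(2)[OF g]] t e by (intro LIMSEQ_D) auto
  then obtain N where N: "\<And>k. k \<ge> N \<Longrightarrow> (\<integral>x. (smooth k g x - g x)\<^sup>2 \<partial>lebesgue) < t * (e / 4)" by auto
  show "\<exists>N. \<forall>k\<ge>N. norm ((\<integral>x. f x * smooth k g x \<partial>lebesgue) - (\<integral>x. f x * g x \<partial>lebesgue)) < e"
  proof (intro exI[of _ N] allI impI)
    fix k assume k: "k \<ge> N"
    define h where "h x = smooth k g x - g x" for x
    have h: "L2c h" unfolding h_def by (intro L2c_diff L2c_smooth g)
    have le: "\<bar>f x * h x\<bar> \<le> t * (f x)\<^sup>2 + (h x)\<^sup>2 / t" for x
    proof -
      have "2 * (\<bar>t * f x\<bar> * \<bar>h x\<bar>) \<le> (t * f x)\<^sup>2 + (h x)\<^sup>2"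
        using sum_squares_bound[of "\<bar>t * f x\<bar>" "\<bar>h x\<bar>"] by simp
      moreover have "0 \<le> \<bar>t * f x\<bar> * \<bar>h x\<bar>" by simp
      ultimately have "\<bar>t * f x\<bar> * \<bar>h x\<bar> \<le> (t * f x)\<^sup>2 + (h x)\<^sup>2" by linarith
      then show ?thesis using t by (simp add: abs_mult field_simps power2_eq_square)
    qed
    have "(\<integral>x. f x * smooth k g x \<partial>lebesgue) - (\<integral>x. f x * g x \<partial>lebesgue) = (\<integral>x. f x * h x \<partial>lebesgue)"
      unfolding h_def right_diff_distrib
      by (rule Bochner_Integration.integral_diff[symmetric]) (intro L2c_product_integrable f g L2c_smooth)+
    also have "\<bar>\<dots>\<bar> \<le> (\<integral>x. \<bar>f x * h x\<bar> \<partial>lebesgue)" by (rule integral_abs_bound)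
    also have "\<dots> \<le> (\<integral>x. t * (f x)\<^sup>2 + (h x)\<^sup>2 / t \<partial>lebesgue)"
      using L2c_product_integrable[OF f h] L2cD(2)[OF f] L2cD(2)[OF h] le by (intro integral_mono) auto
    also have "\<dots> = t * N2 + (\<integral>x. (h x)\<^sup>2 \<partial>lebesgue) / t"
      using L2cD(2)[OF f] L2cD(2)[OF h] by (simp add: N2_def)
    also have "\<dots> \<le> e / 2 + e / 4"
      using tN N[OF k] t unfolding h_def by (intro add_mono) (auto simp: field_simps)
    also have "\<dots> < e" using e by simp
    finally show "norm ((\<integral>x. f x * smooth k g x \<partial>lebesgue) - (\<integral>x. f x * g x \<partial>lebesgue)) < e" by simp
  qed
qed

text \<open>With \<open>i\<close> and \<open>j\<close> chosen suitably this turns the cross terms in Korn's inequality into a squared divergence.\<close>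

lemma global_wgrad_swap:
  assumes w: "global_wgrad w D" and w': "global_wgrad w' D'"
  shows "(\<integral>x. D i x * D' j x \<partial>lebesgue) = (\<integral>x. D j x * D' i x \<partial>lebesgue)"
proof (rule LIMSEQ_unique)
  have L: "L2c w'" "\<And>i. L2c (D i)" "\<And>i. L2c (D' i)" using w w' by (auto simp: global_wgrad_def)
  show "(\<lambda>k. \<integral>x. D i x * smooth k (D' j) x \<partial>lebesgue) \<longlonglongrightarrow> (\<integral>x. D i x * D' j x \<partial>lebesgue)"
    by (intro smooth_weak_tendsto L)
  have S: "C_inf UNIV (smooth k w')" for k
    unfolding smooth_def by (rule conv_C_inf[OF moll L2c_integrable[OF L(1)]])
  have wk: "C_inf UNIV \<psi> \<Longrightarrow> (\<integral>x. D i x * \<psi> x \<partial>lebesgue) = - (\<integral>x. w x * partial i \<psi> x \<partial>lebesgue)" for \<psi> i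
    using w by (simp add: global_wgrad_def)
  have "(\<integral>x. D i x * smooth k (D' j) x \<partial>lebesgue) = (\<integral>x. D j x * smooth k (D' i) x \<partial>lebesgue)" for k
  proof -
    have "(\<integral>x. D i x * smooth k (D' j) x \<partial>lebesgue) = (\<integral>x. D i x * partial j (smooth k w') x \<partial>lebesgue)"
      by (simp add: smooth_partial[OF w'])
    also have "\<dots> = - (\<integral>x. w x * partial i (partial j (smooth k w')) x \<partial>lebesgue)"
      by (intro wk C_inf_partial S)
    \<comment> \<open>Second derivatives are available for the mollification only. Hence one factor
      is mollified while the other remains a weak derivative, and the mollification is removed in
      the limit.\<close>
    also have "partial i (partial j (smooth k w')) = partial j (partial i (smooth k w'))"
      unfolding smooth_def by (rule conv_partial_commute[OF moll L2c_integrable[OF L(1)]])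
    also have "- (\<integral>x. w x * partial j (partial i (smooth k w')) x \<partial>lebesgue) = (\<integral>x. D j x * partial i (smooth k w') x \<partial>lebesgue)"
      by (intro wk[symmetric] C_inf_partial S)
    finally show ?thesis by (simp add: smooth_partial[OF w'])
  qed
  then show "(\<lambda>k. \<integral>x. D i x * smooth k (D' j) x \<partial>lebesgue) \<longlonglongrightarrow> (\<integral>x. D j x * D' i x \<partial>lebesgue)"
    using smooth_weak_tendsto[OF L(2) L(3), of j i] by simp
qed

text \<open>Pointwise, twice the square of the symmetric part is \<open>S x + P x\<close>, where
  \<open>P\<close> contracts \<open>D\<close> with its transpose. Integrated, \<open>P\<close>
  equals the squared trace of \<open>D\<close>, hence is nonnegative; dropping it leaves the
  constant 2.\<close>

lemma korn:
  fixes D :: "'n::finite \<Rightarrow> 'n \<Rightarrow> real^'n \<Rightarrow> real"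
  assumes w: "\<And>b. global_wgrad (w b) (D b)"
  shows "(\<integral>x. (\<Sum>b\<in>UNIV. \<Sum>j\<in>UNIV. (D b j x)\<^sup>2) \<partial>lebesgue)
     \<le> 2 * (\<integral>x. (\<Sum>b\<in>UNIV. \<Sum>j\<in>UNIV. ((D b j x + D j b x) / 2)\<^sup>2) \<partial>lebesgue)"
proof -
  have L: "L2c (D b j)" for b j using w by (auto simp: global_wgrad_def)
  note I = L2c_product_integrable[OF L L]
  define S where "S x = (\<Sum>b\<in>UNIV. \<Sum>j\<in>UNIV. (D b j x)\<^sup>2)" for x
  define P where "P x = (\<Sum>b\<in>UNIV. \<Sum>j\<in>UNIV. D b j x * D j b x)" for x
  define Q where "Q x = (\<Sum>b\<in>UNIV. \<Sum>j\<in>UNIV. D b b x * D j j x)" for x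
  have int: "integrable lebesgue S" "integrable lebesgue P" "integrable lebesgue Q"
    unfolding S_def P_def Q_def power2_eq_square by (intro Bochner_Integration.integrable_sum I)+
  have pt: "2 * (\<Sum>b\<in>UNIV. \<Sum>j\<in>UNIV. ((D b j x + D j b x) / 2)\<^sup>2) = S x + P x" for x
  proof -
    have "(\<Sum>b\<in>UNIV. \<Sum>j\<in>UNIV. (D j b x)\<^sup>2) = S x"
      unfolding S_def by (rule sum.swap)
    moreover have "2 * (\<Sum>b\<in>UNIV. \<Sum>j\<in>UNIV. ((D b j x + D j b x) / 2)\<^sup>2)
       = (\<Sum>b\<in>UNIV. \<Sum>j\<in>UNIV. (D b j x)\<^sup>2 / 2 + (D j b x)\<^sup>2 / 2 + D b j x * D j b x)"
      unfolding sum_distrib_left by (intro sum.cong refl) (simp add: power2_eq_square field_simps)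
    moreover have "\<dots> = S x / 2 + (\<Sum>b\<in>UNIV. \<Sum>j\<in>UNIV. (D j b x)\<^sup>2) / 2 + P x"
      by (simp add: sum.distrib S_def P_def sum_divide_distrib)
    ultimately show ?thesis by simp
  qed
  have "(\<integral>x. P x \<partial>lebesgue) = (\<Sum>b\<in>UNIV. \<Sum>j\<in>UNIV. \<integral>x. D b j x * D j b x \<partial>lebesgue)"
    unfolding P_def by (simp add: Bochner_Integration.integral_sum I)
  \<comment> \<open>The directions \<open>j\<close> and \<open>b\<close> are exchanged between the
    fields \<open>D b\<close> and \<open>D j\<close>.\<close>
  also have "\<dots> = (\<Sum>b\<in>UNIV. \<Sum>j\<in>UNIV. \<integral>x. D b b x * D j j x \<partial>lebesgue)"
    by (intro sum.cong refl global_wgrad_swap[OF w w])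
  also have "\<dots> = (\<integral>x. Q x \<partial>lebesgue)"
    unfolding Q_def by (simp add: Bochner_Integration.integral_sum I)
  also have "\<dots> = (\<integral>x. (\<Sum>b\<in>UNIV. D b b x)\<^sup>2 \<partial>lebesgue)"
    unfolding Q_def by (simp add: power2_eq_square sum_product)
  also have "\<dots> \<ge> 0" by simp
  finally have "(\<integral>x. S x \<partial>lebesgue) \<le> (\<integral>x. S x + P x \<partial>lebesgue)" using int by simp
  also have "\<dots> = 2 * (\<integral>x. (\<Sum>b\<in>UNIV. \<Sum>j\<in>UNIV. ((D b j x + D j b x) / 2)\<^sup>2) \<partial>lebesgue)"
    unfolding pt[symmetric] by simp
  finally show ?thesis unfolding S_def .
qed

text \<open>Both candidates have the same mollifications, namely the partial derivatives of the
  mollified \<open>w\<close>, and each is the L2 limit of its own.\<close>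

lemma global_wgrad_unique:
  assumes w: "global_wgrad w D" and w': "global_wgrad w D'"
  shows "AE x in lebesgue. D j x = D' j x"
proof -
  have L: "L2c (D j)" "L2c (D' j)" using w w' by (auto simp: global_wgrad_def)
  note Ld = L2c_diff[OF L]
  have eq: "smooth k (D j) = smooth k (D' j)" for k
    using smooth_partial[OF w, of j k] smooth_partial[OF w', of j k] by simp
  define f where "f x = D j x - D' j x" for x
  have f: "L2c f" unfolding f_def by (rule Ld)
  have "(\<integral>x. (f x)\<^sup>2 \<partial>lebesgue)
      \<le> 2 * (\<integral>x. (smooth k (D j) x - D j x)\<^sup>2 \<partial>lebesgue) + 2 * (\<integral>x. (smooth k (D' j) x - D' j x)\<^sup>2 \<partial>lebesgue)" for k
  proof -
    have i: "integrable lebesgue (\<lambda>x. (smooth k (D j) x - D j x)\<^sup>2)" "integrable lebesgue (\<lambda>x. (smooth k (D' j) x - D' j x)\<^sup>2)"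
      by (intro L2cD(2) L2c_diff L2c_smooth L)+
    have "(\<integral>x. (f x)\<^sup>2 \<partial>lebesgue) \<le> (\<integral>x. 2 * (smooth k (D j) x - D j x)\<^sup>2 + 2 * (smooth k (D' j) x - D' j x)\<^sup>2 \<partial>lebesgue)"
    proof (rule integral_mono)
      fix x
      have "0 \<le> (smooth k (D' j) x - D j x + (smooth k (D' j) x - D' j x))\<^sup>2" by simp
      then show "(f x)\<^sup>2 \<le> 2 * (smooth k (D j) x - D j x)\<^sup>2 + 2 * (smooth k (D' j) x - D' j x)\<^sup>2"
        unfolding f_def eq by (simp add: power2_eq_square algebra_simps)
    qed (use L2cD(2)[OF f] i in auto)
    then show ?thesis using i by simp
  qed
  moreover have "(\<lambda>k. 2 * (\<integral>x. (smooth k (D j) x - D j x)\<^sup>2 \<partial>lebesgue) + 2 * (\<integral>x. (smooth k (D' j) x - D' j x)\<^sup>2 \<partial>lebesgue))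
      \<longlonglongrightarrow> 2 * 0 + 2 * 0"
    by (intro tendsto_intros smooth_L2_tendsto L2c_integrable L2cD(2) L)
  ultimately have "(\<integral>x. (f x)\<^sup>2 \<partial>lebesgue) \<le> 2 * 0 + 2 * 0"
    by (intro LIMSEQ_le_const[of _ "2 * 0 + 2 * 0"]) auto
  then have "(\<integral>x. (f x)\<^sup>2 \<partial>lebesgue) = 0"
    by (intro antisym) auto
  then have "AE x in lebesgue. (f x)\<^sup>2 = 0"
    using integral_nonneg_eq_0_iff_AE[OF L2cD(2)[OF f]] by simp
  then show ?thesis by eventually_elim (simp add: f_def)
qed

section \<open>Localized fields as admissible test fields\<close>

lemma norm_vec_square: "(norm x)\<^sup>2 = (\<Sum>i\<in>UNIV. (norm (x $ i))\<^sup>2)" for x :: "'a::real_normed_vector ^ 'n::finite"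
  by (simp add: norm_vec_def L2_set_def sum_nonneg)

lemma norm_matrix_square: "(norm A)\<^sup>2 = (\<Sum>i\<in>UNIV. \<Sum>j\<in>UNIV. (A $ i $ j)\<^sup>2)" for A :: "real^'m::finite^'n::finite"
  by (simp add: norm_vec_square)

definition loc_grad :: "(real^'n::finite \<Rightarrow> real) \<Rightarrow> (real^'n \<Rightarrow> real^'n) \<Rightarrow> (real^'n \<Rightarrow> real^'n^'n) \<Rightarrow> real^'n \<Rightarrow> real^'n^'n" where
  "loc_grad \<phi> u Du x = (\<chi> b j. \<phi> x * Du x $ b $ j + partial j \<phi> x * u x $ b)"

lemma weak_grad_localize:
  fixes u :: "real^'n::finite \<Rightarrow> real^'n"
  assumes u: "weak_grad \<Omega> u Du" and \<phi>: "test_fn \<Omega> \<phi>" and \<Omega>: "open \<Omega>"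
  shows "weak_grad \<Omega> (\<lambda>x. \<phi> x *\<^sub>R u x) (loc_grad \<phi> u Du)"
proof -
  note g = global_wgrad_localize[OF u \<phi>]
  have "L2c (\<lambda>x. \<phi> x * u x $ b)" "L2c (\<lambda>x. \<phi> x * Du x $ b $ j + partial j \<phi> x * u x $ b)" for b j
    using g[of b] by (auto simp: global_wgrad_def)
  note L = this[THEN L2c_imp_L2, of \<Omega>]
  show ?thesis
    unfolding weak_grad_def loc_grad_def
  proof (intro conjI allI impI)
    fix b j \<psi> assume \<psi>: "test_fn \<Omega> \<psi>"
    have "(\<integral>x. (\<phi> x * u x $ b) * partial j \<psi> x \<partial>lebesgue) = - (\<integral>x. (\<phi> x * Du x $ b $ j + partial j \<phi> x * u x $ b) * \<psi> x \<partial>lebesgue)"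
      using g[of b] test_fnD(1)[OF \<psi>] unfolding global_wgrad_def by blast
    then show "(LINT x:\<Omega>|lebesgue. (\<phi> x *\<^sub>R u x) $ b * partial j \<psi> x) =
       - (LINT x:\<Omega>|lebesgue. (\<chi> b j. \<phi> x * Du x $ b $ j + partial j \<phi> x * u x $ b) $ b $ j * \<psi> x)"
      using test_fnD(4)[OF \<psi>] test_fnD(4)[OF test_fn_partial[OF \<psi>]]
      by (subst (1 2) set_lebesgue_integral_eq) auto
  qed (use L \<Omega> in auto)
qed

text \<open>Mollifying \<open>\<phi> x *\<^sub>R u x\<close> at scales so small that the support
  stays inside \<Omega> gives the approximating test fields. Their gradients are the mollified weak
  gradients, so L2 convergence of mollifications is convergence in the norm of H1.\<close>

lemma H10_localize:
  fixes u :: "real^'n::finite \<Rightarrow> real^'n"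
  assumes u: "weak_grad \<Omega> u Du" and \<phi>: "test_fn \<Omega> \<phi>" and \<Omega>: "open \<Omega>"
  shows "H10 \<Omega> (\<lambda>x. \<phi> x *\<^sub>R u x)"
proof -
  define w where "w b x = \<phi> x * u x $ b" for b x
  define D where "D b j x = \<phi> x * Du x $ b $ j + partial j \<phi> x * u x $ b" for b j x
  have g: "global_wgrad (w b) (D b)" for b
    unfolding w_def D_def by (rule global_wgrad_localize[OF u \<phi>])
  have L: "L2c (w b)" "L2c (D b j)" for b j using g[of b] by (auto simp: global_wgrad_def)
  define K where "K = tsupport \<phi>"
  have K: "compact K" "K \<subseteq> \<Omega>" using test_fnD(5,6)[OF \<phi>] by (auto simp: K_def)
  obtain e where e: "e > 0" "(\<Union>x\<in>K. cball x e) \<subseteq> \<Omega>"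
    using compact_subset_open_imp_cball_epsilon_subset[OF K(1) \<Omega> K(2)] by blast
  have eq: "(\<Union>x\<in>K. cball x e) = {x + y |x y. x \<in> K \<and> y \<in> cball 0 e}"
    by (auto simp: dist_norm) (metis add_diff_cancel_left' diff_add_cancel norm_minus_commute add.commute)
  have cK: "compact (\<Union>x\<in>K. cball x e)"
    unfolding eq by (intro compact_sums K) simp
  \<comment> \<open>The mollifier of index \<open>k\<close> has radius
    \<open>1 / real (Suc k)\<close>; shifting the sequence by \<open>N\<close> keeps all supports
    within distance \<open>e\<close> of that of \<phi>.\<close>
  obtain N where N: "1 / real (Suc N) < e" using e(1) nat_approx_posE by blast
  define \<Phi> :: "nat \<Rightarrow> real^'n \<Rightarrow> real^'n" where "\<Phi> k x = (\<chi> b. smooth (k + N) (w b) x)" for k x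
  have t: "test_fn \<Omega> (smooth (k + N) (w b))" for k b
  proof (rule test_fnI[OF _ cK e(2)])
    show "C_inf UNIV (smooth (k + N) (w b))"
      unfolding smooth_def by (rule conv_C_inf[OF moll L2c_integrable[OF L(1)]])
    fix x assume x: "x \<notin> (\<Union>x\<in>K. cball x e)"
    show "smooth (k + N) (w b) x = 0"
      unfolding smooth_def
    proof (rule conv_eq_0[OF moll])
      fix y assume y: "norm (x - y) \<le> 1 / real (Suc (k + N))"
      have "1 / real (Suc (k + N)) \<le> 1 / real (Suc N)" by (simp add: frac_le)
      then have "dist y x \<le> e" using y N by (simp add: dist_norm norm_minus_commute)
      then have "y \<notin> K" using x by auto
      then show "w b y = 0" using test_fnD(3)[OF \<phi>] by (simp add: w_def K_def)
    qed
  qed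
  have cg: "cgrad (\<Phi> k) x $ b $ j = smooth (k + N) (D b j) x" for k x b j
    by (simp add: cgrad_def \<Phi>_def smooth_partial[OF g])
  have z: "w b x = 0" "D b j x = 0" "smooth (k + N) (w b) x = 0" "smooth (k + N) (D b j) x = 0" if "x \<notin> \<Omega>" for b j k x
    using test_fnD(4)[OF \<phi> that] test_fnD(4)[OF test_fn_partial[OF \<phi>] that] test_fnD(4)[OF t that]
      test_fnD(4)[OF test_fn_partial[OF t] that] by (simp_all add: w_def D_def smooth_partial[OF g])
  have i: "integrable lebesgue (\<lambda>x. (smooth (k + N) (w b) x - w b x)\<^sup>2)"
      "integrable lebesgue (\<lambda>x. (smooth (k + N) (D b j) x - D b j x)\<^sup>2)" for k b j
    by (intro L2cD(2) L2c_diff L2c_smooth L)+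
  have E: "(LINT x:\<Omega>|lebesgue. (norm (\<Phi> k x - \<phi> x *\<^sub>R u x))\<^sup>2 + (norm (cgrad (\<Phi> k) x - loc_grad \<phi> u Du x))\<^sup>2)
    = (\<Sum>b\<in>UNIV. \<integral>x. (smooth (k + N) (w b) x - w b x)\<^sup>2 \<partial>lebesgue)
      + (\<Sum>b\<in>UNIV. \<Sum>j\<in>UNIV. \<integral>x. (smooth (k + N) (D b j) x - D b j x)\<^sup>2 \<partial>lebesgue)" for k
  proof -
    have p: "(norm (\<Phi> k x - \<phi> x *\<^sub>R u x))\<^sup>2 + (norm (cgrad (\<Phi> k) x - loc_grad \<phi> u Du x))\<^sup>2
      = (\<Sum>b\<in>UNIV. (smooth (k + N) (w b) x - w b x)\<^sup>2) + (\<Sum>b\<in>UNIV. \<Sum>j\<in>UNIV. (smooth (k + N) (D b j) x - D b j x)\<^sup>2)" for x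
      unfolding norm_matrix_square by (simp add: norm_vec_square cg) (simp add: \<Phi>_def w_def D_def loc_grad_def)
    show ?thesis
      unfolding p by (subst set_lebesgue_integral_eq) (simp_all add: z i)
  qed
  have "(\<lambda>k. (\<Sum>b\<in>UNIV. \<integral>x. (smooth (k + N) (w b) x - w b x)\<^sup>2 \<partial>lebesgue)
      + (\<Sum>b\<in>UNIV. \<Sum>j\<in>UNIV. \<integral>x. (smooth (k + N) (D b j) x - D b j x)\<^sup>2 \<partial>lebesgue))
    \<longlonglongrightarrow> (\<Sum>b\<in>(UNIV::'n set). 0) + (\<Sum>b\<in>(UNIV::'n set). \<Sum>j\<in>(UNIV::'n set). 0)"
    by (intro tendsto_add tendsto_sum LIMSEQ_ignore_initial_segment[of "\<lambda>k. \<integral>x. (smooth k _ x - _ x)\<^sup>2 \<partial>lebesgue"]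
        smooth_L2_tendsto L2c_integrable L2cD(2) L)
  then have "(\<lambda>k. LINT x:\<Omega>|lebesgue. (norm (\<Phi> k x - \<phi> x *\<^sub>R u x))\<^sup>2 + (norm (cgrad (\<Phi> k) x - loc_grad \<phi> u Du x))\<^sup>2) \<longlonglongrightarrow> 0"
    unfolding E by simp
  moreover have "\<forall>k b. test_fn \<Omega> (\<lambda>x. \<Phi> k x $ b)" using t by (simp add: \<Phi>_def)
  ultimately show ?thesis
    unfolding H10_def using weak_grad_localize[OF u \<phi> \<Omega>] by blast
qed

section \<open>Cutoff functions constant on the inclusions\<close>

lemma perforated_separated:
  assumes "perforated Fam"
  obtains c where "c > 0"
    "\<And>F G x y. F \<in> Fam \<Longrightarrow> G \<in> Fam \<Longrightarrow> F \<noteq> G \<Longrightarrow> x \<in> closure F \<Longrightarrow> y \<in> closure G \<Longrightarrow> c \<le> dist x y"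
proof -
  have "\<exists>c>0. \<forall>F\<in>Fam. \<forall>G\<in>Fam. F \<noteq> G \<longrightarrow> (\<forall>x\<in>F. \<forall>y\<in>G. c \<le> dist x y)"
    using assms unfolding perforated_def by (elim conjE)
  then obtain c where c: "c > 0" "\<forall>F\<in>Fam. \<forall>G\<in>Fam. F \<noteq> G \<longrightarrow> (\<forall>x\<in>F. \<forall>y\<in>G. c \<le> dist x y)"
    by (elim exE conjE)
  have "c \<le> dist x y" if FG: "F \<in> Fam" "G \<in> Fam" "F \<noteq> G" and xy: "x \<in> closure F" "y \<in> closure G" for F G x y
  proof -
    have "F \<noteq> {}" "G \<noteq> {}" using FG assms by (auto simp: perforated_def lipschitz_domain_def)
    then have "c \<le> setdist F G" using c(2) FG by (intro le_setdistI) auto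
    also have "\<dots> = setdist (closure F) (closure G)" by simp
    also have "\<dots> \<le> dist x y" using xy by (rule setdist_le_dist)
    finally show ?thesis .
  qed
  then show thesis by (rule that[OF c(1)])
qed

lemma finite_separated_in_compact:
  fixes P :: "'a::metric_space set"
  assumes "compact S" "P \<subseteq> S" "c > 0" "\<And>x y. x \<in> P \<Longrightarrow> y \<in> P \<Longrightarrow> x \<noteq> y \<Longrightarrow> c \<le> dist x y"
  shows "finite P"
proof (rule ccontr)
  assume "infinite P"
  then obtain l where "l islimpt P" using assms(1,2) unfolding compact_eq_Bolzano_Weierstrass by blast
  then have inf: "infinite (P \<inter> ball l (c / 2))" using assms(3) unfolding islimpt_eq_infinite_ball by simp
  then obtain a where a: "a \<in> P \<inter> ball l (c / 2)" by (metis finite.emptyI ex_in_conv)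
  have "P \<inter> ball l (c / 2) \<subseteq> {a}"
  proof
    fix b assume b: "b \<in> P \<inter> ball l (c / 2)"
    then have "dist a b < c" using a dist_triangle_half_r[of l a c b] by simp
    then show "b \<in> {a}" using assms(4)[of a b] a b by auto
  qed
  then show False using inf finite_subset by blast
qed

text \<open>Periodicity moves only the union of the closures, so a translate of an inclusion need
  not be recognised as a member of the family. Being connected, it lies in a single
  \<open>closure G\<close>, since the closures are separated by a fixed gap. If the translation
  brings a point to the unit cell, \<open>G\<close> is one of the finitely many inclusions whose
  closures meet the cell, and its diameter bounds that of the original.\<close>

lemma perforated_diameter_bounded:
  fixes Fam :: "(real^'n::finite) set set"
  assumes P: "perforated Fam"
  obtains D where "D > 0" "\<And>F x y. F \<in> Fam \<Longrightarrow> x \<in> F \<Longrightarrow> y \<in> F \<Longrightarrow> dist x y \<le> D"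
proof -
  obtain c where c: "c > 0"
    "\<And>F G x y. F \<in> Fam \<Longrightarrow> G \<in> Fam \<Longrightarrow> F \<noteq> G \<Longrightarrow> x \<in> closure F \<Longrightarrow> y \<in> closure G \<Longrightarrow> c \<le> dist x y"
    using perforated_separated[OF P] by metis
  define H where "H = (\<Union>F\<in>Fam. closure F)"
  have per: "x + z \<in> H" if "x \<in> H" "int_vec z" for x z
    using P that unfolding perforated_def Let_def H_def by blast
  have dom: "connected F" "bounded F" "F \<noteq> {}" if "F \<in> Fam" for F
    using P that by (auto simp: perforated_def lipschitz_domain_def)
  \<comment> \<open>On the union of the closures, \<open>infdist v G\<close> takes no value strictly
    between 0 and \<open>c\<close>. The open conditions \<open>< c\<close> and \<open>> 0\<close>
    would therefore disconnect a set that meets \<open>closure G\<close> without lying in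
    it.\<close>
  have comp: "S \<subseteq> closure G" if S: "connected S" "S \<subseteq> H" and G: "G \<in> Fam" and x: "x \<in> S" "x \<in> closure G" for S G x
  proof (rule ccontr)
    assume "\<not> S \<subseteq> closure G"
    then obtain y where y: "y \<in> S" "y \<notin> closure G" by blast
    have G0: "infdist v G = 0 \<longleftrightarrow> v \<in> closure G" for v using in_closure_iff_infdist_zero dom(3)[OF G] by metis
    have far: "infdist v G \<ge> c" if "v \<in> S" "v \<notin> closure G" for v
    proof -
      obtain F where F: "F \<in> Fam" "v \<in> closure F" using \<open>v \<in> S\<close> S(2) unfolding H_def by blast
      have "F \<noteq> G" using F that by blast
      then have "c \<le> dist v g" if "g \<in> G" for g
        using c(2)[OF F(1) G _ F(2)] closure_subset[of G] that by blast
      then show ?thesis unfolding infdist_def using dom(3)[OF G] by (auto intro!: cINF_greatest)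
    qed
    let ?A = "{v. infdist v G < c}" and ?B = "{v. 0 < infdist v G}"
    have "open ?A" "open ?B" by (intro open_Collect_less continuous_intros)+
    moreover have "?A \<inter> ?B \<inter> S = {}"
    proof (rule equals0I)
      fix v assume v: "v \<in> ?A \<inter> ?B \<inter> S"
      then have "v \<notin> closure G" using G0[of v] by auto
      then show False using far[of v] v by auto
    qed
    moreover have "S \<subseteq> ?A \<union> ?B" using c(1) by (auto simp: not_less)
    ultimately have "?A \<inter> S = {} \<or> ?B \<inter> S = {}" using connectedD[OF S(1)] by blast
    moreover have "x \<in> ?A \<inter> S" using x G0[of x] c(1) by auto
    moreover have "y \<in> ?B \<inter> S" using y far[OF y] c(1) by auto
    ultimately show False by blast
  qed
  let ?Q = "cbox 0 (1 :: real^'n)"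
  define T where "T = {F \<in> Fam. closure F \<inter> ?Q \<noteq> {}}"
  have "finite T"
  proof -
    have "\<forall>F\<in>T. \<exists>x. x \<in> closure F \<inter> ?Q" by (auto simp: T_def)
    then obtain p where p: "\<And>F. F \<in> T \<Longrightarrow> p F \<in> closure F \<inter> ?Q" by metis
    have sep: "c \<le> dist (p F) (p G)" if "F \<in> T" "G \<in> T" "F \<noteq> G" for F G
      using c(2)[of F G "p F" "p G"] p[OF that(1)] p[OF that(2)] that by (auto simp: T_def)
    have "inj_on p T" using sep c(1) by (intro inj_onI) (metis dist_self not_le)
    moreover have "finite (p ` T)"
      by (rule finite_separated_in_compact[OF compact_cbox[of 0 1] _ c(1)]) (use p sep in auto)
    ultimately show ?thesis using finite_image_iff by blast
  qed
  \<comment> \<open>The sum over the finitely many inclusions that meet the cell bounds each of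
    their diameters; the summand 1 makes \<open>D\<close> positive.\<close>
  define D where "D = 1 + (\<Sum>F\<in>T. diameter (closure F))"
  have dpos: "diameter (closure F) \<ge> 0" if "F \<in> T" for F
    using that dom(2) by (intro diameter_ge_0) (auto simp: T_def)
  have "dist x y \<le> D" if F: "F \<in> Fam" "x \<in> F" "y \<in> F" for F x y
  proof -
    \<comment> \<open>With this integer vector, \<open>x + z\<close> consists of the fractional
      parts of the coordinates of \<open>x\<close>.\<close>
    define z :: "real^'n" where "z = (\<chi> i. - of_int \<lfloor>x $ i\<rfloor>)"
    have z: "int_vec z" by (simp add: int_vec_def z_def)
    let ?S = "(\<lambda>v. v + z) ` closure F"
    have "connected (closure F)" using dom(1)[OF F(1)] by (rule connected_imp_connected_closure)
    then have S: "connected ?S" by (intro connected_continuous_image continuous_intros)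
    have SH: "?S \<subseteq> H"
    proof
      fix s assume "s \<in> ?S"
      then obtain v where v: "v \<in> closure F" "s = v + z" by blast
      have "v \<in> H" using v(1) F(1) by (auto simp: H_def)
      then show "s \<in> H" using per z v(2) by blast
    qed
    have xS: "x + z \<in> ?S" "y + z \<in> ?S" using F closure_subset by auto
    then obtain G where G: "G \<in> Fam" "x + z \<in> closure G" using SH by (auto simp: H_def)
    have "x + z \<in> ?Q"
      by (auto simp: mem_box_cart z_def) linarith+
    then have GT: "G \<in> T" using G by (auto simp: T_def)
    have "?S \<subseteq> closure G" by (rule comp[OF S SH G(1) xS(1) G(2)])
    then have "dist (x + z) (y + z) \<le> diameter (closure G)"
      using xS dom(2)[OF G(1)] by (intro diameter_bounded_bound) auto
    also have "\<dots> \<le> (\<Sum>F\<in>T. diameter (closure F))"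
      using GT \<open>finite T\<close> dpos by (intro member_le_sum) auto
    finally show ?thesis by (simp add: D_def)
  qed
  moreover have "D > 0" using dpos unfolding D_def by (smt (verit) sum_nonneg)
  ultimately show thesis using that by blast
qed

section \<open>Construction of the cutoff\<close>

lemma cube_iff_infnorm: "x \<in> cube R \<longleftrightarrow> infnorm x < R / 2" for x :: "real^'n::finite"
proof -
  have "infnorm x < R / 2 \<longleftrightarrow> (\<forall>i\<in>Basis. \<bar>x \<bullet> i\<bar> < R / 2)"
    unfolding infnorm_Max by (subst Max_less_iff) auto
  also have "\<dots> \<longleftrightarrow> x \<in> cube R"
    unfolding cube_def mem_box by (auto simp: abs_less_iff)
  finally show ?thesis by simp
qed

lemma compact_infnorm_ball: "compact {x :: real^'n::finite. infnorm x \<le> r}"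
proof -
  have "closed {x :: real^'n. infnorm x \<le> r}"
    by (intro closed_Collect_le continuous_on_infnorm continuous_intros)
  moreover have "bounded {x :: real^'n. infnorm x \<le> r}"
    unfolding bounded_iff
  proof (intro exI ballI)
    fix x :: "real^'n" assume "x \<in> {x. infnorm x \<le> r}"
    then show "norm x \<le> sqrt (real DIM(real^'n)) * r"
      using norm_le_infnorm[of x] by (intro order_trans[OF norm_le_infnorm]) (simp add: mult_left_mono)
  qed
  ultimately show ?thesis by (simp add: compact_eq_bounded_closed)
qed

text \<open>Cubes are balls of \<open>infnorm\<close>, so the cutoff is built from a profile in
  \<open>infnorm\<close>; this converts Euclidean displacements into its terms.\<close>

lemma infnorm_diff_le_dist: "\<bar>infnorm x - infnorm y\<bar> \<le> dist x y" for x y :: "real^'n::finite"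
  using infnorm_triangle[of y "x - y"] infnorm_triangle[of x "y - x"] infnorm_sub[of x y] infnorm_le_norm[of "x - y"]
  by (simp add: dist_norm)

text \<open>The kernel has mass 1 and lives in the ball of radius \<open>e\<close>. This yields the
  plateau of the cutoff, its constancy on each inclusion, and the vanishing integral of the
  first-order kernels.\<close>

lemma conv_locally_constant:
  assumes G: "mollifier e G" and c: "\<And>y. norm (x - y) \<le> e \<Longrightarrow> g y = c"
  shows "conv (G (\<lambda>_. 0)) g x = c"
proof -
  have "G (\<lambda>_. 0) (x - y) * g y = G (\<lambda>_. 0) (x - y) * c" for y
    using c[of y] mollifier_zero[OF G, of "x - y" "\<lambda>_. 0"] by (cases "norm (x - y) \<le> e") auto
  then have "(\<lambda>y. G (\<lambda>_. 0) (x - y) * g y) = (\<lambda>y. G (\<lambda>_. 0) (x - y) * c)" by (rule ext)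
  then show ?thesis unfolding conv_def by (simp add: mollifier_reflect_integral[OF G])
qed

text \<open>Mollifying the indicator of a large ball gives the constant 1 near \<open>x\<close>, so
  its derivative at \<open>x\<close> is 0; and that derivative is this integral, because the
  indicator equals 1 wherever the kernel does not vanish.\<close>

lemma mollifier_partial_integral:
  fixes G :: "('n::finite \<Rightarrow> nat) \<Rightarrow> real^'n \<Rightarrow> real"
  assumes G: "mollifier e G"
  shows "(\<integral>y. G ((\<lambda>_. 0)(j := Suc 0)) (x - y) \<partial>lebesgue) = 0"
proof -
  \<comment> \<open>In the radius, the 1 leaves room for a neighbourhood of \<open>x\<close> and
    \<open>e\<close> for the support of the kernel.\<close>
  define h where "h = (indicator (cball 0 (norm x + 1 + e)) :: real^'n \<Rightarrow> real)"
  have hi: "integrable lebesgue h"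
    unfolding h_def by (intro integrable_real_indicator) (use lmeasurable_cball[of 0 "norm x + 1 + e"] in \<open>auto simp: fmeasurable_def\<close>)
  have "conv (G (\<lambda>_. 0)) h z = 1" if z: "z \<in> ball x 1" for z
  proof (rule conv_locally_constant[OF G])
    fix y assume "norm (z - y) \<le> e"
    then have "norm y \<le> norm x + 1 + e"
      using z norm_triangle_ineq2[of y z] norm_triangle_ineq2[of z x] by (simp add: dist_norm norm_minus_commute)
    then show "h y = 1" by (simp add: h_def)
  qed
  then have "partial j (conv (G (\<lambda>_. 0)) h) x = 0"
    by (intro partial_eq_0_locally[of "ball x 1" _ _ 1]) auto
  then have "conv (G ((\<lambda>_. 0)(j := Suc 0))) h x = 0" by (simp add: conv_partial[OF G hi])
  moreover have "G m (x - y) * h y = G m (x - y)" for m y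
  proof (cases "norm (x - y) \<le> e")
    case True
    then have "norm y \<le> norm x + 1 + e" using norm_triangle_ineq2[of y x] by (simp add: norm_minus_commute)
    then show ?thesis by (simp add: h_def)
  qed (simp add: mollifier_zero[OF G])
  ultimately show ?thesis by (simp add: conv_def)
qed

text \<open>Only the oscillation of \<open>g\<close> on the scale of the mollifier enters, so \<open>g\<close> may jump.\<close>

lemma conv_partial_bound:
  fixes G :: "('n::finite \<Rightarrow> nat) \<Rightarrow> real^'n \<Rightarrow> real"
  assumes G: "mollifier e G" and g: "integrable lebesgue g"
    and osc: "\<And>y. norm (x - y) \<le> e \<Longrightarrow> \<bar>g y - g x\<bar> \<le> t"
  shows "\<bar>partial j (conv (G (\<lambda>_. 0)) g) x\<bar> \<le> t * (\<integral>y. \<bar>G ((\<lambda>_. 0)(j := Suc 0)) y\<bar> \<partial>lborel)"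
proof -
  define H where "H = G ((\<lambda>_. 0)(j := Suc 0))"
  have Hm: "H \<in> borel_measurable borel" unfolding H_def by (rule borel_measurable_continuous_onI[OF mollifier_continuous[OF G]])
  have Hl: "integrable lborel (\<lambda>y. H (x - y))" unfolding H_def by (rule mollifier_reflect_integrable[OF G])
  then have Hi: "integrable lebesgue (\<lambda>y. H (x - y))"
    by (simp add: integrable_completion)
  have Hg: "integrable lebesgue (\<lambda>y. H (x - y) * g y)" unfolding H_def by (rule conv_integrable[OF G g])
  have d: "integrable lebesgue (\<lambda>y. H (x - y) * (g y - g x))"
    unfolding right_diff_distrib using Hg Hi by simp
  have "partial j (conv (G (\<lambda>_. 0)) g) x = (\<integral>y. H (x - y) * g y \<partial>lebesgue)"
    by (simp add: conv_partial[OF G g] conv_def H_def)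
  also have "\<dots> = (\<integral>y. H (x - y) * g y \<partial>lebesgue) - (\<integral>y. H (x - y) \<partial>lebesgue) * g x"
    using mollifier_partial_integral[OF G] by (simp add: H_def)
  also have "\<dots> = (\<integral>y. H (x - y) * (g y - g x) \<partial>lebesgue)"
    unfolding right_diff_distrib using Hg Hi by simp
  also have "\<bar>\<dots>\<bar> \<le> (\<integral>y. \<bar>H (x - y) * (g y - g x)\<bar> \<partial>lebesgue)" by (rule integral_abs_bound)
  also have "\<dots> \<le> (\<integral>y. t * \<bar>H (x - y)\<bar> \<partial>lebesgue)"
  proof (rule integral_mono)
    fix y
    show "\<bar>H (x - y) * (g y - g x)\<bar> \<le> t * \<bar>H (x - y)\<bar>"
    proof (cases "norm (x - y) \<le> e")
      case True
      then show ?thesis using mult_right_mono[OF osc[OF True], of "\<bar>H (x - y)\<bar>"] by (simp add: abs_mult mult.commute)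
    next
      case False
      then have "H (x - y) = 0" unfolding H_def by (intro mollifier_zero[OF G]) simp
      then show ?thesis by simp
    qed
  qed (use d Hi in auto)
  also have "\<dots> = t * (\<integral>y. \<bar>H (x - y)\<bar> \<partial>lborel)"
    using borel_measurable_integrable[OF Hl] by (simp add: integral_completion)
  also have "(\<integral>y. \<bar>H (x - y)\<bar> \<partial>lborel) = (\<integral>y. \<bar>H y\<bar> \<partial>lborel)"
    using Hm by (intro lborel_reflect[of "\<lambda>y. \<bar>H y\<bar>"]) simp
  finally show ?thesis unfolding H_def .
qed

text \<open>Slope \<open>8 / R\<close>, equal to 1 on the cube of side \<open>5 R / 8\<close> and 0 off the cube of side
  \<open>7 R / 8\<close>: this leaves room of width \<open>R / 16\<close> on both sides for the modification near the inclusions.\<close>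

definition radial_cutoff :: "real \<Rightarrow> real^'n::finite \<Rightarrow> real" where
  "radial_cutoff R x = max 0 (min 1 ((7 * R / 16 - infnorm x) * (8 / R)))"

lemma radial_cutoff_lipschitz:
  assumes "R > 0"
  shows "\<bar>radial_cutoff R x - radial_cutoff R y\<bar> \<le> dist x y * (8 / R)"
proof -
  have "\<bar>radial_cutoff R x - radial_cutoff R y\<bar> \<le> \<bar>(7 * R / 16 - infnorm x) * (8 / R) - (7 * R / 16 - infnorm y) * (8 / R)\<bar>"
    unfolding radial_cutoff_def by linarith
  also have "\<dots> = \<bar>infnorm x - infnorm y\<bar> * (8 / R)"
  proof -
    have "(7 * R / 16 - infnorm x) * (8 / R) - (7 * R / 16 - infnorm y) * (8 / R) = (infnorm y - infnorm x) * (8 / R)"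
      by (simp only: left_diff_distrib)
    then show ?thesis using assms by (simp only: abs_mult) (simp add: abs_minus_commute)
  qed
  also have "\<dots> \<le> dist x y * (8 / R)" using assms by (intro mult_right_mono infnorm_diff_le_dist) auto
  finally show ?thesis .
qed

lemma radial_cutoff_eq:
  assumes "R > 0"
  shows "infnorm x \<le> 5 * R / 16 \<Longrightarrow> radial_cutoff R x = 1" "infnorm x \<ge> 7 * R / 16 \<Longrightarrow> radial_cutoff R x = 0"
    "0 \<le> radial_cutoff R x" "radial_cutoff R x \<le> 1"
proof -
  show "radial_cutoff R x = 1" if "infnorm x \<le> 5 * R / 16"
  proof -
    have "1 = (2 * R / 16) * (8 / R)" using assms by simp
    also have "\<dots> \<le> (7 * R / 16 - infnorm x) * (8 / R)" using assms that by (intro mult_right_mono) auto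
    finally show ?thesis by (simp add: radial_cutoff_def)
  qed
  show "radial_cutoff R x = 0" if "infnorm x \<ge> 7 * R / 16"
  proof -
    have "(7 * R / 16 - infnorm x) * (8 / R) \<le> 0" using assms that by (intro mult_nonpos_nonneg) auto
    then show ?thesis by (simp add: radial_cutoff_def)
  qed
qed (auto simp: radial_cutoff_def)

text \<open>Making a profile constant near every inclusion destroys its continuity, but amounts to a
  bounded displacement of its argument. \<open>conv_partial_bound\<close> asks only for small
  oscillation at the mollifier's scale, and \<open>M\<close>, the sum of the L1 norms of the
  first-order kernels, is independent of \<open>R\<close>.\<close>

lemma cutoff_exists:
  fixes Fam :: "(real^'n::finite) set set"
  assumes P: "perforated Fam"
  obtains K R0 where "K > 0" "R0 > 0"
    "\<And>R. R \<ge> R0 \<Longrightarrow> \<exists>\<phi>. test_fn (cube R) \<phi> \<and> (\<forall>x\<in>cube (R / 2). \<phi> x = 1) \<and>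
        (\<forall>x j. \<bar>partial j \<phi> x\<bar> \<le> K / R) \<and> (\<forall>x\<in>\<Union>Fam. \<forall>j. partial j \<phi> x = 0)"
proof -
  obtain c where c: "c > 0"
    "\<And>F G x y. F \<in> Fam \<Longrightarrow> G \<in> Fam \<Longrightarrow> F \<noteq> G \<Longrightarrow> x \<in> closure F \<Longrightarrow> y \<in> closure G \<Longrightarrow> c \<le> dist x y"
    using perforated_separated[OF P] by metis
  obtain D where D: "D > 0" "\<And>F x y. F \<in> Fam \<Longrightarrow> x \<in> F \<Longrightarrow> y \<in> F \<Longrightarrow> dist x y \<le> D"
    using perforated_diameter_bounded[OF P] by metis
  have dom: "open F" "F \<noteq> {}" if "F \<in> Fam" for F
    using P that by (auto simp: perforated_def lipschitz_domain_def)
  \<comment> \<open>Since \<open>2 * r < c\<close>, the neighbourhoods of radius \<open>r\<close> of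
    two different inclusions are disjoint.\<close>
  define r where "r = c / 3"
  have r: "r > 0" using c by (simp add: r_def)
  \<comment> \<open>A radius below \<open>r\<close> ensures that the mollification at a point of an
    inclusion sees only the neighbourhood of that inclusion. The bound 1 matches the summand 1 in
    \<open>L\<close>.\<close>
  define e where "e = min (r / 2) 1"
  have e: "e > 0" "e < r" "e \<le> 1" using r by (auto simp: e_def)
  obtain G :: "('n \<Rightarrow> nat) \<Rightarrow> real^'n \<Rightarrow> real" where G: "mollifier e G" using mollifier_exists[OF e(1)] by blast
  define N where "N F = {x. infdist x F < r}" for F :: "(real^'n) set"
  have Nopen: "open (N F)" for F unfolding N_def by (intro open_Collect_less continuous_intros)
  have Nnear: "\<exists>f\<in>F. dist x f < r" if "x \<in> N F" "F \<in> Fam" for x F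
    using that dom(2)[OF that(2)] unfolding N_def infdist_def by (auto simp: cINF_less_iff)
  have Ndisj: "F = F'" if FF: "F \<in> Fam" "F' \<in> Fam" "x \<in> N F" "x \<in> N F'" for F F' x
  proof (rule ccontr)
    assume ne: "F \<noteq> F'"
    obtain f where f: "f \<in> F" "dist x f < r" using Nnear[OF FF(3,1)] by blast
    obtain f' where f': "f' \<in> F'" "dist x f' < r" using Nnear[OF FF(4,2)] by blast
    have "dist f f' < 2 * r" using f f' dist_triangle3[of f f' x] by linarith
    moreover have "c \<le> dist f f'" using c(2)[OF FF(1,2) ne] f f' closure_subset by blast
    ultimately show False using c(1) by (simp add: r_def)
  qed
  define p where "p F = (SOME x. x \<in> F)" for F :: "(real^'n) set"
  have p: "p F \<in> F" if "F \<in> Fam" for F unfolding p_def using dom(2)[OF that] by (simp add: some_in_eq)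
  define U where "U = (\<Union>F\<in>Fam. N F)"
  \<comment> \<open>Points near an inclusion are sent to its base point, all others stay. A profile
    composed with \<open>q\<close> is constant near each inclusion, at the price of jumps;
    \<open>q\<close> moves points by at most \<open>D + r\<close>.\<close>
  define q where "q x = (if x \<in> U then p (THE F. F \<in> Fam \<and> x \<in> N F) else x)" for x
  have q: "q x = p F" if "F \<in> Fam" "x \<in> N F" for F x
  proof -
    have "(THE F. F \<in> Fam \<and> x \<in> N F) = F" using that Ndisj by (intro the_equality) blast+
    then show ?thesis using that by (auto simp: q_def U_def)
  qed
  have qd: "dist x (q x) \<le> D + r" for x
  proof (cases "x \<in> U")
    case True
    then obtain F where F: "F \<in> Fam" "x \<in> N F" by (auto simp: U_def)
    obtain f where f: "f \<in> F" "dist x f < r" using Nnear[OF F(2,1)] by blast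
    have "dist f (p F) \<le> D" using D(2)[OF F(1) f(1) p[OF F(1)]] .
    then show ?thesis using f dist_triangle[of x "p F" f] q[OF F] by simp
  qed (use D r in \<open>simp add: q_def\<close>)
  define L where "L = D + r + 1"
  have L: "L > 0" using D r by (simp add: L_def)
  define M where "M = (\<Sum>j\<in>UNIV. \<integral>y. \<bar>G ((\<lambda>_. 0)(j := Suc 0)) y\<bar> \<partial>lborel)"
  \<comment> \<open>The factor 24 is 3 displacements times the slope constant 8;
    \<open>M + 1\<close> instead of \<open>M\<close> makes \<open>K\<close> positive without further
    argument.\<close>
  define K where "K = 24 * L * (M + 1)"
  have M: "M \<ge> 0" unfolding M_def by (intro sum_nonneg) simp
  have K: "K > 0" using L M by (simp add: K_def)
  have "\<exists>\<phi>. test_fn (cube R) \<phi> \<and> (\<forall>x\<in>cube (R / 2). \<phi> x = 1) \<and>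
        (\<forall>x j. \<bar>partial j \<phi> x\<bar> \<le> K / R) \<and> (\<forall>x\<in>\<Union>Fam. \<forall>j. partial j \<phi> x = 0)" if R: "R \<ge> 32 * L" for R
  proof -
    have R0: "R > 0" using R L by simp
    define g :: "real^'n \<Rightarrow> real" where "g x = radial_cutoff R (q x)" for x
    have qi: "\<bar>infnorm x - infnorm (q x)\<bar> \<le> D + r" for x
      using qd[of x] infnorm_diff_le_dist[of x "q x"] by linarith
    \<comment> \<open>Displacement and mollifier radius together fit into \<open>R / 32\<close>. So
      the cutoff vanishes once \<open>infnorm\<close> exceeds
      \<open>7 * R / 16 + R / 32 = 15 * R / 32\<close>, and the plateau \<open>5 * R / 16\<close>
      shrinks to no less than \<open>R / 4\<close>, the half-side of the inner cube.\<close>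
    have LR: "D + r + 1 \<le> R / 32" using R by (simp add: L_def)
    have g0: "g x = 0" if "infnorm x \<ge> 7 * R / 16 + (D + r)" for x
      unfolding g_def using qi[of x] that by (intro radial_cutoff_eq[OF R0]) linarith
    have g1: "g x = 1" if "infnorm x \<le> 5 * R / 16 - (D + r)" for x
      unfolding g_def using qi[of x] that by (intro radial_cutoff_eq[OF R0]) linarith
    \<comment> \<open>The path runs from \<open>q y\<close> to \<open>y\<close>, to
      \<open>x\<close>, to \<open>q x\<close>, each leg being at most \<open>L\<close>; the jumps of
      \<open>q\<close> are thereby accounted for.\<close>
    have gosc: "\<bar>g y - g x\<bar> \<le> 3 * L * (8 / R)" if "norm (x - y) \<le> e" for x y
    proof -
      have "dist (q y) (q x) \<le> dist (q y) y + dist y x + dist x (q x)"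
        using dist_triangle[of "q y" "q x" y] dist_triangle[of y "q x" x] by linarith
      also have "\<dots> \<le> 3 * L"
        using qd[of x] qd[of y] that e D r by (simp add: dist_commute dist_norm norm_minus_commute L_def)
      finally have "dist (q y) (q x) * (8 / R) \<le> 3 * L * (8 / R)" using R0 by (intro mult_right_mono) auto
      then show ?thesis using radial_cutoff_lipschitz[OF R0, of "q y" "q x"] unfolding g_def by linarith
    qed
    \<comment> \<open>On the open set \<open>U\<close> the function is locally constant, and off
      \<open>U\<close> it is the continuous radial profile; measurability survives the
      jumps.\<close>
    have gm: "g \<in> borel_measurable borel"
    proof -
      have Uo: "open U" unfolding U_def using Nopen by blast
      have "continuous_on (N F) g" if "F \<in> Fam" for F
        by (rule continuous_on_eq[of _ "\<lambda>_. radial_cutoff R (p F)"]) (use q[OF that] in \<open>auto simp: g_def\<close>)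
      then have 1: "continuous_on U g" unfolding U_def by (intro continuous_on_open_UN Nopen)
      have "continuous_on UNIV (radial_cutoff R :: real^'n \<Rightarrow> real)"
        unfolding radial_cutoff_def by (intro continuous_intros continuous_on_infnorm)
      then have 2: "continuous_on (- U) (radial_cutoff R :: real^'n \<Rightarrow> real)" by (rule continuous_on_subset) simp
      have "(\<lambda>x. if x \<in> U then g x else radial_cutoff R x) \<in> borel_measurable borel"
        using Uo 1 2 by (intro borel_measurable_continuous_on_if) auto
      also have "(\<lambda>x. if x \<in> U then g x else radial_cutoff R x) = g" by (auto simp: g_def q_def)
      finally show ?thesis .
    qed
    let ?K = "{x :: real^'n. infnorm x \<le> 15 * R / 32}"
    have gi: "integrable lebesgue g"
    proof -
      have "integrable lborel (indicator ?K :: real^'n \<Rightarrow> real)"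
        using compact_infnorm_ball[of "15 * R / 32"] emeasure_compact_finite[of ?K]
        by (intro integrable_real_indicator) (auto intro: borel_compact)
      then have "integrable lborel g"
      proof (rule Bochner_Integration.integrable_bound)
        show "AE x in lborel. norm (g x) \<le> norm (indicat_real ?K x)"
        proof (intro AE_I2)
          fix x
          show "norm (g x) \<le> norm (indicat_real ?K x)"
            using g0[of x] LR radial_cutoff_eq(3,4)[OF R0, of "q x"] by (cases "x \<in> ?K") (auto simp: g_def)
        qed
      qed (use gm in simp)
      then show ?thesis by (simp add: integrable_completion)
    qed
    define \<phi> where "\<phi> = conv (G (\<lambda>_. 0)) g"
    have "test_fn (cube R) \<phi>"
    proof (rule test_fnI[OF _ compact_infnorm_ball])
      show "C_inf UNIV \<phi>" unfolding \<phi>_def by (rule conv_C_inf[OF G gi])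
      show "?K \<subseteq> cube R" using R0 by (auto simp: cube_iff_infnorm)
      fix x assume x: "x \<notin> ?K"
      show "\<phi> x = 0"
        unfolding \<phi>_def
      proof (rule conv_eq_0[OF G])
        fix y assume "norm (x - y) \<le> e"
        then show "g y = 0" using x infnorm_diff_le_dist[of x y] LR e by (intro g0) (simp add: dist_norm)
      qed
    qed
    moreover have "\<phi> x = 1" if x: "x \<in> cube (R / 2)" for x
      unfolding \<phi>_def
    proof (rule conv_locally_constant[OF G])
      fix y assume "norm (x - y) \<le> e"
      then show "g y = 1"
        using x infnorm_diff_le_dist[of x y] LR e R0 by (intro g1) (simp add: dist_norm cube_iff_infnorm)
    qed
    moreover have "\<bar>partial j \<phi> x\<bar> \<le> K / R" for x j
    proof -
      have "\<bar>partial j \<phi> x\<bar> \<le> 3 * L * (8 / R) * (\<integral>y. \<bar>G ((\<lambda>_. 0)(j := Suc 0)) y\<bar> \<partial>lborel)"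
        unfolding \<phi>_def by (rule conv_partial_bound[OF G gi gosc])
      also have "\<dots> \<le> 3 * L * (8 / R) * (M + 1)"
      proof (intro mult_left_mono)
        have "(\<integral>y. \<bar>G ((\<lambda>_. 0)(j := Suc 0)) y\<bar> \<partial>lborel) \<le> M"
          unfolding M_def by (rule member_le_sum) auto
        then show "(\<integral>y. \<bar>G ((\<lambda>_. 0)(j := Suc 0)) y\<bar> \<partial>lborel) \<le> M + 1" by simp
      qed (use L R0 in auto)
      also have "\<dots> = K / R" by (simp add: K_def)
      finally show ?thesis .
    qed
    moreover have "partial j \<phi> x = 0" if x: "x \<in> \<Union>Fam" for x j
    proof -
      obtain F where F: "F \<in> Fam" "x \<in> F" using x by blast
      show ?thesis
      proof (rule partial_eq_0_locally[OF dom(1)[OF F(1)] F(2)])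
        fix y assume y: "y \<in> F"
        show "\<phi> y = radial_cutoff R (p F)"
          unfolding \<phi>_def
        proof (rule conv_locally_constant[OF G])
          fix v assume "norm (y - v) \<le> e"
          then have "infdist v F < r"
            using infdist_le[OF y, of v] e by (simp add: dist_norm norm_minus_commute)
          then show "g v = radial_cutoff R (p F)" using q[OF F(1)] by (simp add: g_def N_def)
        qed
      qed
    qed
    ultimately show ?thesis by blast
  qed
  then show thesis using that[of K "32 * L"] K L by simp
qed

section \<open>The Caccioppoli inequality\<close>

text \<open>As in \<open>weak_solution\<close>, gradients carry the component first and the
  direction second. The bounds in \<open>elast_coeff\<close> list the two indices in the other
  order, which agrees for symmetric matrices.\<close>

definition elast_form :: "(real^'n::finite \<Rightarrow> 'n \<Rightarrow> 'n \<Rightarrow> 'n \<Rightarrow> 'n \<Rightarrow> real) \<Rightarrow> real^'n \<Rightarrow> real^'n^'n \<Rightarrow> real^'n^'n \<Rightarrow> real" where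
  "elast_form A x M N = (\<Sum>i\<in>UNIV. \<Sum>j\<in>UNIV. \<Sum>a\<in>UNIV. \<Sum>b\<in>UNIV. A x i j a b * M $ b $ j * N $ a $ i)"

definition sym_part :: "real^'n::finite^'n \<Rightarrow> real^'n^'n" where
  "sym_part M = (1/2) *\<^sub>R (M + transpose M)"

lemma elast_form_linear:
  "elast_form A x M (N + N') = elast_form A x M N + elast_form A x M N'"
  "elast_form A x (M + M') N = elast_form A x M N + elast_form A x M' N"
  "elast_form A x M (c *\<^sub>R N) = c * elast_form A x M N"
  "elast_form A x (c *\<^sub>R M) N = c * elast_form A x M N"
  unfolding elast_form_def
  by (simp_all add: sum.distrib[symmetric] sum_distrib_left algebra_simps)

lemma transpose_sym_part: "transpose (sym_part M) = sym_part M"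
  by (simp add: sym_part_def transpose_def vec_eq_iff add.commute)

lemma norm_sym_part_le: "norm (sym_part M) \<le> norm M"
proof -
  have "(norm (transpose M))\<^sup>2 = (norm M)\<^sup>2"
    unfolding norm_matrix_square transpose_def by (simp add: sum.swap[of "\<lambda>i j. (M $ j $ i)\<^sup>2"])
  then have "norm (transpose M) = norm M" by (simp add: power2_eq_iff_nonneg)
  then show ?thesis using norm_triangle_ineq[of M "transpose M"] by (simp add: sym_part_def)
qed

context
  fixes A :: "real^'n::finite \<Rightarrow> 'n \<Rightarrow> 'n \<Rightarrow> 'n \<Rightarrow> 'n \<Rightarrow> real" and k1 k2 :: real
  assumes A: "elast_coeff A k1 k2"
begin

lemma A_symmetries: "A x i j a b = A x j i b a" "A x i j a b = A x a j i b"
  using A unfolding elast_coeff_def by blast+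

lemma elast_form_commute: "elast_form A x M N = elast_form A x N M"
proof -
  have "elast_form A x M N = (\<Sum>j\<in>UNIV. \<Sum>i\<in>UNIV. \<Sum>a\<in>UNIV. \<Sum>b\<in>UNIV. A x i j a b * M $ b $ j * N $ a $ i)"
    unfolding elast_form_def by (rule sum.swap)
  also have "\<dots> = (\<Sum>j\<in>UNIV. \<Sum>i\<in>UNIV. \<Sum>b\<in>UNIV. \<Sum>a\<in>UNIV. A x i j a b * M $ b $ j * N $ a $ i)"
    by (intro sum.cong refl sum.swap)
  also have "\<dots> = elast_form A x N M"
    unfolding elast_form_def
  proof (intro sum.cong refl)
    fix i j a b
    show "A x j i b a * M $ a $ i * N $ b $ j = A x i j a b * N $ b $ j * M $ a $ i"
      using A_symmetries(1)[of x i j a b] by simp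
  qed
  finally show ?thesis .
qed

text \<open>The second symmetry of the coefficients exchanges \<open>i\<close> and \<open>a\<close>,
  the two indices attached to \<open>N\<close>.\<close>

lemma elast_form_transpose: "elast_form A x M (transpose N) = elast_form A x M N"
proof -
  have 1: "(\<Sum>j\<in>UNIV. \<Sum>a\<in>UNIV. f j a) = (\<Sum>a\<in>UNIV. \<Sum>j\<in>UNIV. f j a)" for f :: "'n \<Rightarrow> 'n \<Rightarrow> real"
    by (rule sum.swap)
  have "elast_form A x M (transpose N) = (\<Sum>i\<in>UNIV. \<Sum>a\<in>UNIV. \<Sum>j\<in>UNIV. \<Sum>b\<in>UNIV. A x i j a b * M $ b $ j * N $ i $ a)"
    unfolding elast_form_def transpose_def by (subst 1) simp
  also have "\<dots> = (\<Sum>a\<in>UNIV. \<Sum>i\<in>UNIV. \<Sum>j\<in>UNIV. \<Sum>b\<in>UNIV. A x i j a b * M $ b $ j * N $ i $ a)"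
    by (rule sum.swap)
  also have "\<dots> = (\<Sum>a\<in>UNIV. \<Sum>i\<in>UNIV. \<Sum>j\<in>UNIV. \<Sum>b\<in>UNIV. A x a j i b * M $ b $ j * N $ i $ a)"
    using A_symmetries(2) by (intro sum.cong refl) simp
  also have "\<dots> = elast_form A x M N"
    unfolding elast_form_def by (subst 1) simp
  finally show ?thesis .
qed

text \<open>Ellipticity is assumed for symmetric matrices; through this identity it applies to
  gradients and controls their symmetric part.\<close>

lemma elast_form_sym_part: "elast_form A x (sym_part M) (sym_part N) = elast_form A x M N"
proof -
  have r: "elast_form A x M (sym_part N) = elast_form A x M N" for M N
    unfolding sym_part_def by (simp add: elast_form_linear elast_form_transpose)
  have "elast_form A x (sym_part M) (sym_part N) = elast_form A x N (sym_part M)"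
    using r elast_form_commute by simp
  also have "\<dots> = elast_form A x M N" using r elast_form_commute by simp
  finally show ?thesis .
qed

lemma elast_form_bounds:
  assumes "transpose \<xi> = \<xi>"
  shows "k1 * (norm \<xi>)\<^sup>2 \<le> elast_form A x \<xi> \<xi>" "elast_form A x \<xi> \<xi> \<le> k2 * (norm \<xi>)\<^sup>2"
proof -
  have "\<xi> $ b $ j = \<xi> $ j $ b" for b j using assms by (metis transpose_def vec_lambda_beta)
  then have "elast_form A x \<xi> \<xi> = (\<Sum>i\<in>UNIV. \<Sum>j\<in>UNIV. \<Sum>a\<in>UNIV. \<Sum>b\<in>UNIV. A x i j a b * \<xi> $ i $ a * \<xi> $ j $ b)"
    unfolding elast_form_def by (intro sum.cong refl) (simp add: mult.commute mult.left_commute)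
  then show "k1 * (norm \<xi>)\<^sup>2 \<le> elast_form A x \<xi> \<xi>" "elast_form A x \<xi> \<xi> \<le> k2 * (norm \<xi>)\<^sup>2"
    using A assms unfolding elast_coeff_def by auto
qed

text \<open>Expand the nonnegative quantity \<open>elast_form (p e + 2 s) (p e + 2 s)\<close>, where \<open>e\<close> and \<open>s\<close> are
  the symmetric parts of \<open>M\<close> and \<open>S\<close>.\<close>

lemma elast_energy_pointwise:
  assumes k: "0 < k1" "0 < k2"
  shows "k1 / 2 * (norm (p *\<^sub>R sym_part M))\<^sup>2 - 2 * k2 * (norm S)\<^sup>2 \<le> elast_form A x M (p\<^sup>2 *\<^sub>R M + (2 * p) *\<^sub>R S)"
proof -
  define e where "e = sym_part M"
  define s where "s = sym_part S"
  let ?B = "elast_form A x"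
  have "transpose (p *\<^sub>R e + 2 *\<^sub>R s) = p *\<^sub>R e + 2 *\<^sub>R s"
    using transpose_sym_part[of M] transpose_sym_part[of S] unfolding e_def[symmetric] s_def[symmetric]
    by (simp add: transpose_def vec_eq_iff)
  then have "0 \<le> ?B (p *\<^sub>R e + 2 *\<^sub>R s) (p *\<^sub>R e + 2 *\<^sub>R s)"
    using elast_form_bounds(1)[of "p *\<^sub>R e + 2 *\<^sub>R s" x] k(1) by (meson mult_nonneg_nonneg less_imp_le order_trans zero_le_power2)
  also have "\<dots> = p\<^sup>2 * ?B e e + 4 * p * ?B e s + 4 * ?B s s"
    using elast_form_commute[of x s e] by (simp add: elast_form_linear power2_eq_square algebra_simps)
  finally have 1: "0 \<le> p\<^sup>2 * ?B e e + 4 * p * ?B e s + 4 * ?B s s" .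
  have 2: "?B M (p\<^sup>2 *\<^sub>R M + (2 * p) *\<^sub>R S) = p\<^sup>2 * ?B e e + 2 * p * ?B e s"
    by (simp add: elast_form_linear e_def s_def elast_form_sym_part)
  have 3: "p\<^sup>2 * (k1 * (norm e)\<^sup>2) \<le> p\<^sup>2 * ?B e e"
    unfolding e_def by (intro mult_left_mono elast_form_bounds transpose_sym_part) simp
  have "?B s s \<le> k2 * (norm s)\<^sup>2" unfolding s_def by (intro elast_form_bounds transpose_sym_part)
  also have "\<dots> \<le> k2 * (norm S)\<^sup>2"
    unfolding s_def using k(2) by (intro mult_left_mono power_mono norm_sym_part_le) auto
  finally have 4: "?B s s \<le> k2 * (norm S)\<^sup>2" .
  have 5: "k1 / 2 * (norm (p *\<^sub>R e))\<^sup>2 = p\<^sup>2 * (k1 * (norm e)\<^sup>2) / 2" by (simp add: power_mult_distrib)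
  \<comment> \<open>Half of \<open>1\<close> bounds the cross term \<open>2 * p * ?B e s\<close>
    below by minus one half of the first term of \<open>2\<close> and minus
    \<open>2 * ?B s s\<close>; the other half of the first term survives and gives
    \<open>k1 / 2\<close>.\<close>
  show ?thesis unfolding 2 e_def[symmetric] 5 using 1 3 4 by linarith
qed

end

section \<open>Energy estimate and Korn's inequality for the localized solution\<close>

definition tensor_grad :: "(real^'n::finite \<Rightarrow> real) \<Rightarrow> (real^'n \<Rightarrow> real^'n) \<Rightarrow> real^'n \<Rightarrow> real^'n^'n" where
  "tensor_grad \<phi> u x = (\<chi> b j. partial j \<phi> x * u x $ b)"

lemma integrable_norm_square_matrix:
  fixes M :: "real^'n::finite \<Rightarrow> real^'n^'n"
  assumes "\<And>b j. L2c (\<lambda>x. M x $ b $ j)"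
  shows "integrable lebesgue (\<lambda>x. (norm (M x))\<^sup>2)"
  unfolding norm_matrix_square by (intro Bochner_Integration.integrable_sum L2cD(2) assms)

lemma localized_L2c:
  fixes u :: "real^'n::finite \<Rightarrow> real^'n"
  assumes u: "weak_grad \<Omega> u Du" and \<phi>: "test_fn \<Omega> \<phi>"
  shows "L2c (\<lambda>x. (\<phi> x *\<^sub>R Du x) $ b $ j)" "L2c (\<lambda>x. tensor_grad \<phi> u x $ b $ j)"
    "L2c (\<lambda>x. (\<phi> x *\<^sub>R sym_part (Du x)) $ b $ j)"
proof -
  have ub: "L2 \<Omega> (\<lambda>x. u x $ b)" and Dub: "L2 \<Omega> (\<lambda>x. Du x $ b $ j)" for b j
    using u by (auto simp: weak_grad_def)
  show 1: "L2c (\<lambda>x. (\<phi> x *\<^sub>R Du x) $ b $ j)" for b j using L2c_localize[OF Dub \<phi>] by simp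
  show "L2c (\<lambda>x. tensor_grad \<phi> u x $ b $ j)"
    using L2c_localize[OF ub test_fn_partial[OF \<phi>]] by (simp add: tensor_grad_def)
  have "L2c (\<lambda>x. ((\<phi> x *\<^sub>R Du x) $ b $ j + (\<phi> x *\<^sub>R Du x) $ j $ b) * (1 / 2))"
    by (intro L2c_mult_continuous L2c_add 1 continuous_on_const)
  then show "L2c (\<lambda>x. (\<phi> x *\<^sub>R sym_part (Du x)) $ b $ j)"
    by (simp add: sym_part_def transpose_def algebra_simps)
qed

lemma integrable_bounded_mult:
  fixes f g :: "'a \<Rightarrow> real"
  assumes "integrable M f" "g \<in> borel_measurable M" "\<And>x. \<bar>g x\<bar> \<le> B"
  shows "integrable M (\<lambda>x. g x * f x)"
proof (rule Bochner_Integration.integrable_bound)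
  show "integrable M (\<lambda>x. B * f x)" using assms(1) by simp
  show "(\<lambda>x. g x * f x) \<in> borel_measurable M" using assms by simp
  show "AE x in M. norm (g x * f x) \<le> norm (B * f x)"
  proof (intro AE_I2)
    fix x
    have "\<bar>g x\<bar> \<le> \<bar>B\<bar>" using assms(3)[of x] by linarith
    then show "norm (g x * f x) \<le> norm (B * f x)" by (simp add: abs_mult mult_right_mono)
  qed
qed

lemma elast_energy_estimate:
  fixes u :: "real^'n::finite \<Rightarrow> real^'n"
  assumes A: "elast_coeff A k1 k2" and k: "0 < k1" "0 < k2" and \<Omega>: "open \<Omega>" and F: "open F" and t: "t \<ge> 1"
    and u: "weak_grad \<Omega> u Du" and \<phi>: "test_fn \<Omega> \<phi>" and flat: "\<And>x j. x \<in> F \<Longrightarrow> partial j \<phi> x = 0"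
    and sol: "\<And>v Dv. H10 \<Omega> v \<Longrightarrow> weak_grad \<Omega> v Dv \<Longrightarrow>
      (LINT x:\<Omega>|lebesgue. Lambda F t x * elast_form A x (Du x) (Dv x)) = 0"
  shows "k1 * (\<integral>x. (norm (\<phi> x *\<^sub>R sym_part (Du x)))\<^sup>2 \<partial>lebesgue) \<le> 4 * k2 * (\<integral>x. (norm (tensor_grad \<phi> u x))\<^sup>2 \<partial>lebesgue)"
proof -
  define \<psi> where "\<psi> x = \<phi> x * \<phi> x" for x
  have \<psi>: "test_fn \<Omega> \<psi>" unfolding \<psi>_def by (rule test_fn_mult[OF \<phi> test_fnD(1)[OF \<phi>]])
  have p\<psi>: "partial j \<psi> x = 2 * \<phi> x * partial j \<phi> x" for j x
  proof -
    have "\<psi> = (\<lambda>x. \<phi> x * \<phi> x)" by (rule ext) (rule \<psi>_def)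
    then show ?thesis using partial_mult[OF test_fnD(1)[OF \<phi>] test_fnD(1)[OF \<phi>], of j x] by simp
  qed
  define S where "S x = tensor_grad \<phi> u x" for x
  define E where "E x = \<phi> x *\<^sub>R sym_part (Du x)" for x
  have lg: "loc_grad \<psi> u Du x = (\<phi> x)\<^sup>2 *\<^sub>R Du x + (2 * \<phi> x) *\<^sub>R S x" for x
    by (simp add: loc_grad_def S_def tensor_grad_def p\<psi> vec_eq_iff power2_eq_square) (simp add: \<psi>_def)
  define f where "f x = Lambda F t x * elast_form A x (Du x) (loc_grad \<psi> u Du x)" for x
  have "0 = (LINT x:\<Omega>|lebesgue. f x)"
    unfolding f_def by (rule sol[OF H10_localize[OF u \<psi> \<Omega>] weak_grad_localize[OF u \<psi> \<Omega>], symmetric])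
  also have "\<dots> = (\<integral>x. f x \<partial>lebesgue)"
  proof (rule set_lebesgue_integral_eq)
    fix x assume "x \<notin> \<Omega>"
    then have "\<phi> x = 0" by (rule test_fnD(4)[OF \<phi>])
    then show "f x = 0" unfolding f_def lg by (simp add: elast_form_def)
  qed
  finally have f0: "(\<integral>x. f x \<partial>lebesgue) = 0" by simp
  note L = localized_L2c[OF u \<phi>]
  obtain M where M: "\<And>x i j a b. \<bar>A x i j a b\<bar> \<le> M" using A unfolding elast_coeff_def by blast
  have Lam: "\<bar>Lambda F t x\<bar> \<le> t" for x using t by (simp add: Lambda_def)
  have Lm: "Lambda F t \<in> borel_measurable lebesgue"
    unfolding Lambda_def using F by (intro measurable_If_set) auto
  have fi: "integrable lebesgue f"
  proof -
    \<comment> \<open>The two factors \<phi> are shared out, one to each gradient, so that every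
      summand is a bounded function times a product of two \<open>L2c\<close> functions.\<close>
    have eq: "f = (\<lambda>x. \<Sum>i\<in>UNIV. \<Sum>j\<in>UNIV. \<Sum>a\<in>UNIV. \<Sum>b\<in>UNIV. (Lambda F t x * A x i j a b) *
        ((\<phi> x *\<^sub>R Du x) $ b $ j * ((\<phi> x *\<^sub>R Du x) $ a $ i + S x $ a $ i * 2)))"
      unfolding f_def[abs_def] lg elast_form_def
      by (rule ext, simp add: sum_distrib_left) (intro sum.cong refl, simp add: power2_eq_square algebra_simps)
    show ?thesis
      unfolding eq
    proof (intro Bochner_Integration.integrable_sum, rule integrable_bounded_mult[where B = "t * M"])
      fix i j a b
      show "integrable lebesgue (\<lambda>x. (\<phi> x *\<^sub>R Du x) $ b $ j * ((\<phi> x *\<^sub>R Du x) $ a $ i + S x $ a $ i * 2))"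
        unfolding S_def by (intro L2c_product_integrable L2c_add L2c_mult_continuous L continuous_on_const)
      show "(\<lambda>x. Lambda F t x * A x i j a b) \<in> borel_measurable lebesgue"
        using Lm A unfolding elast_coeff_def by (intro borel_measurable_times) auto
      show "\<bar>Lambda F t x * A x i j a b\<bar> \<le> t * M" for x
        unfolding abs_mult using Lam M t by (intro mult_mono) auto
    qed
  qed
  have Ei: "integrable lebesgue (\<lambda>x. (norm (E x))\<^sup>2)" and Si: "integrable lebesgue (\<lambda>x. (norm (S x))\<^sup>2)"
    unfolding E_def S_def by (intro integrable_norm_square_matrix L)+
  have "k1 / 2 * (\<integral>x. (norm (E x))\<^sup>2 \<partial>lebesgue) - 2 * k2 * (\<integral>x. (norm (S x))\<^sup>2 \<partial>lebesgue)
     = (\<integral>x. k1 / 2 * (norm (E x))\<^sup>2 - 2 * k2 * (norm (S x))\<^sup>2 \<partial>lebesgue)"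
    using Ei Si by simp
  also have "\<dots> \<le> (\<integral>x. f x \<partial>lebesgue)"
  proof (rule integral_mono)
    fix x
    have pw: "k1 / 2 * (norm (E x))\<^sup>2 - 2 * k2 * (norm (S x))\<^sup>2 \<le> elast_form A x (Du x) (loc_grad \<psi> u Du x)"
      unfolding E_def lg by (rule elast_energy_pointwise[OF A k])
    show "k1 / 2 * (norm (E x))\<^sup>2 - 2 * k2 * (norm (S x))\<^sup>2 \<le> f x"
    proof (cases "x \<in> F")
      case True
      \<comment> \<open>On \<open>F\<close> the cross term is absent and the form is bounded below
        by a nonnegative multiple of the square of \<open>E x\<close>; the weight \<open>t\<close>
        can only enlarge it and so drops out of the lower bound.\<close>
      have "S x = 0" using flat[OF True] by (simp add: S_def tensor_grad_def vec_eq_iff)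
      then have pw': "k1 / 2 * (norm (E x))\<^sup>2 \<le> elast_form A x (Du x) (loc_grad \<psi> u Du x)" using pw by simp
      moreover have "0 \<le> k1 / 2 * (norm (E x))\<^sup>2" using k by simp
      ultimately have "0 \<le> elast_form A x (Du x) (loc_grad \<psi> u Du x)" by linarith
      then have "1 * elast_form A x (Du x) (loc_grad \<psi> u Du x) \<le> t * elast_form A x (Du x) (loc_grad \<psi> u Du x)"
        using t by (intro mult_right_mono) auto
      then show ?thesis using pw' \<open>S x = 0\<close> True by (simp add: f_def Lambda_def)
    qed (use pw in \<open>simp add: f_def Lambda_def\<close>)
  qed (use Ei Si fi in auto)
  finally show ?thesis unfolding f0 E_def S_def by linarith
qed

lemma norm_add_square_le: "(norm (a + b))\<^sup>2 \<le> 2 * (norm a)\<^sup>2 + 2 * (norm b)\<^sup>2" for a b :: "'a::real_normed_vector"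
proof -
  have "(norm (a + b))\<^sup>2 \<le> (norm a + norm b)\<^sup>2" by (intro power_mono norm_triangle_ineq) simp
  also have "\<dots> \<le> 2 * (norm a)\<^sup>2 + 2 * (norm b)\<^sup>2"
    using sum_squares_bound[of "norm a" "norm b"] by (simp add: power2_sum)
  finally show ?thesis .
qed

lemma norm_sym_part_square:
  "(norm (sym_part M))\<^sup>2 = (\<Sum>b\<in>UNIV. \<Sum>j\<in>UNIV. ((M $ b $ j + M $ j $ b) / 2)\<^sup>2)"
  unfolding norm_matrix_square by (simp add: sym_part_def transpose_def)

text \<open>The gradient of the localized field is \<open>D = P + S\<close>, with symmetric part
  \<open>E + sym_part (S x)\<close>. Korn and one splitting of the square give 4 and 4; returning to
  \<open>P = D - S\<close> doubles both and adds 2, hence 8 and 10.\<close>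

lemma korn_localized:
  fixes u :: "real^'n::finite \<Rightarrow> real^'n"
  assumes u: "weak_grad \<Omega> u Du" and \<phi>: "test_fn \<Omega> \<phi>"
  shows "(\<integral>x. (norm (\<phi> x *\<^sub>R Du x))\<^sup>2 \<partial>lebesgue) \<le>
     8 * (\<integral>x. (norm (\<phi> x *\<^sub>R sym_part (Du x)))\<^sup>2 \<partial>lebesgue) + 10 * (\<integral>x. (norm (tensor_grad \<phi> u x))\<^sup>2 \<partial>lebesgue)"
proof -
  define P where "P x = \<phi> x *\<^sub>R Du x" for x
  define S where "S x = tensor_grad \<phi> u x" for x
  define E where "E x = \<phi> x *\<^sub>R sym_part (Du x)" for x
  define D where "D x = P x + S x" for x
  note L = localized_L2c[OF u \<phi>]
  have Di: "L2c (\<lambda>x. D x $ b $ j)" for b j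
    unfolding D_def P_def S_def using L2c_add[OF L(1) L(2), of b j b j] by simp
  have int: "integrable lebesgue (\<lambda>x. (norm (P x))\<^sup>2)" "integrable lebesgue (\<lambda>x. (norm (S x))\<^sup>2)"
     "integrable lebesgue (\<lambda>x. (norm (E x))\<^sup>2)" "integrable lebesgue (\<lambda>x. (norm (D x))\<^sup>2)"
    unfolding P_def S_def E_def by (intro integrable_norm_square_matrix L Di)+
  have sym: "sym_part (D x) = E x + sym_part (S x)" for x
    by (simp add: D_def P_def E_def sym_part_def transpose_def vec_eq_iff algebra_simps)
  have symL: "L2c (\<lambda>x. sym_part (D x) $ b $ j)" for b j
    using L2c_mult_continuous[OF L2c_add[OF Di Di], of "\<lambda>_. 1/2" b j j b]
    by (simp add: sym_part_def transpose_def algebra_simps)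
  have g: "global_wgrad (\<lambda>x. \<phi> x * u x $ b) (\<lambda>j x. D x $ b $ j)" for b
    using global_wgrad_localize[OF u \<phi>, of b] by (simp add: D_def P_def S_def tensor_grad_def)
  have "(\<integral>x. (norm (D x))\<^sup>2 \<partial>lebesgue) \<le> 2 * (\<integral>x. (norm (sym_part (D x)))\<^sup>2 \<partial>lebesgue)"
    using korn[of "\<lambda>b x. \<phi> x * u x $ b" "\<lambda>b j x. D x $ b $ j", OF g] unfolding norm_sym_part_square unfolding norm_matrix_square .
  also have "(\<integral>x. (norm (sym_part (D x)))\<^sup>2 \<partial>lebesgue) \<le> (\<integral>x. 2 * (norm (E x))\<^sup>2 + 2 * (norm (S x))\<^sup>2 \<partial>lebesgue)"
  proof (rule integral_mono)
    fix x
    have "(norm (sym_part (S x)))\<^sup>2 \<le> (norm (S x))\<^sup>2" by (intro power_mono norm_sym_part_le) simp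
    then show "(norm (sym_part (D x)))\<^sup>2 \<le> 2 * (norm (E x))\<^sup>2 + 2 * (norm (S x))\<^sup>2"
      unfolding sym using norm_add_square_le[of "E x" "sym_part (S x)"] by linarith
  qed (use int integrable_norm_square_matrix[OF symL] in auto)
  also have "\<dots> = 2 * (\<integral>x. (norm (E x))\<^sup>2 \<partial>lebesgue) + 2 * (\<integral>x. (norm (S x))\<^sup>2 \<partial>lebesgue)"
    using int by simp
  finally have 1: "(\<integral>x. (norm (D x))\<^sup>2 \<partial>lebesgue) \<le> 4 * (\<integral>x. (norm (E x))\<^sup>2 \<partial>lebesgue) + 4 * (\<integral>x. (norm (S x))\<^sup>2 \<partial>lebesgue)"
    by simp
  have "(\<integral>x. (norm (P x))\<^sup>2 \<partial>lebesgue) \<le> (\<integral>x. 2 * (norm (D x))\<^sup>2 + 2 * (norm (S x))\<^sup>2 \<partial>lebesgue)"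
  proof (rule integral_mono)
    show "(norm (P x))\<^sup>2 \<le> 2 * (norm (D x))\<^sup>2 + 2 * (norm (S x))\<^sup>2" for x
      using norm_add_square_le[of "D x" "- S x"] by (simp add: D_def)
  qed (use int in auto)
  also have "\<dots> = 2 * (\<integral>x. (norm (D x))\<^sup>2 \<partial>lebesgue) + 2 * (\<integral>x. (norm (S x))\<^sup>2 \<partial>lebesgue)"
    using int by simp
  finally show ?thesis using 1 unfolding P_def[symmetric] S_def[symmetric] E_def[symmetric] by linarith
qed

lemma weak_grad_square_integrable:
  fixes u :: "real^'n::finite \<Rightarrow> real^'n"
  assumes "weak_grad \<Omega> u Du"
  shows "set_integrable lebesgue \<Omega> (\<lambda>x. (norm (u x))\<^sup>2)" "set_integrable lebesgue \<Omega> (\<lambda>x. (norm (Du x))\<^sup>2)"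
proof -
  have sq: "set_integrable lebesgue \<Omega> (\<lambda>x. (u x $ b)\<^sup>2)" "set_integrable lebesgue \<Omega> (\<lambda>x. (Du x $ b $ j)\<^sup>2)" for b j
    using assms by (auto simp: weak_grad_def L2_def)
  show "set_integrable lebesgue \<Omega> (\<lambda>x. (norm (u x))\<^sup>2)"
    unfolding norm_vec_square set_integrable_def scaleR_sum_right real_norm_def power2_abs
    by (intro Bochner_Integration.integrable_sum sq(1)[unfolded set_integrable_def])
  show "set_integrable lebesgue \<Omega> (\<lambda>x. (norm (Du x))\<^sup>2)"
    unfolding norm_matrix_square set_integrable_def scaleR_sum_right
    by (intro Bochner_Integration.integrable_sum sq(2)[unfolded set_integrable_def])
qed

text \<open>\<open>weak_solution\<close> brings its own gradient; this identifies it almost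
  everywhere, where \<phi> is nonzero, with any other weak gradient of \<open>u\<close>.\<close>

lemma weak_grad_unique:
  fixes u :: "real^'n::finite \<Rightarrow> real^'n"
  assumes u: "weak_grad \<Omega> u Du" "weak_grad \<Omega> u Du'" and \<phi>: "test_fn \<Omega> \<phi>"
  shows "AE x in lebesgue. \<phi> x *\<^sub>R Du x = \<phi> x *\<^sub>R Du' x"
proof -
  have "AE x in lebesgue. \<forall>b j. \<phi> x * Du x $ b $ j = \<phi> x * Du' x $ b $ j"
  proof (subst AE_all_countable, intro allI, subst AE_all_countable, intro allI)
    fix b j
    have "AE x in lebesgue. \<phi> x * Du x $ b $ j + partial j \<phi> x * u x $ b = \<phi> x * Du' x $ b $ j + partial j \<phi> x * u x $ b"
      by (rule global_wgrad_unique[OF global_wgrad_localize[OF u(1) \<phi>] global_wgrad_localize[OF u(2) \<phi>]])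
    then show "AE x in lebesgue. \<phi> x * Du x $ b $ j = \<phi> x * Du' x $ b $ j" by simp
  qed
  then show ?thesis by eventually_elim (simp add: vec_eq_iff)
qed

section \<open>Estimates on cubes\<close>

lemma open_cube: "open (cube R)" unfolding cube_def by (rule open_box)

lemma cube_lebesgue: "cube R \<in> sets lebesgue"
  by (rule sets_completionI_sets) (simp add: borel_open open_cube)

lemma cube_half_subset: "R \<ge> 0 \<Longrightarrow> cube (R / 2) \<subseteq> (cube R :: (real^'n::finite) set)"
  by (auto simp: cube_iff_infnorm)

lemma norm_tensor_grad_le:
  fixes u :: "real^'n::finite \<Rightarrow> real^'n"
  assumes "\<And>j. \<bar>partial j \<phi> x\<bar> \<le> c"
  shows "(norm (tensor_grad \<phi> u x))\<^sup>2 \<le> real CARD('n) * c\<^sup>2 * (norm (u x))\<^sup>2"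
proof -
  have "(norm (tensor_grad \<phi> u x))\<^sup>2 = (\<Sum>b\<in>UNIV. \<Sum>j\<in>UNIV. (partial j \<phi> x)\<^sup>2 * (u x $ b)\<^sup>2)"
    by (simp add: norm_matrix_square tensor_grad_def power_mult_distrib)
  also have "\<dots> \<le> (\<Sum>b\<in>(UNIV::'n set). \<Sum>j\<in>(UNIV::'n set). c\<^sup>2 * (u x $ b)\<^sup>2)"
  proof (intro sum_mono mult_right_mono)
    have "\<bar>partial j \<phi> x\<bar> \<le> \<bar>c\<bar>" for j using assms[of j] by linarith
    then show "(partial j \<phi> x)\<^sup>2 \<le> c\<^sup>2" for j by (simp only: abs_le_square_iff)
  qed simp
  also have "\<dots> = real CARD('n) * c\<^sup>2 * (norm (u x))\<^sup>2"
    by (simp add: norm_vec_square sum_distrib_left mult.assoc)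
  finally show ?thesis .
qed

lemma caccioppoli_large:
  fixes u :: "real^'n::finite \<Rightarrow> real^'n"
  assumes A: "elast_coeff A k1 k2" and k: "0 < k1" "0 < k2" and F: "open F" and t: "t \<ge> 1" and R: "R > 0"
    and u: "weak_grad (cube R) u Du" and sol: "weak_solution (cube R) (Lambda F t) A u"
    and \<phi>: "test_fn (cube R) \<phi>" "\<And>x. x \<in> cube (R / 2) \<Longrightarrow> \<phi> x = 1"
      "\<And>x j. \<bar>partial j \<phi> x\<bar> \<le> K / R" "\<And>x j. x \<in> F \<Longrightarrow> partial j \<phi> x = 0"
  shows "(LINT x:cube (R / 2)|lebesgue. (norm (Du x))\<^sup>2)
    \<le> (32 * k2 / k1 + 10) * real CARD('n) * K\<^sup>2 / R\<^sup>2 * (LINT x:cube R|lebesgue. (norm (u x))\<^sup>2)"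
proof -
  \<comment> \<open>The gradient for which the equation holds may differ from \<open>Du\<close>. All
    estimates are made for \<open>Du'\<close>, and only the left-hand integral is compared with
    \<open>Du\<close>, almost everywhere.\<close>
  obtain Du' where u': "weak_grad (cube R) u Du'" and sol': "\<And>v Dv. H10 (cube R) v \<Longrightarrow> weak_grad (cube R) v Dv \<Longrightarrow>
      (LINT x:cube R|lebesgue. Lambda F t x * elast_form A x (Du' x) (Dv x)) = 0"
    using sol unfolding weak_solution_def elast_form_def by blast
  define E where "E = (\<integral>x. (norm (\<phi> x *\<^sub>R sym_part (Du' x)))\<^sup>2 \<partial>lebesgue)"
  define T where "T = (\<integral>x. (norm (tensor_grad \<phi> u x))\<^sup>2 \<partial>lebesgue)"
  note L = localized_L2c[OF u' \<phi>(1)]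
  have "k1 * E \<le> 4 * k2 * T"
    unfolding E_def T_def by (rule elast_energy_estimate[OF A k open_cube F t u' \<phi>(1,4) sol'])
  then have ET: "E \<le> 4 * k2 / k1 * T" using k by (simp add: field_simps)
  have T: "T \<le> real CARD('n) * (K / R)\<^sup>2 * (LINT x:cube R|lebesgue. (norm (u x))\<^sup>2)"
  proof -
    have i: "integrable lebesgue (\<lambda>x. indicator (cube R) x *\<^sub>R (norm (u x))\<^sup>2)"
      using weak_grad_square_integrable(1)[OF u] unfolding set_integrable_def .
    have "T \<le> (\<integral>x. real CARD('n) * (K / R)\<^sup>2 * (indicator (cube R) x *\<^sub>R (norm (u x))\<^sup>2) \<partial>lebesgue)"
      unfolding T_def
    proof (rule integral_mono)
      fix x
      show "(norm (tensor_grad \<phi> u x))\<^sup>2 \<le> real CARD('n) * (K / R)\<^sup>2 * (indicator (cube R) x *\<^sub>R (norm (u x))\<^sup>2)"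
      proof (cases "x \<in> cube R")
        case True
        then show ?thesis using norm_tensor_grad_le[of \<phi> x "K / R" u] \<phi>(3) by simp
      next
        case False
        then have "tensor_grad \<phi> u x = 0"
          using test_fnD(4)[OF test_fn_partial[OF \<phi>(1)] False] by (simp add: tensor_grad_def vec_eq_iff)
        then show ?thesis using False by simp
      qed
    qed (use i integrable_norm_square_matrix[OF L(2)] in auto)
    then show ?thesis using i by (simp add: set_lebesgue_integral_def)
  qed
  have "(LINT x:cube (R / 2)|lebesgue. (norm (Du x))\<^sup>2) \<le> (\<integral>x. (norm (\<phi> x *\<^sub>R Du' x))\<^sup>2 \<partial>lebesgue)"
    unfolding set_lebesgue_integral_def
  proof (rule integral_mono_AE)
    show "integrable lebesgue (\<lambda>x. indicator (cube (R / 2)) x *\<^sub>R (norm (Du x))\<^sup>2)"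
      using set_integrable_subset[OF weak_grad_square_integrable(2)[OF u] cube_lebesgue cube_half_subset] R
      unfolding set_integrable_def by auto
    show "integrable lebesgue (\<lambda>x. (norm (\<phi> x *\<^sub>R Du' x))\<^sup>2)"
      by (intro integrable_norm_square_matrix L)
    show "AE x in lebesgue. indicator (cube (R / 2)) x *\<^sub>R (norm (Du x))\<^sup>2 \<le> (norm (\<phi> x *\<^sub>R Du' x))\<^sup>2"
      using weak_grad_unique[OF u u' \<phi>(1)]
    proof eventually_elim
      case (elim x)
      then show ?case using \<phi>(2)[of x] by (cases "x \<in> cube (R / 2)") auto
    qed
  qed
  also have "\<dots> \<le> 8 * E + 10 * T" unfolding E_def T_def by (rule korn_localized[OF u' \<phi>(1)])
  \<comment> \<open>Korn's factor 8 meets the energy bound \<open>4 * k2 / k1\<close>, which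
    produces the 32 of the final constant.\<close>
  also have "\<dots> \<le> 8 * (4 * k2 / k1 * T) + 10 * T" using ET by linarith
  also have "\<dots> = (32 * k2 / k1 + 10) * T" by (simp add: algebra_simps)
  also have "\<dots> \<le> (32 * k2 / k1 + 10) * (real CARD('n) * (K / R)\<^sup>2 * (LINT x:cube R|lebesgue. (norm (u x))\<^sup>2))"
    using T k by (intro mult_left_mono) auto
  finally show ?thesis by (simp add: power_divide mult.assoc)
qed

theorem theorem3p3:
  fixes Fam :: "(real^'n::finite) set set" and k1 k2 l :: real
  assumes "CARD('n) \<ge> 2"
    and "perforated Fam"
    and "0 < k1" and "0 < k2"
    and "1 \<le> l"
  shows "\<exists>C>0. \<forall>A \<delta> R (u :: real^'n \<Rightarrow> real^'n) Du.
           elast_coeff A k1 k2 \<and> 1 < \<delta> \<and> 32 \<le> R \<and>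
           weak_grad (cube R) u Du \<and>
           weak_solution (cube R) (Lambda (\<Union>Fam) (\<delta>\<^sup>2)) A u \<longrightarrow>
           (LINT x:cube (R/2)|lebesgue. (norm (Du x))\<^sup>2)
             \<le> C / R\<^sup>2 * (LINT x:cube R|lebesgue. (norm (u x))\<^sup>2)
               + C / R powr (2 * l) * (LINT x:cube R|lebesgue. (norm (Du x))\<^sup>2)"
proof -
  obtain K R0 where K: "K > 0" "R0 > 0"
    and cut: "\<And>R. R \<ge> R0 \<Longrightarrow> \<exists>\<phi>. test_fn (cube R) \<phi> \<and> (\<forall>x\<in>cube (R / 2). \<phi> x = 1) \<and>
        (\<forall>x j. \<bar>partial j \<phi> x\<bar> \<le> K / R) \<and> (\<forall>x\<in>\<Union>Fam. \<forall>j. partial j \<phi> x = 0)"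
    using cutoff_exists[OF assms(2)] by metis
  have F: "open (\<Union>Fam)" using assms(2) by (auto simp: perforated_def lipschitz_domain_def)
  define C1 where "C1 = (32 * k2 / k1 + 10) * real CARD('n) * K\<^sup>2"
  \<comment> \<open>\<open>C1\<close> serves \<open>R \<ge> R0\<close>. For smaller \<open>R\<close>
    the summand \<open>R0 powr (2 * l)\<close> makes the coefficient of the last integral at least
    1, and enlarging the cube is enough.\<close>
  define C where "C = C1 + R0 powr (2 * l)"
  have C1: "C1 \<ge> 0" using assms(3,4) by (simp add: C1_def)
  have C0: "C > 0" "C \<ge> C1" "C \<ge> R0 powr (2 * l)" using C1 K(2) by (simp_all add: C_def add_nonneg_pos)
  have "(LINT x:cube (R/2)|lebesgue. (norm (Du x))\<^sup>2)
             \<le> C / R\<^sup>2 * (LINT x:cube R|lebesgue. (norm (u x))\<^sup>2)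
               + C / R powr (2 * l) * (LINT x:cube R|lebesgue. (norm (Du x))\<^sup>2)"
    if A: "elast_coeff A k1 k2" and \<delta>: "1 < \<delta>" and R: "32 \<le> R" and u: "weak_grad (cube R) u Du"
      and sol: "weak_solution (cube R) (Lambda (\<Union>Fam) (\<delta>\<^sup>2)) A u"
    for A \<delta> R and u :: "real^'n \<Rightarrow> real^'n" and Du
  proof -
    define U where "U = (LINT x:cube R|lebesgue. (norm (u x))\<^sup>2)"
    define V where "V = (LINT x:cube R|lebesgue. (norm (Du x))\<^sup>2)"
    define W where "W = (LINT x:cube (R/2)|lebesgue. (norm (Du x))\<^sup>2)"
    have UV: "U \<ge> 0" "V \<ge> 0" unfolding U_def V_def set_lebesgue_integral_def by simp_all
    have "W \<le> C / R\<^sup>2 * U + C / R powr (2 * l) * V"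
    proof (cases "R \<ge> R0")
      case True
      then obtain \<phi> where \<phi>: "test_fn (cube R) \<phi>" "\<forall>x\<in>cube (R / 2). \<phi> x = 1"
        "\<forall>x j. \<bar>partial j \<phi> x\<bar> \<le> K / R" "\<forall>x\<in>\<Union>Fam. \<forall>j. partial j \<phi> x = 0"
        using cut by blast
      have "\<delta>\<^sup>2 \<ge> 1" using \<delta> by simp
      then have "W \<le> C1 / R\<^sup>2 * U"
        unfolding W_def U_def C1_def
        by (rule caccioppoli_large[OF A assms(3,4) F _ _ u sol \<phi>(1)]) (use \<phi> R in auto)
      also have "\<dots> \<le> C / R\<^sup>2 * U" using C0 UV by (intro mult_right_mono divide_right_mono) auto
      finally show ?thesis using C0 UV by (simp add: add_increasing2)
    next
      case False
      have i: "set_integrable lebesgue (cube R) (\<lambda>x. (norm (Du x))\<^sup>2)" by (rule weak_grad_square_integrable(2)[OF u])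
      have "W \<le> V"
        unfolding W_def V_def set_lebesgue_integral_def
      proof (rule integral_mono)
        show "integrable lebesgue (\<lambda>x. indicator (cube (R / 2)) x *\<^sub>R (norm (Du x))\<^sup>2)"
          using set_integrable_subset[OF i cube_lebesgue cube_half_subset] R
          unfolding set_integrable_def by auto
        show "integrable lebesgue (\<lambda>x. indicator (cube R) x *\<^sub>R (norm (Du x))\<^sup>2)"
          using i unfolding set_integrable_def .
        show "indicator (cube (R / 2)) x *\<^sub>R (norm (Du x))\<^sup>2 \<le> indicator (cube R) x *\<^sub>R (norm (Du x))\<^sup>2" for x
          using cube_half_subset[of R] R by (auto simp: indicator_def)
      qed
      also have "\<dots> = 1 * V" by simp
      also have "\<dots> \<le> C / R powr (2 * l) * V"
      proof (rule mult_right_mono)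
        have "R powr (2 * l) \<le> R0 powr (2 * l)" using False R assms(5) by (intro powr_mono2) auto
        then have "R powr (2 * l) \<le> C" using C0(3) by linarith
        then show "1 \<le> C / R powr (2 * l)" using R by (simp add: le_divide_eq)
      qed (rule UV)
      finally show ?thesis using C0 UV by (simp add: add_increasing)
    qed
    then show ?thesis unfolding U_def V_def W_def .
  qed
  then show ?thesis using C0(1) by (intro exI[of _ C]) blast
qed

end
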